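(* Consider the multivariate Fay-Herriot model described in the context, and assume: (i) $0<k<\infty$ and $0<s<\infty$ are fixed (not depending on $m$); (ii) there exist positive constants $\underline d,\overline d$ not depending on $m$ such that $\underline d\, I_k\le D_i\le\overline d\, I_k$ (Loewner order) for $i=1,\dots,m$; (iii) $X^\top X$ is nonsingular and $X^\top X/m$ converges to a positive definite matrix as $m\to\infty$. Let $\widehat\Psi$ be either $\widehat\Psi_0$ or $\widehat\Psi_1$ and let $\widehat\theta_a^{EB}=\widehat\theta_a(\widehat\Psi^+)$ be the corresponding empirical Bayes estimator of $\theta_a=X_a\beta+v_a$ for a given area $a$. Then its mean squared error matrix $\mathrm{MSEM}(\widehat\theta_a^{EB})=E[(\widehat\theta_a^{EB}-\theta_a)(\widehat\theta_a^{EB}-\theta_a)^\top]$ satisfies, as $m\to\infty$, $$\mathrm{MSEM}(\widehat\theta_a^{EB})=G_{1a}(\Psi)+G_{2a}(\Psi)+G_{3a}(\Psi)+O(m^{-3/2}),$$ where $$G_{1a}(\Psi)=(\Psi^{-1}+D_a^{-1})^{-1}=\Psi(\Psi+D_a)^{-1}D_a,$$ $$G_{2a}(\Psi)=D_a(\Psi+D_a)^{-1}X_a\{X^\top(I_m\otimes\Psi+D)^{-1}X\}^{-1}X_a^\top(\Psi+D_a)^{-1}D_a,$$ $$G_{3a}(\Psi)=\frac1{m^2}D_a(\Psi+D_a)^{-1}\Big[\sum_{i=1}^m(\Psi+D_i)(\Psi+D_a)^{-1}(\Psi+D_i)+\sum_{i=1}^m\mathrm{tr}\big[(\Psi+D_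i)(\Psi+D_a)^{-1}\big](\Psi+D_i)\Big](\Psi+D_a)^{-1}D_a.$$
   Context: Model: for $i=1,\dots,m$, $y_i=X_i\beta+v_i+\varepsilon_i$, where $y_i\in\mathbb R^k$ is observed, $X_i$ is a known nonrandom $k\times s$ matrix, $\beta\in\mathbb R^s$ is a fixed unknown vector, and all the $v_i,\varepsilon_i$ are mutually independent with $v_i\sim\mathcal N_k(0,\Psi)$, $\varepsilon_i\sim\mathcal N_k(0,D_i)$. Here $\Psi$ is a fixed unknown nonsingular $k\times k$ covariance matrix and the $D_i$ are known $k\times k$ covariance matrices. The asymptotics are $m\to\infty$ along a sequence $(X_i,D_i)_{i\ge1}$ with $k,s,\beta,\Psi$ and the area index $a$ fixed. Write $y=(y_1^\top,\dots,y_m^\top)^\top$, $X=(X_1^\top,\dots,X_m^\top)^\top$ and $D=\text{block diag}(D_1,\dots,D_m)$. Generalized least squares: for a nonnegative definite matrix $\Psi$, $$\widehat\beta(\Psi)=\Big\{\sum_{i=1}^m X_i^\top(\Psi+D_i)^{-1}X_i\Big\}^{-1}\sum_{i=1}^m X_i^\top(\Psi+D_i)^{-1}y_i .$$ Ordinary least squares: $\widetilde\beta=(X^\top X)^{-1}X^\top y$. Predictor: $\widehat\theta_a(\Psi)=y_a-D_a(\Psi+D_a)^{-1}\{y_a-X_a\widehat\beta(\Psi)\}$. Estimators of $\Psi$: $$\widehat\Psi_0=\frac1m\sum_{i=1}^m\big\{(y_i-X_i\widetilde\beta)(y_i-X_i\widetilde\beta)^\top-D_i\big\},\qquad \widehat\Psi_1=\widehat\Psi_0-\mathrm{Bias}_{\widehat\Psi_0}(\widehat\Psi_0),$$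 where, for a symmetric $k\times k$ matrix $\Psi$, $$\mathrm{Bias}_{\widehat\Psi_0}(\Psi)=\frac1m\sum_{i=1}^m X_i(X^\top X)^{-1}\Big\{\sum_{j=1}^m X_j^\top(\Psi+D_j)X_j\Big\}(X^\top X)^{-1}X_i^\top-\frac1m\sum_{i=1}^m(\Psi+D_i)X_i(X^\top X)^{-1}X_i^\top-\frac1m\sum_{i=1}^m X_i(X^\top X)^{-1}X_i^\top(\Psi+D_i).$$ Nonnegative definite modification: if $\widehat\Psi=H\Lambda H^\top$ with $H$ orthogonal and $\Lambda=\mathrm{diag}(\lambda_1,\dots,\lambda_k)$, then $\widehat\Psi^+=H\Lambda^+H^\top$ with $\Lambda^+=\mathrm{diag}(\max\{0,\lambda_1\},\dots,\max\{0,\lambda_k\})$. *)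

theory Defs
  imports "HOL-Probability.Probability"
begin

section \<open>Matrices of fixed size\<close>

definition diag_mat :: "real^'k \<Rightarrow> real^'k^'k" where
  "diag_mat l = (\<chi> i j. if i = j then l $ i else 0)"

definition outer :: "real^'k \<Rightarrow> real^'k \<Rightarrow> real^'k^'k" where
  "outer u w = (\<chi> i j. u $ i * w $ j)"

definition psd :: "real^'k^'k \<Rightarrow> bool" where
  "psd A \<longleftrightarrow> transpose A = A \<and> (\<forall>x. 0 \<le> x \<bullet> (A *v x))"

definition pos_def :: "real^'k^'k \<Rightarrow> bool" where
  "pos_def A \<longleftrightarrow> transpose A = A \<and> (\<forall>x. x \<noteq> 0 \<longrightarrow> 0 < x \<bullet> (A *v x))"

definition loewner_le :: "real^'k^'k \<Rightarrow> real^'k^'k \<Rightarrow> bool" where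
  "loewner_le A B \<longleftrightarrow> psd (B - A)"

text \<open>The nonnegative definite modification of a symmetric matrix. The result does not depend
  on the spectral decomposition, so the description is definite for every symmetric argument.\<close>

definition psd_part :: "real^'k^'k \<Rightarrow> real^'k^'k" where
  "psd_part A = (THE B. \<exists>H l. orthogonal_matrix H \<and>
      A = H ** diag_mat l ** transpose H \<and>
      B = H ** diag_mat (\<chi> i. max 0 (l $ i)) ** transpose H)"

text \<open>Lebesgue density of the normal law with mean \<open>mu\<close> and nonsingular covariance matrix \<open>S\<close>.\<close>

definition mvn_density :: "real^'k \<Rightarrow> real^'k^'k \<Rightarrow> real^'k \<Rightarrow> real" where
  "mvn_density mu S x =
     exp (- ((x - mu) \<bullet> (matrix_inv S *v (x - mu))) / 2) / sqrt ((2 * pi) ^ CARD('k) * det S)"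

section \<open>Stacked vectors and matrices\<close>

text \<open>Areas are numbered from \<open>0\<close>, so the first \<open>m\<close> areas are \<open>{..<m}\<close>. Since \<open>m\<close> varies,
  a row of a stacked object is addressed by a pair (area, row within the area), and the stacked
  object for \<open>m\<close> areas is the restriction to the row set \<open>stack_rows m\<close>.\<close>

definition stack_rows :: "nat \<Rightarrow> (nat \<times> 'k) set" where
  "stack_rows m = {..<m} \<times> UNIV"

definition stack_mat :: "(nat \<Rightarrow> real^'s^'k) \<Rightarrow> nat \<times> 'k \<Rightarrow> 's \<Rightarrow> real" where
  "stack_mat X = (\<lambda>(i, r) c. X i $ r $ c)"

definition stack_vec :: "(nat \<Rightarrow> real^'k) \<Rightarrow> nat \<times> 'k \<Rightarrow> real" where
  "stack_vec y = (\<lambda>(i, r). y i $ r)"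

definition block_diag :: "(nat \<Rightarrow> real^'k^'k) \<Rightarrow> nat \<times> 'k \<Rightarrow> nat \<times> 'k \<Rightarrow> real" where
  "block_diag D = (\<lambda>(i, r) (j, q). if i = j then D i $ r $ q else 0)"

definition kron_id :: "real^'k^'k \<Rightarrow> nat \<times> 'k \<Rightarrow> nat \<times> 'k \<Rightarrow> real" where
  "kron_id Psi = (\<lambda>(i, r) (j, q). (if i = j then 1 else 0) * Psi $ r $ q)"

text \<open>Inverse of a square matrix with rows and columns indexed by the finite set \<open>I\<close>, extended
  by \<open>0\<close> outside \<open>I\<close> to make it unique as a function.\<close>

definition inv_on :: "'i set \<Rightarrow> ('i \<Rightarrow> 'i \<Rightarrow> real) \<Rightarrow> 'i \<Rightarrow> 'i \<Rightarrow> real" where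
  "inv_on I A = (THE B.
      (\<forall>p q. p \<notin> I \<or> q \<notin> I \<longrightarrow> B p q = 0) \<and>
      (\<forall>p\<in>I. \<forall>q\<in>I. (\<Sum>r\<in>I. A p r * B r q) = (if p = q then 1 else 0)) \<and>
      (\<forall>p\<in>I. \<forall>q\<in>I. (\<Sum>r\<in>I. B p r * A r q) = (if p = q then 1 else 0)))"

definition XtX :: "(nat \<Rightarrow> real^'s^'k) \<Rightarrow> nat \<Rightarrow> real^'s^'s" where
  "XtX X m = (\<chi> c d. \<Sum>p\<in>stack_rows m. stack_mat X p c * stack_mat X p d)"

definition Xty :: "(nat \<Rightarrow> real^'s^'k) \<Rightarrow> nat \<Rightarrow> (nat \<Rightarrow> real^'k) \<Rightarrow> real^'s" where
  "Xty X m y = (\<chi> c. \<Sum>p\<in>stack_rows m. stack_mat X p c * stack_vec y p)"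

text \<open>\<open>XtVinvX X D m Psi\<close> is \<open>X\<^sup>T (I\<^sub>m \<otimes> Psi + D)\<^sup>-\<^sup>1 X\<close>.\<close>

definition XtVinvX ::
  "(nat \<Rightarrow> real^'s^'k) \<Rightarrow> (nat \<Rightarrow> real^'k^'k) \<Rightarrow> nat \<Rightarrow> real^'k^'k \<Rightarrow> real^'s^'s" where
  "XtVinvX X D m Psi = (\<chi> c d. \<Sum>p\<in>stack_rows m. \<Sum>q\<in>stack_rows m.
     stack_mat X p c * inv_on (stack_rows m) (\<lambda>p q. kron_id Psi p q + block_diag D p q) p q
       * stack_mat X q d)"

section \<open>Estimators and predictor\<close>

definition gls :: "(nat \<Rightarrow> real^'s^'k) \<Rightarrow> (nat \<Rightarrow> real^'k^'k) \<Rightarrow> nat \<Rightarrow> real^'k^'k \<Rightarrow>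
    (nat \<Rightarrow> real^'k) \<Rightarrow> real^'s" where
  "gls X D m Psi y =
     matrix_inv (\<Sum>i<m. transpose (X i) ** matrix_inv (Psi + D i) ** X i) *v
       (\<Sum>i<m. (transpose (X i) ** matrix_inv (Psi + D i)) *v y i)"

definition ols :: "(nat \<Rightarrow> real^'s^'k) \<Rightarrow> nat \<Rightarrow> (nat \<Rightarrow> real^'k) \<Rightarrow> real^'s" where
  "ols X m y = matrix_inv (XtX X m) *v Xty X m y"

definition theta_hat :: "(nat \<Rightarrow> real^'s^'k) \<Rightarrow> (nat \<Rightarrow> real^'k^'k) \<Rightarrow> nat \<Rightarrow> nat \<Rightarrow>
    real^'k^'k \<Rightarrow> (nat \<Rightarrow> real^'k) \<Rightarrow> real^'k" where
  "theta_hat X D a m Psi y =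
     y a - (D a ** matrix_inv (Psi + D a)) *v (y a - X a *v gls X D m Psi y)"

definition Psi0_hat :: "(nat \<Rightarrow> real^'s^'k) \<Rightarrow> (nat \<Rightarrow> real^'k^'k) \<Rightarrow> nat \<Rightarrow>
    (nat \<Rightarrow> real^'k) \<Rightarrow> real^'k^'k" where
  "Psi0_hat X D m y = (1 / real m) *\<^sub>R
     (\<Sum>i<m. outer (y i - X i *v ols X m y) (y i - X i *v ols X m y) - D i)"

definition Bias0 :: "(nat \<Rightarrow> real^'s^'k) \<Rightarrow> (nat \<Rightarrow> real^'k^'k) \<Rightarrow> nat \<Rightarrow>
    real^'k^'k \<Rightarrow> real^'k^'k" where
  "Bias0 X D m Psi =
     (1 / real m) *\<^sub>R (\<Sum>i<m. X i ** matrix_inv (XtX X m) **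
        (\<Sum>j<m. transpose (X j) ** (Psi + D j) ** X j) **
        matrix_inv (XtX X m) ** transpose (X i))
   - (1 / real m) *\<^sub>R (\<Sum>i<m. (Psi + D i) ** X i ** matrix_inv (XtX X m) ** transpose (X i))
   - (1 / real m) *\<^sub>R (\<Sum>i<m. X i ** matrix_inv (XtX X m) ** transpose (X i) ** (Psi + D i))"

definition Psi1_hat :: "(nat \<Rightarrow> real^'s^'k) \<Rightarrow> (nat \<Rightarrow> real^'k^'k) \<Rightarrow> nat \<Rightarrow>
    (nat \<Rightarrow> real^'k) \<Rightarrow> real^'k^'k" where
  "Psi1_hat X D m y = Psi0_hat X D m y - Bias0 X D m (Psi0_hat X D m y)"

section \<open>Mean squared error and its approximation\<close>

definition MSEM :: "'a measure \<Rightarrow> ('a \<Rightarrow> real^'k) \<Rightarrow> ('a \<Rightarrow> real^'k) \<Rightarrow> real^'k^'k" where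
  "MSEM M est theta = (LINT w|M. outer (est w - theta w) (est w - theta w))"

definition G1 :: "(nat \<Rightarrow> real^'k^'k) \<Rightarrow> nat \<Rightarrow> real^'k^'k \<Rightarrow> real^'k^'k" where
  "G1 D a Psi = matrix_inv (matrix_inv Psi + matrix_inv (D a))"

definition G2 :: "(nat \<Rightarrow> real^'s^'k) \<Rightarrow> (nat \<Rightarrow> real^'k^'k) \<Rightarrow> nat \<Rightarrow> nat \<Rightarrow>
    real^'k^'k \<Rightarrow> real^'k^'k" where
  "G2 X D a m Psi = D a ** matrix_inv (Psi + D a) ** X a ** matrix_inv (XtVinvX X D m Psi) **
     transpose (X a) ** matrix_inv (Psi + D a) ** D a"

definition G3 :: "(nat \<Rightarrow> real^'k^'k) \<Rightarrow> nat \<Rightarrow> nat \<Rightarrow> real^'k^'k \<Rightarrow> real^'k^'k" where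
  "G3 D a m Psi = (1 / (real m)\<^sup>2) *\<^sub>R
     (D a ** matrix_inv (Psi + D a) **
      ((\<Sum>i<m. (Psi + D i) ** matrix_inv (Psi + D a) ** (Psi + D i)) +
       (\<Sum>i<m. trace ((Psi + D i) ** matrix_inv (Psi + D a)) *\<^sub>R (Psi + D i))) **
      matrix_inv (Psi + D a) ** D a)"

end

theory Submission
  imports Defs
begin

text \<open>With \<open>u\<^sub>i = v\<^sub>i + \<epsilon>\<^sub>i\<close> and \<open>K = D\<^sub>a (\<Psi> + D\<^sub>a)\<^sup>-\<^sup>1\<close>, the error of the predictor is the Bayes error
  \<open>\<epsilon>\<^sub>a - K u\<^sub>a\<close> plus a function of the \<open>u\<^sub>i\<close>. The joint density of \<open>(v\<^sub>a, \<epsilon>\<^sub>a)\<close> is invariant under the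
  reflection that keeps \<open>u\<^sub>a\<close> and changes the sign of the Bayes error; hence the two summands are
  orthogonal, and the first contributes \<open>G1\<close>. The second equals
  \<open>K (\<Delta> (\<Psi> + D\<^sub>a)\<^sup>-\<^sup>1 u\<^sub>a + X\<^sub>a b)\<close> up to a remainder of order \<open>1/m\<close> in every \<open>L\<^sup>p\<close>, where \<open>\<Delta>\<close> is the
  average over the areas other than \<open>a\<close> of \<open>u\<^sub>i u\<^sub>i\<^sup>T - (\<Psi> + D\<^sub>i)\<close> and \<open>b\<close> is the error of generalized
  least squares at the true \<open>\<Psi>\<close>, again without area \<open>a\<close>. As \<open>u\<^sub>a\<close> is independent of \<open>\<Delta>\<close> and \<open>b\<close>, the
  two parts of this leading term are uncorrelated; they give \<open>G3\<close> and \<open>G2\<close>. The leading term is of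
  order \<open>m\<^bsup>-1/2\<^esup>\<close>, so the remainder costs \<open>m\<^bsup>-3/2\<^esup>\<close>. Replacing the estimator by its nonnegative
  definite part is harmless because it does nothing near \<open>\<Psi>\<close>.\<close>

text \<open>The estimated matrix and the least squares errors are built from the same u_i, so
  products of dependent factors occur throughout; working with all moments at once avoids tracking
  exponents through Hoelder's inequality. The factors that are not polynomial are inverses. Since
  D_i is at least \<open>dlo\<close>, the inverse of B + D_i is bounded, and the inverse of the
  weighted cross product matrix grows only linearly in B, so no event of small probability has to be
  cut off. The critical term is the change in generalized least squares caused by estimating Psi. A
  norm bound gives only m^(-1/2) there, because it destroys the cancellation in sums of the u_i. The
  gain comes from the normal equations at the true Psi, which remove the term of order zero, and
  from taking the entries of the estimation error out of the sums. Residuals in place of the u_i,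
  the bias correction and the omission of area a each change the estimator by O(1/m), so both
  estimators have the same leading term. The two sums in \<open>G3\<close> are the two nontrivial
  pairings in the fourth moment of a normal vector.\<close>

declare transpose_matrix_vector [simp del]

section \<open>Matrices\<close>

lemma norm_matrix_vector_le: "norm (A *v x) \<le> norm A * norm (x::real^'n)" for A :: "real^'n^'m"
proof -
  have "norm (A *v x) \<le> L2_set (\<lambda>i. norm (A $ i) * norm x) UNIV"
    unfolding norm_vec_def[of "A *v x"]
    by (rule L2_set_mono) (auto simp: matrix_vector_mul_component Cauchy_Schwarz_ineq2)
  also have "\<dots> = norm A * norm x"
    unfolding norm_vec_def[of A] by (simp add: L2_set_left_distrib)
  finally show ?thesis .
qed

lemma norm_transpose: "norm (transpose A) = norm A" for A :: "real^'n^'m"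
proof -
  have "(norm (transpose A))\<^sup>2 = (norm A)\<^sup>2"
    unfolding power2_norm_eq_inner inner_vec_def transpose_def
    by simp (rule sum.swap)
  then show ?thesis by (simp add: power2_eq_iff_nonneg)
qed

lemma matrix_mult_row: "(A ** B) $ i = transpose B *v (A $ i)" for A :: "real^'n^'m"
  by (simp add: vec_eq_iff matrix_matrix_mult_def matrix_vector_mult_def transpose_def mult.commute)

lemma norm_matrix_mult_le: "norm (A ** B) \<le> norm A * norm B" for A :: "real^'n^'m" and B :: "real^'p^'n"
proof -
  have "norm (A ** B) \<le> L2_set (\<lambda>i. norm (A $ i) * norm B) UNIV"
    unfolding norm_vec_def[of "A ** B"]
  proof (rule L2_set_mono)
    fix i
    show "norm ((A ** B) $ i) \<le> norm (A $ i) * norm B"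
      using norm_matrix_vector_le[of "transpose B" "A $ i"]
      by (simp add: matrix_mult_row norm_transpose mult.commute)
  qed auto
  also have "\<dots> = norm A * norm B"
    unfolding norm_vec_def[of A] by (simp add: L2_set_left_distrib)
  finally show ?thesis .
qed

lemma norm_matrix_mult_mono: "norm A \<le> x \<Longrightarrow> norm B \<le> y \<Longrightarrow> norm (A ** B) \<le> x * y"
  for A :: "real^'n^'m" and B :: "real^'p^'n"
  by (rule order_trans[OF norm_matrix_mult_le mult_mono]) (auto intro: order_trans[OF norm_ge_zero])

lemma norm_matrix_vector_mono: "norm A \<le> x \<Longrightarrow> norm B \<le> y \<Longrightarrow> norm (A *v B) \<le> x * y"
  for A :: "real^'n^'m" and B :: "real^'n"
  by (rule order_trans[OF norm_matrix_vector_le mult_mono]) (auto intro: order_trans[OF norm_ge_zero])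

lemma bounded_bilinear_matrix_mult:
  "bounded_bilinear ((**) :: real^'n^'m \<Rightarrow> real^'p^'n \<Rightarrow> real^'p^'m)"
proof
  fix a a' :: "real^'n^'m" and b b' :: "real^'p^'n" and r :: real
  show "(a + a') ** b = a ** b + a' ** b" "a ** (b + b') = a ** b + a ** b'"
    by (simp_all add: vec_eq_iff matrix_matrix_mult_def sum.distrib algebra_simps)
  show "(r *\<^sub>R a) ** b = r *\<^sub>R (a ** b)" "a ** (r *\<^sub>R b) = r *\<^sub>R (a ** b)"
    by (simp_all add: vec_eq_iff matrix_matrix_mult_def sum_distrib_left algebra_simps)
  show "\<exists>K. \<forall>a b. norm ((a::real^'n^'m) ** (b::real^'p^'n)) \<le> norm a * norm b * K"
    by (rule exI[of _ 1]) (simp add: norm_matrix_mult_le)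
qed

lemma bounded_bilinear_matrix_vector:
  "bounded_bilinear ((*v) :: real^'n^'m \<Rightarrow> real^'n \<Rightarrow> real^'m)"
proof
  fix a a' :: "real^'n^'m" and b b' :: "real^'n" and r :: real
  show "(a + a') *v b = a *v b + a' *v b" "a *v (b + b') = a *v b + a *v b'"
    by (simp_all add: algebra_simps)
  show "(r *\<^sub>R a) *v b = r *\<^sub>R (a *v b)" "a *v (r *\<^sub>R b) = r *\<^sub>R (a *v b)"
    by (simp_all add: vec_eq_iff matrix_vector_mult_def sum_distrib_left algebra_simps)
  show "\<exists>K. \<forall>a b. norm ((a::real^'n^'m) *v (b::real^'n)) \<le> norm a * norm b * K"
    by (rule exI[of _ 1]) (simp add: norm_matrix_vector_le)
qed

interpretation mm: bounded_bilinear "(**) :: real^'n^'m \<Rightarrow> real^'p^'n \<Rightarrow> real^'p^'m"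
  by (rule bounded_bilinear_matrix_mult)

interpretation mv: bounded_bilinear "(*v) :: real^'n^'m \<Rightarrow> real^'n \<Rightarrow> real^'m"
  by (rule bounded_bilinear_matrix_vector)

lemma norm_outer: "norm (outer u w) = norm u * norm w"
proof -
  have "outer u w $ i = u $ i *\<^sub>R w" for i
    by (simp add: outer_def vec_eq_iff)
  then show ?thesis
    unfolding norm_vec_def[of "outer u w"] norm_vec_def[of u] by (simp add: L2_set_left_distrib)
qed

lemma bounded_bilinear_outer: "bounded_bilinear (outer :: real^'k \<Rightarrow> _)"
proof
  fix a a' b b' :: "real^'k" and r :: real
  show "outer (a + a') b = outer a b + outer a' b" "outer a (b + b') = outer a b + outer a b'"
    "outer (r *\<^sub>R a) b = r *\<^sub>R outer a b" "outer a (r *\<^sub>R b) = r *\<^sub>R outer a b"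
    by (simp_all add: vec_eq_iff outer_def algebra_simps)
  show "\<exists>K. \<forall>a b. norm (outer (a::real^'k) (b::real^'k)) \<le> norm a * norm b * K"
    by (rule exI[of _ 1]) (simp add: norm_outer)
qed

interpretation outer: bounded_bilinear "outer :: real^'k \<Rightarrow> _"
  by (rule bounded_bilinear_outer)

lemma outer_nth [simp]: "outer u w $ i $ j = u $ i * w $ j"
  by (simp add: outer_def)

lemma outer_mult: "outer (A *v x) (B *v y) = A ** outer x y ** transpose B" for A B :: "real^'n^'m"
  by (simp add: vec_eq_iff outer_def matrix_matrix_mult_def matrix_vector_mult_def transpose_def
      sum_product sum_distrib_right sum_distrib_left mult_ac)

lemma transpose_outer: "transpose (outer u w) = outer w u"
  by (simp add: vec_eq_iff transpose_def)

lemma outer_mult_vector: "outer u w *v x = (w \<bullet> x) *\<^sub>R u"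
  by (simp add: vec_eq_iff matrix_vector_mult_def inner_vec_def sum_distrib_right sum_distrib_left mult_ac)

lemma transpose_add: "transpose (A + B) = transpose A + transpose B"
  by (simp add: vec_eq_iff transpose_def)

lemma transpose_diff: "transpose (A - B) = transpose A - transpose B"
  by (simp add: vec_eq_iff transpose_def)

lemma bounded_linear_transpose: "bounded_linear (transpose :: real^'n^'m \<Rightarrow> real^'m^'n)"
  by (rule bounded_linear_intro[where K=1]) (simp_all add: transpose_add transpose_scalar norm_transpose)

lemma transpose_sum: "transpose (\<Sum>i\<in>I. A i) = (\<Sum>i\<in>I. transpose (A i))"
  by (simp add: vec_eq_iff transpose_def)

lemma inner_matrix_vector: "x \<bullet> (A *v y) = (transpose A *v x) \<bullet> y" for A :: "real^'n^'m"
  by (simp add: transpose_matrix_vector dot_lmul_matrix)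

text \<open>The norm is the Euclidean norm of all entries. It is at most the sum of the norms of the
  columns, and each column is the image of a unit vector. This is the origin of the
  \<open>CARD\<close> factor in the later bounds on inverses and on the D_i.\<close>

lemma norm_matrix_le_card:
  fixes c :: real
  assumes "\<And>x. norm (A *v x) \<le> c * norm x"
  shows "norm (A :: real^'n^'m) \<le> CARD('n) * c"
proof -
  have "norm (transpose A) \<le> (\<Sum>j\<in>UNIV. norm (transpose A $ j))"
    unfolding norm_vec_def[of "transpose A"] by (rule L2_set_le_sum) simp
  also have "\<dots> \<le> (\<Sum>j\<in>(UNIV::'n set). c)"
  proof (rule sum_mono)
    fix j :: 'n
    have "transpose A $ j = A *v axis j 1"
      by (simp add: vec_eq_iff transpose_def matrix_vector_mult_def axis_def if_distrib cong: if_cong)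
    then show "norm (transpose A $ j) \<le> c" using assms[of "axis j 1"] by simp
  qed
  finally show ?thesis by (simp add: norm_transpose)
qed

section \<open>Inverses, coercive and semidefinite quadratic forms\<close>

lemma matrix_inv_mult:
  assumes "invertible A"
  shows "matrix_inv A ** A = mat 1" "A ** matrix_inv A = mat 1"
  using assms someI_ex[of "\<lambda>A'. A ** A' = mat 1 \<and> A' ** A = mat 1"]
  unfolding invertible_def matrix_inv_def by blast+

lemma matrix_inv_unique:
  fixes A :: "real^'n^'n"
  assumes "A ** B = mat 1"
  shows "matrix_inv A = B" "invertible A"
proof -
  have "B ** A = mat 1" using assms matrix_left_right_inverse by blast
  then show inv: "invertible A" using assms unfolding invertible_def by blast
  have "matrix_inv A = matrix_inv A ** (A ** B)" by (simp add: assms)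
  also have "\<dots> = B" by (simp add: matrix_mul_assoc matrix_inv_mult(1)[OF inv])
  finally show "matrix_inv A = B" .
qed

lemma matrix_inv_vector:
  assumes "invertible (A :: real^'n^'n)"
  shows "matrix_inv A *v (A *v x) = x" "A *v (matrix_inv A *v x) = x"
  using matrix_inv_mult[OF assms] by (simp_all add: matrix_vector_mul_assoc)

lemma transpose_matrix_inv:
  fixes A :: "real^'n^'n"
  assumes "invertible A" "transpose A = A"
  shows "transpose (matrix_inv A) = matrix_inv A"
proof -
  have "A ** transpose (matrix_inv A) = transpose (matrix_inv A ** A)"
    by (simp add: matrix_transpose_mul assms)
  then have "A ** transpose (matrix_inv A) = mat 1"
    by (simp add: matrix_inv_mult[OF assms(1)])
  from matrix_inv_unique(1)[OF this] show ?thesis by simp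
qed

text \<open>Cauchy-Schwarz turns coercivity into \<open>d * norm x \<le> norm (A *v x)\<close>. This
  makes A injective, hence invertible, and bounds its inverse as an operator by 1/d.\<close>

lemma coercive_inverse:
  fixes A :: "real^'n^'n"
  assumes d: "d > 0" and co: "\<And>x. d * (x \<bullet> x) \<le> x \<bullet> (A *v x)"
  shows "invertible A" "norm (matrix_inv A) \<le> CARD('n) / d"
proof -
  have ge: "d * norm x \<le> norm (A *v x)" for x
  proof (cases "x = 0")
    case False
    have "norm x * (d * norm x) \<le> norm x * norm (A *v x)"
      using order_trans[OF co[of x] norm_cauchy_schwarz[of x "A *v x"]]
      by (simp add: dot_square_norm power2_eq_square mult.left_commute)
    then show ?thesis using False by simp
  qed auto
  have "\<forall>x. A *v x = 0 \<longrightarrow> x = 0"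
  proof (intro allI impI)
    fix x assume "A *v x = 0"
    then show "x = 0" using ge[of x] d by (simp add: mult_le_0_iff)
  qed
  then have "\<exists>B. B ** A = mat 1" by (simp add: matrix_left_invertible_ker)
  then show inv: "invertible A" by (simp add: invertible_left_inverse)
  have "norm (matrix_inv A *v x) \<le> (1/d) * norm x" for x
    using ge[of "matrix_inv A *v x"] d by (simp add: matrix_inv_vector[OF inv] field_simps)
  from norm_matrix_le_card[OF this] show "norm (matrix_inv A) \<le> CARD('n) / d" by simp
qed

lemma inner_matrix_le_norm: "x \<bullet> (A *v x) \<le> norm A * (x \<bullet> x)" for A :: "real^'n^'n"
proof -
  have "x \<bullet> (A *v x) \<le> norm x * norm (A *v x)" by (rule norm_cauchy_schwarz)
  also have "\<dots> \<le> norm x * (norm A * norm x)"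
    by (intro mult_left_mono norm_matrix_vector_le) auto
  finally show ?thesis by (simp add: dot_square_norm power2_eq_square mult_ac)
qed

lemma inner_matrix_ge_norm: "- norm A * (x \<bullet> x) \<le> x \<bullet> (A *v x)" for A :: "real^'n^'n"
  using inner_matrix_le_norm[of x "- A"] by (simp add: mv.minus_left)

text \<open>The form of A at x + t y is a nonnegative polynomial in t of degree at most two; its
  discriminant gives the inequality. A vanishing leading coefficient has to be treated apart, since
  A may be singular.\<close>

lemma psd_Cauchy_Schwarz:
  assumes "psd A"
  shows "(x \<bullet> (A *v y))\<^sup>2 \<le> (x \<bullet> (A *v x)) * (y \<bullet> (A *v y))"
proof -
  let ?a = "y \<bullet> (A *v y)" and ?b = "x \<bullet> (A *v y)" and ?c = "x \<bullet> (A *v x)"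
  have sym: "transpose A = A" using assms by (simp add: psd_def)
  have yx: "y \<bullet> (A *v x) = ?b"
    by (subst inner_matrix_vector) (simp add: sym inner_commute)
  have nn: "0 \<le> ?c + 2 * t * ?b + t\<^sup>2 * ?a" for t
  proof -
    have "0 \<le> (x + t *\<^sub>R y) \<bullet> (A *v (x + t *\<^sub>R y))" using assms by (simp add: psd_def)
    also have "\<dots> = ?c + 2 * t * ?b + t\<^sup>2 * ?a"
      by (simp add: inner_add_left inner_add_right mv.add_right mv.scaleR_right yx power2_eq_square algebra_simps)
    finally show ?thesis .
  qed
  have a0: "0 \<le> ?a" using assms by (simp add: psd_def)
  show ?thesis
  proof (cases "?a = 0")
    case True
    have "?b = 0"
    proof (rule ccontr)
      assume b: "?b \<noteq> 0"
      \<comment> \<open>This t gives the affine function the value -1, so a nonzero slope is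
        impossible.\<close>
      have "0 \<le> ?c + 2 * (- (?c + 1) / (2 * ?b)) * ?b" using nn[of "- (?c + 1) / (2 * ?b)"] True by simp
      also have "\<dots> = -1" using b by (simp add: field_simps)
      finally show False by simp
    qed
    then show ?thesis using True by simp
  next
    case False
    with a0 have "?a > 0" by simp
    \<comment> \<open>The minimizer of the quadratic polynomial.\<close>
    have "0 \<le> ?c + 2 * (- ?b / ?a) * ?b + (- ?b / ?a)\<^sup>2 * ?a" by (rule nn)
    also have "\<dots> = ?c - ?b\<^sup>2 / ?a"
      using \<open>?a > 0\<close> by (simp add: field_simps power2_eq_square)
    finally show ?thesis using \<open>?a > 0\<close> by (simp add: field_simps)
  qed
qed

text \<open>Cauchy-Schwarz for the form of A, taken at Ax and x, bounds the square of |Ax|^2 by s^2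
  |Ax|^2 |x|^2.\<close>

lemma norm_psd_le:
  fixes s :: real
  assumes A: "psd (A :: real^'n^'n)" and le: "\<And>x. x \<bullet> (A *v x) \<le> s * (x \<bullet> x)"
  shows "norm A \<le> CARD('n) * s"
proof (rule norm_matrix_le_card)
  have s: "0 \<le> s"
  proof -
    have "0 \<le> axis undefined 1 \<bullet> (A *v axis undefined 1)" using A by (simp add: psd_def)
    also have "\<dots> \<le> s" using le[of "axis undefined 1"] by (simp add: dot_square_norm)
    finally show ?thesis .
  qed
  fix x
  let ?z = "A *v x"
  have "(?z \<bullet> ?z)\<^sup>2 \<le> (?z \<bullet> (A *v ?z)) * (x \<bullet> (A *v x))" by (rule psd_Cauchy_Schwarz[OF A])
  also have "\<dots> \<le> (s * (?z \<bullet> ?z)) * (s * (x \<bullet> x))"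
    using le A s by (intro mult_mono) (auto simp: psd_def)
  finally have *: "(?z \<bullet> ?z) * (?z \<bullet> ?z) \<le> (?z \<bullet> ?z) * (s\<^sup>2 * (x \<bullet> x))" by (simp add: power2_eq_square mult_ac)
  show "norm ?z \<le> s * norm x"
  proof (cases "?z = 0")
    case False
    then have "?z \<bullet> ?z \<le> s\<^sup>2 * (x \<bullet> x)" using * by simp
    then have "(norm ?z)\<^sup>2 \<le> (s * norm x)\<^sup>2" by (simp add: dot_square_norm power_mult_distrib)
    then show ?thesis using s by (simp add: power2_le_iff_abs_le)
  qed (use s in simp)
qed

lemma psd_zero_form:
  assumes "psd A" "x \<bullet> (A *v x) = 0"
  shows "A *v x = 0"
  using psd_Cauchy_Schwarz[OF assms(1), of "A *v x" x] assms(2) by simp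

text \<open>Inversion reverses the Loewner order: an upper bound s for A is a lower bound 1/s for
  its inverse. Cauchy-Schwarz for the form of A, taken at x and y = A^-1 x, yields this without a
  square root of A.\<close>

lemma psd_matrix_inv_ge:
  assumes A: "psd A" "invertible A" and le: "\<And>x. x \<bullet> (A *v x) \<le> s * (x \<bullet> x)"
  shows "x \<bullet> x \<le> s * (x \<bullet> (matrix_inv A *v x))"
proof (cases "x = 0")
  case False
  define y where "y = matrix_inv A *v x"
  have x: "x = A *v y" by (simp add: y_def matrix_inv_vector A)
  have "(x \<bullet> x)\<^sup>2 \<le> (x \<bullet> (A *v x)) * (y \<bullet> (A *v y))"
    using psd_Cauchy_Schwarz[OF A(1), of x y] by (simp add: x)
  also have "\<dots> \<le> (s * (x \<bullet> x)) * (y \<bullet> (A *v y))"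
    using le A(1) by (intro mult_right_mono) (auto simp: psd_def)
  finally have "(x \<bullet> x) * (x \<bullet> x) \<le> (x \<bullet> x) * (s * (y \<bullet> x))"
    by (simp add: x[symmetric] power2_eq_square mult_ac)
  then show ?thesis using False by (simp add: y_def inner_commute)
qed auto

text \<open>The constant is the minimum of the form on the unit sphere, attained by compactness;
  homogeneity extends the bound to all vectors.\<close>

lemma pos_def_coercive:
  assumes "pos_def (A :: real^'n^'n)"
  obtains q where "q > 0" "\<And>x. q * (x \<bullet> x) \<le> x \<bullet> (A *v x)"
proof -
  let ?S = "sphere (0::real^'n) 1"
  have "\<exists>x\<in>?S. \<forall>y\<in>?S. x \<bullet> (A *v x) \<le> y \<bullet> (A *v y)"
  proof (rule continuous_attains_inf)
    have "axis undefined 1 \<in> ?S" by simp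
    then show "?S \<noteq> {}" by blast
  qed (auto intro!: continuous_on_inner matrix_vector_mult_linear_continuous_on)
  then obtain e where e: "e \<in> ?S" "\<And>y. y \<in> ?S \<Longrightarrow> e \<bullet> (A *v e) \<le> y \<bullet> (A *v y)" by blast
  show ?thesis
  proof (rule that[of "e \<bullet> (A *v e)"])
    show "e \<bullet> (A *v e) > 0"
    proof -
      have "e \<noteq> 0" using e(1) by auto
      then show ?thesis using assms by (simp add: pos_def_def)
    qed
    fix x :: "real^'n"
    show "e \<bullet> (A *v e) * (x \<bullet> x) \<le> x \<bullet> (A *v x)"
    proof (cases "x = 0")
      case False
      then have "x /\<^sub>R norm x \<in> ?S" by simp
      from e(2)[OF this] have "e \<bullet> (A *v e) \<le> (x \<bullet> (A *v x)) / (norm x)\<^sup>2"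
        by (simp add: mv.scaleR_right power2_eq_square divide_inverse mult_ac)
      then show ?thesis using False by (simp add: field_simps dot_square_norm)
    qed simp
  qed
qed

lemma coercive_pos_def:
  assumes "transpose A = A" "d > 0" "\<And>x. d * (x \<bullet> x) \<le> x \<bullet> (A *v x)"
  shows "pos_def A"
  unfolding pos_def_def
proof (intro conjI allI impI)
  fix x :: "real^'a" assume "x \<noteq> 0"
  then have "0 < d * (x \<bullet> x)" using assms(2) by simp
  also have "\<dots> \<le> x \<bullet> (A *v x)" by (rule assms(3))
  finally show "0 < x \<bullet> (A *v x)" .
qed (rule assms)

lemma pos_def_imp_psd: "pos_def A \<Longrightarrow> psd A"
  unfolding pos_def_def psd_def by (metis inner_zero_left less_eq_real_def)

lemma pos_def_invertible: "pos_def A \<Longrightarrow> invertible A"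
  by (metis pos_def_coercive coercive_inverse(1))

text \<open>For a semidefinite form a vector of value zero lies in the kernel, and the kernel is
  trivial.\<close>

lemma psd_invertible_pos_def:
  assumes "psd A" "invertible A"
  shows "pos_def A"
  unfolding pos_def_def
proof (intro conjI allI impI)
  show "transpose A = A" using assms by (simp add: psd_def)
  fix x :: "real^'a" assume x: "x \<noteq> 0"
  show "0 < x \<bullet> (A *v x)"
  proof (rule ccontr)
    assume "\<not> 0 < x \<bullet> (A *v x)"
    moreover have "0 \<le> x \<bullet> (A *v x)" using assms(1) by (simp add: psd_def)
    ultimately have "A *v x = 0" using psd_zero_form[OF assms(1), of x] by linarith
    then have "x = 0" using matrix_inv_vector(1)[OF assms(2), of x] by simp
    with x show False by simp
  qed
qed

lemma loewner_le_scaled_mat: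
  "loewner_le (d *\<^sub>R mat 1) A \<Longrightarrow> d * (x \<bullet> x) \<le> x \<bullet> (A *v x)"
  "loewner_le A (d *\<^sub>R mat 1) \<Longrightarrow> x \<bullet> (A *v x) \<le> d * (x \<bullet> x)"
  unfolding loewner_le_def psd_def
  by (auto simp: mv.diff_left mv.scaleR_left inner_diff_right dest!: spec[of _ x])

section \<open>Spectral decomposition and the nonnegative definite part\<close>

text \<open>Rayleigh's argument by induction: the orthogonal complement S of the eigenvectors
  already found is invariant under A, and a maximizer of the quadratic form on the unit sphere of S
  is a further eigenvector.\<close>

lemma orthonormal_eigenvectors:
  fixes A :: "real^'n^'n"
  assumes sym: "transpose A = A"
  shows "n \<le> CARD('n) \<Longrightarrow> \<exists>B. finite B \<and> card B = n \<and> pairwise orthogonal B \<and>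
    (\<forall>b\<in>B. norm b = 1 \<and> (\<exists>c. A *v b = c *\<^sub>R b))"
proof (induction n)
  case 0
  then show ?case by (intro exI[of _ "{}"]) auto
next
  case (Suc n)
  then obtain B where B: "finite B" "card B = n" "pairwise orthogonal B"
    "\<And>b. b \<in> B \<Longrightarrow> norm b = 1" "\<And>b. b \<in> B \<Longrightarrow> \<exists>c. A *v b = c *\<^sub>R b" by auto
  define S where "S = {x. \<forall>b\<in>B. b \<bullet> x = 0}"
  have subS: "subspace S"
    by (auto simp: S_def subspace_def inner_add_right)
  have inv: "A *v x \<in> S" if "x \<in> S" for x
    unfolding S_def
  proof (clarify)
    fix b assume b: "b \<in> B"
    then obtain c where c: "A *v b = c *\<^sub>R b" using B by blast
    show "b \<bullet> (A *v x) = 0" using that b by (simp add: inner_matrix_vector sym c S_def)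
  qed
  have "dim B < DIM(real^'n)" using dim_le_card'[OF B(1)] B(2) Suc.prems by simp
  then obtain z where z: "z \<noteq> 0" "\<And>y. y \<in> span B \<Longrightarrow> orthogonal z y"
    using orthogonal_to_subspace_exists by blast
  then have zS: "z \<in> S" by (auto simp: S_def orthogonal_def span_base inner_commute)
  let ?T = "sphere 0 1 \<inter> S"
  have "z /\<^sub>R norm z \<in> ?T" using z(1) zS subS by (auto intro: subspace_scale)
  then have ne: "?T \<noteq> {}" by blast
  have "compact ?T" by (simp add: compact_Int_closed closed_subspace subS)
  then have "\<exists>x\<in>?T. \<forall>y\<in>?T. y \<bullet> (A *v y) \<le> x \<bullet> (A *v x)"
    using ne by (intro continuous_attains_sup)
      (auto intro!: continuous_on_inner matrix_vector_mult_linear_continuous_on)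
  then obtain e where e: "e \<in> S" "norm e = 1"
      and mx: "\<And>y. y \<in> S \<Longrightarrow> norm y = 1 \<Longrightarrow> y \<bullet> (A *v y) \<le> e \<bullet> (A *v e)"
    by auto
  define mu where "mu = e \<bullet> (A *v e)"
  have mx': "y \<bullet> (A *v y) \<le> mu * (y \<bullet> y)" if y: "y \<in> S" for y
  proof (cases "y = 0")
    case False
    then have "y /\<^sub>R norm y \<in> S" "norm (y /\<^sub>R norm y) = 1"
      using y subS by (auto intro: subspace_scale)
    from mx[OF this] have "(y \<bullet> (A *v y)) / (norm y)\<^sup>2 \<le> mu"
      by (simp add: mv.scaleR_right power2_eq_square divide_inverse mult_ac mu_def)
    then show ?thesis using False by (simp add: field_simps dot_square_norm)
  qed simp
  \<comment> \<open>The residual of the eigenvalue equation. Maximality of e against the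
    perturbations e + t g will force it to vanish, because the first-order term in t is 2 (g .
    g).\<close>
  define g where "g = mu *\<^sub>R e - A *v e"
  have gS: "g \<in> S" unfolding g_def using e inv subS by (intro subspace_diff subspace_scale) auto
  define c where "c = mu * (g \<bullet> g) - g \<bullet> (A *v g)"
  have c0: "c \<ge> 0" using mx'[OF gS] by (simp add: c_def)
  have Age: "g \<bullet> (A *v e) = e \<bullet> (A *v g)"
    by (subst inner_matrix_vector) (simp add: sym inner_commute)
  have quad: "0 \<le> 2 * t * (g \<bullet> g) + t\<^sup>2 * c" for t
  proof -
    have "e + t *\<^sub>R g \<in> S" using e gS subS by (intro subspace_add subspace_scale) auto
    from mx'[OF this] have "0 \<le> mu * ((e + t *\<^sub>R g) \<bullet> (e + t *\<^sub>R g)) - (e + t *\<^sub>R g) \<bullet> (A *v (e + t *\<^sub>R g))"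
      by simp
    also have "\<dots> = (mu * (e \<bullet> e) - e \<bullet> (A *v e)) + 2 * t * (mu * (g \<bullet> e) - g \<bullet> (A *v e)) + t\<^sup>2 * c"
      using Age by (simp add: inner_add_left inner_add_right mv.add_right mv.scaleR_right c_def
          power2_eq_square algebra_simps inner_commute[of e g])
    also have "mu * (e \<bullet> e) - e \<bullet> (A *v e) = 0" using e(2) by (simp add: mu_def dot_square_norm)
    also have "mu * (g \<bullet> e) - g \<bullet> (A *v e) = g \<bullet> g"
      by (subst (3) g_def) (simp add: inner_diff_right)
    finally show ?thesis by simp
  qed
  have "g \<bullet> g = 0"
  proof (rule ccontr)
    assume "g \<bullet> g \<noteq> 0"
    then have gp: "g \<bullet> g > 0" by (metis inner_ge_zero less_eq_real_def)
    \<comment> \<open>Negative, and small enough that the linear term beats the quadratic one; the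
      \<open>+ 1\<close> covers c = 0.\<close>
    let ?t = "- (g \<bullet> g) / (c + 1)"
    have "?t * (2 * (g \<bullet> g) + ?t * c) = 2 * ?t * (g \<bullet> g) + ?t\<^sup>2 * c"
      by (simp only: power2_eq_square distrib_left mult.assoc mult.left_commute)
    moreover have "2 * (g \<bullet> g) + ?t * c > 0"
    proof -
      have "c / (c + 1) \<le> 1" using c0 by simp
      then have "(g \<bullet> g) * (c / (c + 1)) \<le> (g \<bullet> g) * 1" using gp by (intro mult_left_mono) auto
      then have "(g \<bullet> g) * (c / (c + 1)) < 2 * (g \<bullet> g)" using gp by linarith
      then show ?thesis by simp
    qed
    moreover have "?t < 0" using gp c0 by (simp add: divide_neg_pos)
    ultimately have "2 * ?t * (g \<bullet> g) + ?t\<^sup>2 * c < 0" by (metis mult_neg_pos)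
    then show False using quad[of ?t] by simp
  qed
  then have Ae: "A *v e = mu *\<^sub>R e" by (simp add: g_def)
  have enB: "e \<notin> B" using e B(4) by (auto simp: S_def dot_square_norm)
  show ?case
  proof (intro exI[of _ "insert e B"] conjI)
    show "card (insert e B) = Suc n" using B enB by simp
    show "pairwise orthogonal (insert e B)"
      using B(3) e(1) by (auto simp: pairwise_insert orthogonal_def S_def inner_commute)
    show "\<forall>b\<in>insert e B. norm b = 1 \<and> (\<exists>c. A *v b = c *\<^sub>R b)" using B Ae e by blast
  qed (use B in auto)
qed

lemma symmetric_spectral:
  fixes A :: "real^'n^'n"
  assumes sym: "transpose A = A"
  obtains H l where "orthogonal_matrix H" "A = H ** diag_mat l ** transpose H"
proof -
  obtain B where B: "finite B" "card B = CARD('n)" "pairwise orthogonal B"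
    "\<And>b. b \<in> B \<Longrightarrow> norm b = 1" "\<And>b. b \<in> B \<Longrightarrow> \<exists>c. A *v b = c *\<^sub>R b"
    using orthonormal_eigenvectors[OF sym, of "CARD('n)"] by auto
  obtain f where f: "bij_betw f (UNIV::'n set) B"
    using B finite_same_card_bij[of "UNIV::'n set" B] by auto
  then have fB: "f i \<in> B" for i by (auto simp: bij_betw_def)
  obtain l where l: "\<And>i. A *v f i = l i *\<^sub>R f i" using B(5)[OF fB] by metis
  define H where "H = (\<chi> i j. f j $ i)"
  have ff: "f i \<bullet> f j = (if i = j then 1 else 0)" for i j
  proof (cases "i = j")
    case True then show ?thesis using B(4)[OF fB] by (simp add: dot_square_norm)
  next
    case False
    then have "f i \<noteq> f j" using f by (auto simp: bij_betw_def inj_def)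
    then show ?thesis using B(3) fB False by (auto simp: pairwise_def orthogonal_def)
  qed
  have "transpose H ** H = mat 1"
    using ff by (simp add: vec_eq_iff matrix_matrix_mult_def transpose_def H_def mat_def inner_vec_def)
  then have orth: "orthogonal_matrix H" by (simp add: orthogonal_matrix)
  have "A ** H = H ** diag_mat (\<chi> i. l i)"
    using l by (simp add: vec_eq_iff matrix_matrix_mult_def matrix_vector_mult_def H_def diag_mat_def
        if_distrib cong: if_cong)
  then have "A ** (H ** transpose H) = H ** diag_mat (\<chi> i. l i) ** transpose H"
    by (simp add: matrix_mul_assoc)
  then have "A = H ** diag_mat (\<chi> i. l i) ** transpose H"
    using orth by (simp add: orthogonal_matrix_def)
  then show ?thesis using that orth by blast
qed

section \<open>Matrices in spectral form\<close>

lemma spectral_nth: "(H ** diag_mat l ** transpose H) $ p $ q = (\<Sum>j\<in>UNIV. l $ j * H $ p $ j * H $ q $ j)"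
  by (simp add: matrix_matrix_mult_def diag_mat_def transpose_def if_distrib mult_ac cong: if_cong)

lemma spectral_transpose: "transpose (H ** diag_mat l ** transpose H) = H ** diag_mat l ** transpose H"
proof -
  have "(H ** diag_mat l ** transpose H) $ p $ q = (H ** diag_mat l ** transpose H) $ q $ p" for p q
    unfolding spectral_nth by (simp add: mult_ac)
  then show ?thesis by (subst (1) transpose_def) (simp add: vec_eq_iff)
qed

text \<open>In terms of the columns of H the entrywise inner product is a sum of values of the form
  of C with weights l, so its sign can be read off from l.\<close>

lemma spectral_inner:
  "(H ** diag_mat l ** transpose H) \<bullet> C = (\<Sum>j\<in>UNIV. l $ j * (column j H \<bullet> (C *v column j H)))"
proof -
  have "(H ** diag_mat l ** transpose H) \<bullet> C
      = (\<Sum>p\<in>UNIV. \<Sum>q\<in>UNIV. \<Sum>j\<in>UNIV. l $ j * H $ p $ j * H $ q $ j * C $ p $ q)"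
    by (simp add: inner_vec_def spectral_nth sum_distrib_right)
  also have "\<dots> = (\<Sum>p\<in>UNIV. \<Sum>j\<in>UNIV. \<Sum>q\<in>UNIV. l $ j * H $ p $ j * H $ q $ j * C $ p $ q)"
    by (intro sum.cong refl) (rule sum.swap)
  also have "\<dots> = (\<Sum>j\<in>UNIV. \<Sum>p\<in>UNIV. \<Sum>q\<in>UNIV. l $ j * H $ p $ j * H $ q $ j * C $ p $ q)"
    by (rule sum.swap)
  also have "\<dots> = (\<Sum>j\<in>UNIV. l $ j * (column j H \<bullet> (C *v column j H)))"
    by (simp add: inner_vec_def matrix_vector_mult_def column_def sum_distrib_left mult_ac)
  finally show ?thesis .
qed

lemma spectral_form:
  "x \<bullet> ((H ** diag_mat l ** transpose H) *v x) = (\<Sum>j\<in>UNIV. l $ j * (column j H \<bullet> x)\<^sup>2)"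
proof -
  have "x \<bullet> ((H ** diag_mat l ** transpose H) *v x) = (H ** diag_mat l ** transpose H) \<bullet> outer x x"
    by (simp add: inner_vec_def matrix_vector_mult_def sum_distrib_left mult_ac)
  also have "\<dots> = (\<Sum>j\<in>UNIV. l $ j * (column j H \<bullet> x)\<^sup>2)"
    unfolding spectral_inner by (simp add: outer_mult_vector power2_eq_square inner_commute)
  finally show ?thesis .
qed

lemma orthogonal_columns:
  "orthogonal_matrix (H::real^'n^'n) \<Longrightarrow> column i H \<bullet> column j H = (if i = j then 1 else 0)"
  unfolding orthogonal_matrix
  by (simp add: vec_eq_iff matrix_matrix_mult_def transpose_def mat_def column_def inner_vec_def)

lemma spectral_column:
  assumes "orthogonal_matrix H"
  shows "column i H \<bullet> ((H ** diag_mat l ** transpose H) *v column i H) = l $ i"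
proof -
  have "(\<Sum>j\<in>UNIV. l $ j * (column j H \<bullet> column i H)\<^sup>2) = (\<Sum>j\<in>UNIV. if j = i then l $ j else 0)"
    by (intro sum.cong refl) (simp add: orthogonal_columns[OF assms])
  then show ?thesis by (simp add: spectral_form)
qed

lemma spectral_psd: "(\<And>i. 0 \<le> l $ i) \<Longrightarrow> psd (H ** diag_mat l ** transpose H)"
  unfolding psd_def by (auto simp: spectral_transpose spectral_form intro!: sum_nonneg)

text \<open>One half of the self-duality of the semidefinite cone: expand B in its eigenvectors and
  use that the form of C is nonnegative at each of them.\<close>

lemma inner_psd_nonneg:
  assumes "psd B" "psd C"
  shows "0 \<le> B \<bullet> C"
proof -
  obtain H l where H: "orthogonal_matrix H" "B = H ** diag_mat l ** transpose H"
    using assms symmetric_spectral unfolding psd_def by blast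
  have "l $ j \<ge> 0" for j
    using assms(1) spectral_column[OF H(1), of j l] unfolding H(2) psd_def by metis
  then show ?thesis using assms(2) unfolding H(2) spectral_inner psd_def by (intro sum_nonneg) auto
qed

text \<open>Moreau's decomposition with respect to the cone of nonnegative definite matrices: the
  mixed inner products are nonnegative, so both parts depend nonexpansively on the difference.\<close>

lemma psd_decomposition_nonexpansive:
  assumes "psd B" "psd C" "psd B'" "psd C'" "B \<bullet> C = 0" "B' \<bullet> C' = 0"
  shows "norm (B - B') \<le> norm ((B - C) - (B' - C'))"
proof -
  have "(norm (B - B'))\<^sup>2 \<le> (norm (B - B'))\<^sup>2 + (norm (C - C'))\<^sup>2 + 2 * (B \<bullet> C' + B' \<bullet> C)"
    using inner_psd_nonneg[of B C'] inner_psd_nonneg[of B' C] assms by simp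
  also have "\<dots> = (norm ((B - C) - (B' - C')))\<^sup>2"
    unfolding power2_norm_eq_inner using assms(5,6)
    by (simp add: inner_diff_left inner_diff_right inner_commute algebra_simps)
  finally show ?thesis by (simp add: power2_le_iff_abs_le)
qed

text \<open>P and N carry the positive and the negative parts of the same eigenvalues, so at each
  eigenvector at least one of the two is zero; this is the orthogonality.\<close>

lemma spectral_split:
  fixes H :: "real^'n^'n" and l :: "real^'n"
  assumes "orthogonal_matrix H"
  defines "P \<equiv> H ** diag_mat (\<chi> i. max 0 (l $ i)) ** transpose H"
  defines "N \<equiv> H ** diag_mat (\<chi> i. max 0 (- (l $ i))) ** transpose H"
  shows "psd P" "psd N" "P \<bullet> N = 0" "H ** diag_mat l ** transpose H = P - N"
proof -
  show "psd P" "psd N" unfolding P_def N_def by (auto intro!: spectral_psd)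
  show "P \<bullet> N = 0" unfolding P_def spectral_inner unfolding N_def spectral_column[OF assms(1)]
    by (intro sum.neutral) (auto simp: max_def)
  show "H ** diag_mat l ** transpose H = P - N"
    unfolding P_def N_def
    by (auto simp: vec_eq_iff spectral_nth sum_subtractf[symmetric] max_def intro!: sum.cong)
qed

text \<open>This justifies the definite description in \<open>psd_part\<close>. Two spectral
  decompositions of one matrix give two orthogonal decompositions with the same difference, and
  nonexpansiveness puts their positive parts at distance zero.\<close>

lemma psd_part_spectral:
  assumes H: "orthogonal_matrix H"
  shows "psd_part (H ** diag_mat l ** transpose H) = H ** diag_mat (\<chi> i. max 0 (l $ i)) ** transpose H"
  unfolding psd_part_def
proof (rule the_equality)
  show "\<exists>Ha la. orthogonal_matrix Ha \<and> H ** diag_mat l ** transpose H = Ha ** diag_mat la ** transpose Ha \<and>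
     H ** diag_mat (\<chi> i. max 0 (l $ i)) ** transpose H = Ha ** diag_mat (\<chi> i. max 0 (la $ i)) ** transpose Ha"
    using H by blast
next
  fix B
  assume "\<exists>Ha la. orthogonal_matrix Ha \<and> H ** diag_mat l ** transpose H = Ha ** diag_mat la ** transpose Ha \<and>
     B = Ha ** diag_mat (\<chi> i. max 0 (la $ i)) ** transpose Ha"
  then obtain G r where G: "orthogonal_matrix G" "H ** diag_mat l ** transpose H = G ** diag_mat r ** transpose G"
     "B = G ** diag_mat (\<chi> i. max 0 (r $ i)) ** transpose G" by blast
  note h = spectral_split[OF H, of l] and g = spectral_split[OF G(1), of r]
  have "norm (B - H ** diag_mat (\<chi> i. max 0 (l $ i)) ** transpose H)
    \<le> norm (G ** diag_mat r ** transpose G - H ** diag_mat l ** transpose H)"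
    unfolding G(3) h(4) g(4) by (rule psd_decomposition_nonexpansive) (use h g in auto)
  then show "B = H ** diag_mat (\<chi> i. max 0 (l $ i)) ** transpose H" by (simp add: G(2))
qed

lemma psd_part_decomposition:
  assumes "transpose A = A"
  obtains N where "psd (psd_part A)" "psd N" "psd_part A \<bullet> N = 0" "A = psd_part A - N"
  using assms by (metis symmetric_spectral psd_part_spectral spectral_split)

lemma psd_psd_part: "transpose A = A \<Longrightarrow> psd (psd_part A)"
  by (metis psd_part_decomposition)

lemma psd_part_nonexpansive:
  assumes "transpose A = A" "transpose B = B"
  shows "norm (psd_part A - psd_part B) \<le> norm (A - B)"
proof -
  obtain N where "psd (psd_part A)" "psd N" "psd_part A \<bullet> N = 0" "A = psd_part A - N"
    using psd_part_decomposition[OF assms(1)] .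
  moreover obtain N' where "psd (psd_part B)" "psd N'" "psd_part B \<bullet> N' = 0" "B = psd_part B - N'"
    using psd_part_decomposition[OF assms(2)] .
  ultimately show ?thesis using psd_decomposition_nonexpansive[of "psd_part A" N "psd_part B" N'] by simp
qed

text \<open>Both A = \<open>psd_part A\<close> - N and A = A - 0 are Moreau decompositions, so the
  positive parts agree.\<close>

lemma psd_part_psd:
  assumes "psd A"
  shows "psd_part A = A"
proof -
  have sym: "transpose A = A" using assms by (simp add: psd_def)
  obtain N where N: "psd (psd_part A)" "psd N" "psd_part A \<bullet> N = 0" "A = psd_part A - N"
    using psd_part_decomposition[OF sym] .
  have "norm (psd_part A - A) \<le> norm ((psd_part A - N) - (A - 0))"
    by (rule psd_decomposition_nonexpansive) (use N assms in \<open>auto simp: psd_def transpose_def vec_eq_iff\<close>)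
  then show ?thesis using N(4) by simp
qed

text \<open>Near a positive definite matrix the nonnegative definite part does nothing, so its effect
  is of second order in the distance to that matrix.\<close>

lemma psd_part_second_order:
  assumes A: "transpose A = A" and P: "psd P" and c: "c > 0" "\<And>x. c * (x \<bullet> x) \<le> x \<bullet> (P *v x)"
  shows "norm (psd_part A - A) \<le> 2 / c * (norm (A - P))\<^sup>2"
proof (cases "norm (A - P) \<le> c")
  case True
  have "0 \<le> x \<bullet> (A *v x)" for x
  proof -
    have "x \<bullet> (A *v x) = x \<bullet> (P *v x) + x \<bullet> ((A - P) *v x)"
      by (simp add: mv.diff_left inner_diff_right)
    also have "\<dots> \<ge> c * (x \<bullet> x) + - norm (A - P) * (x \<bullet> x)"
      using c(2) inner_matrix_ge_norm by (intro add_mono)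
    also have "c * (x \<bullet> x) + - norm (A - P) * (x \<bullet> x) = (c - norm (A - P)) * (x \<bullet> x)"
      by (simp add: algebra_simps)
    finally show ?thesis
      using True mult_nonneg_nonneg[of "c - norm (A - P)" "x \<bullet> x"] inner_ge_zero[of x] by linarith
  qed
  then have "psd A" using A by (simp add: psd_def)
  then show ?thesis using c by (simp add: psd_part_psd)
next
  case False
  have symP: "transpose P = P" using P by (simp add: psd_def)
  have "norm (psd_part A - A) \<le> norm (psd_part A - psd_part P) + norm (P - A)"
    using norm_triangle_ineq[of "psd_part A - psd_part P" "P - A"] by (simp add: psd_part_psd[OF P])
  also have "\<dots> \<le> 2 * norm (A - P)"
    using psd_part_nonexpansive[OF A symP] by (simp add: norm_minus_commute)
  \<comment> \<open>Here the distance exceeds c, so a linear bound is also a quadratic one.\<close>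
  also have "\<dots> \<le> 2 * norm (A - P) * (norm (A - P) / c)"
    using mult_left_mono[of 1 "norm (A - P) / c" "2 * norm (A - P)"] False c by simp
  also have "\<dots> = 2 / c * (norm (A - P))\<^sup>2" by (simp add: power2_eq_square)
  finally show ?thesis .
qed

section \<open>Orders of magnitude in all moments\<close>

text \<open>\<open>momO M n f\<close> says that \<open>f m\<close> is of order \<open>m\<^bsup>-n/2\<^esup>\<close> in \<open>L\<^sup>p\<close> for every \<open>p\<close>. Unlike boundedness in one
  fixed \<open>L\<^sup>p\<close>, this is stable under products.\<close>

definition momO :: "'a measure \<Rightarrow> nat \<Rightarrow> (nat \<Rightarrow> 'a \<Rightarrow> 'b::real_normed_vector) \<Rightarrow> bool" where
  "momO M n f \<longleftrightarrow> (\<forall>\<^sub>F m in sequentially. f m \<in> borel_measurable M) \<and>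
     (\<forall>p::nat. \<exists>C. \<forall>\<^sub>F m in sequentially. integrable M (\<lambda>w. norm (f m w) ^ p) \<and>
        (LINT w|M. norm (f m w) ^ p) \<le> C * (1 / sqrt (real m)) ^ (n * p))"

lemma momO_measurable: "momO M n f \<Longrightarrow> \<forall>\<^sub>F m in sequentially. f m \<in> borel_measurable M"
  by (simp add: momO_def)

text \<open>The constant is made nonnegative so that the bound can be multiplied and
  weakened.\<close>

lemma momO_moment:
  assumes "momO M n f"
  obtains C where "C \<ge> 0" "\<forall>\<^sub>F m in sequentially. integrable M (\<lambda>w. norm (f m w) ^ p) \<and>
        (LINT w|M. norm (f m w) ^ p) \<le> C * (1 / sqrt (real m)) ^ (n * p)"
proof -
  obtain C where C: "\<forall>\<^sub>F m in sequentially. integrable M (\<lambda>w. norm (f m w) ^ p) \<and>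
        (LINT w|M. norm (f m w) ^ p) \<le> C * (1 / sqrt (real m)) ^ (n * p)"
    using assms unfolding momO_def by blast
  show ?thesis
  proof (rule that[of "max C 0"])
    show "\<forall>\<^sub>F m in sequentially. integrable M (\<lambda>w. norm (f m w) ^ p) \<and>
        (LINT w|M. norm (f m w) ^ p) \<le> max C 0 * (1 / sqrt (real m)) ^ (n * p)"
      using C
    proof eventually_elim
      case (elim m)
      have "C * (1 / sqrt (real m)) ^ (n * p) \<le> max C 0 * (1 / sqrt (real m)) ^ (n * p)"
        by (intro mult_right_mono) auto
      with elim show ?case by linarith
    qed
  qed simp
qed

lemma momO_dominated:
  assumes f: "momO M n f" and g: "\<forall>\<^sub>F m in sequentially. g m \<in> borel_measurable M"
    and le: "\<forall>\<^sub>F m in sequentially. \<forall>w\<in>space M. norm (g m w) \<le> norm (f m w)"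
  shows "momO M n g"
  unfolding momO_def
proof (intro conjI allI)
  fix p :: nat
  obtain C where "0 \<le> C" and B: "\<forall>\<^sub>F m in sequentially. integrable M (\<lambda>w. norm (f m w) ^ p) \<and>
        (LINT w|M. norm (f m w) ^ p) \<le> C * (1 / sqrt (real m)) ^ (n * p)"
    by (rule momO_moment[OF f])
  from B have "\<forall>\<^sub>F m in sequentially. integrable M (\<lambda>w. norm (g m w) ^ p) \<and>
        (LINT w|M. norm (g m w) ^ p) \<le> C * (1 / sqrt (real m)) ^ (n * p)"
    using g le
  proof eventually_elim
    case (elim m)
    then have int: "integrable M (\<lambda>w. norm (f m w) ^ p)" and [measurable]: "g m \<in> borel_measurable M" by auto
    have le': "norm (g m w) ^ p \<le> norm (f m w) ^ p" if "w \<in> space M" for w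
      using elim(3) that by (intro power_mono) auto
    have int': "integrable M (\<lambda>w. norm (g m w) ^ p)"
      by (rule Bochner_Integration.integrable_bound[OF int]) (simp, intro AE_I2, simp add: le')
    have "(LINT w|M. norm (g m w) ^ p) \<le> (LINT w|M. norm (f m w) ^ p)"
      by (rule integral_mono[OF int' int le'])
    with int' elim(1) show ?case by linarith
  qed
  then show "\<exists>C. \<forall>\<^sub>F m in sequentially. integrable M (\<lambda>w. norm (g m w) ^ p) \<and>
        (LINT w|M. norm (g m w) ^ p) \<le> C * (1 / sqrt (real m)) ^ (n * p)" by blast
qed (rule g)

lemma momO_norm_iff: 
  assumes "\<forall>\<^sub>F m in sequentially. f m \<in> borel_measurable M"
  shows "momO M n (\<lambda>m w. norm (f m w)) \<longleftrightarrow> momO M n f"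
proof -
  have "\<forall>\<^sub>F m in sequentially. (\<lambda>w. norm (f m w)) \<in> borel_measurable M"
    using assms by eventually_elim measurable
  then show ?thesis using assms by (simp add: momO_def)
qed

lemma momO_norm: "momO M n f \<Longrightarrow> momO M n (\<lambda>m w. norm (f m w))"
  using momO_norm_iff momO_measurable by blast

lemma eventually_sqrt_inverse_le_1: "\<forall>\<^sub>F m in sequentially. 0 < 1 / sqrt (real m) \<and> 1 / sqrt (real m) \<le> 1"
  using eventually_ge_at_top[of 1] by eventually_elim simp

lemma momO_mono:
  assumes "momO M n f" "k \<le> n"
  shows "momO M k f"
  unfolding momO_def
proof (intro conjI allI)
  fix p :: nat
  obtain C where C: "C \<ge> 0" "\<forall>\<^sub>F m in sequentially. integrable M (\<lambda>w. norm (f m w) ^ p) \<and>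
        (LINT w|M. norm (f m w) ^ p) \<le> C * (1 / sqrt (real m)) ^ (n * p)"
    using momO_moment[OF assms(1)] .
  have "\<forall>\<^sub>F m in sequentially. integrable M (\<lambda>w. norm (f m w) ^ p) \<and>
        (LINT w|M. norm (f m w) ^ p) \<le> C * (1 / sqrt (real m)) ^ (k * p)"
    using C(2) eventually_sqrt_inverse_le_1
  proof eventually_elim
    case (elim m)
    have "(1 / sqrt (real m)) ^ (n * p) \<le> (1 / sqrt (real m)) ^ (k * p)"
      using elim assms(2) by (intro power_decreasing) auto
    then show ?case using elim mult_left_mono[OF _ C(1)] by fastforce
  qed
  then show "\<exists>C. \<forall>\<^sub>F m in sequentially. integrable M (\<lambda>w. norm (f m w) ^ p) \<and>
        (LINT w|M. norm (f m w) ^ p) \<le> C * (1 / sqrt (real m)) ^ (k * p)" by blast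
qed (rule momO_measurable[OF assms(1)])

section \<open>Sums, products and linear images of sequences of given order\<close>

lemma add_power_le: "(a + b) ^ p \<le> 2 ^ p * (a ^ p + b ^ p)" if "0 \<le> a" "0 \<le> b" for a b :: real
proof -
  have "(a + b) ^ p \<le> (2 * max a b) ^ p" using that by (intro power_mono) auto
  also have "\<dots> \<le> 2 ^ p * (a ^ p + b ^ p)" using that by (auto simp: power_mult_distrib max_def)
  finally show ?thesis .
qed

lemma momO_add:
  fixes f g :: "nat \<Rightarrow> 'a \<Rightarrow> 'b::{second_countable_topology, real_normed_vector}"
  assumes f: "momO M n f" and g: "momO M n g"
  shows "momO M n (\<lambda>m w. f m w + g m w)"
  unfolding momO_def
proof (intro conjI allI)
  show "\<forall>\<^sub>F m in sequentially. (\<lambda>w. f m w + g m w) \<in> borel_measurable M"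
    using momO_measurable[OF f] momO_measurable[OF g] by eventually_elim measurable
  fix p :: nat
  obtain C where "0 \<le> C" and C: "\<forall>\<^sub>F m in sequentially. integrable M (\<lambda>w. norm (f m w) ^ p) \<and>
        (LINT w|M. norm (f m w) ^ p) \<le> C * (1 / sqrt (real m)) ^ (n * p)"
    by (rule momO_moment[OF f])
  obtain C' where "0 \<le> C'" and C': "\<forall>\<^sub>F m in sequentially. integrable M (\<lambda>w. norm (g m w) ^ p) \<and>
        (LINT w|M. norm (g m w) ^ p) \<le> C' * (1 / sqrt (real m)) ^ (n * p)"
    by (rule momO_moment[OF g])
  have "\<forall>\<^sub>F m in sequentially. integrable M (\<lambda>w. norm (f m w + g m w) ^ p) \<and>
        (LINT w|M. norm (f m w + g m w) ^ p) \<le> (2 ^ p * (C + C')) * (1 / sqrt (real m)) ^ (n * p)"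
    using C C' momO_measurable[OF f] momO_measurable[OF g]
  proof eventually_elim
    case (elim m)
    then have int: "integrable M (\<lambda>w. 2 ^ p * (norm (f m w) ^ p + norm (g m w) ^ p))"
      and [measurable]: "f m \<in> borel_measurable M" "g m \<in> borel_measurable M" by simp_all
    have le: "norm (f m w + g m w) ^ p \<le> 2 ^ p * (norm (f m w) ^ p + norm (g m w) ^ p)" for w
      by (rule order_trans[OF power_mono[OF norm_triangle_ineq] add_power_le]) auto
    have int': "integrable M (\<lambda>w. norm (f m w + g m w) ^ p)"
      by (rule Bochner_Integration.integrable_bound[OF int]) (simp, intro AE_I2, simp add: le)
    have "(LINT w|M. norm (f m w + g m w) ^ p) \<le> (LINT w|M. 2 ^ p * (norm (f m w) ^ p + norm (g m w) ^ p))"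
      by (rule integral_mono[OF int' int le])
    also have "\<dots> = 2 ^ p * ((LINT w|M. norm (f m w) ^ p) + (LINT w|M. norm (g m w) ^ p))"
      using elim by simp
    also have "\<dots> \<le> 2 ^ p * (C * (1 / sqrt (real m)) ^ (n * p) + C' * (1 / sqrt (real m)) ^ (n * p))"
      using elim by (intro mult_left_mono add_mono) auto
    finally show ?case using int' by (simp add: algebra_simps)
  qed
  then show "\<exists>C. \<forall>\<^sub>F m in sequentially. integrable M (\<lambda>w. norm (f m w + g m w) ^ p) \<and>
        (LINT w|M. norm (f m w + g m w) ^ p) \<le> C * (1 / sqrt (real m)) ^ (n * p)" by blast
qed

text \<open>The p-th moment of the product is reduced to 2p-th moments by a weighted inequality
  between arithmetic and geometric mean. This stands in for Hoelder's inequality and is the reason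
  for requiring all p.\<close>

lemma momO_mult_norm:
  assumes f: "momO M n f" and g: "momO M k g"
  shows "momO M (n + k) (\<lambda>m w. norm (f m w) * norm (g m w))"
  unfolding momO_def
proof (intro conjI allI)
  have meas: "\<forall>\<^sub>F m in sequentially. (\<lambda>w. norm (f m w)) \<in> borel_measurable M \<and> (\<lambda>w. norm (g m w)) \<in> borel_measurable M"
    using momO_measurable[OF momO_norm[OF f]] momO_measurable[OF momO_norm[OF g]] by eventually_elim simp
  then show "\<forall>\<^sub>F m in sequentially. (\<lambda>w. norm (f m w) * norm (g m w)) \<in> borel_measurable M"
    by eventually_elim (rule borel_measurable_times, auto)
  fix p :: nat
  obtain C where "0 \<le> C" and C: "\<forall>\<^sub>F m in sequentially. integrable M (\<lambda>w. norm (f m w) ^ (2 * p)) \<and>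
        (LINT w|M. norm (f m w) ^ (2 * p)) \<le> C * (1 / sqrt (real m)) ^ (n * (2 * p))"
    by (rule momO_moment[OF f])
  obtain C' where "0 \<le> C'" and C': "\<forall>\<^sub>F m in sequentially. integrable M (\<lambda>w. norm (g m w) ^ (2 * p)) \<and>
        (LINT w|M. norm (g m w) ^ (2 * p)) \<le> C' * (1 / sqrt (real m)) ^ (k * (2 * p))"
    by (rule momO_moment[OF g])
  have "\<forall>\<^sub>F m in sequentially. integrable M (\<lambda>w. norm (norm (f m w) * norm (g m w)) ^ p) \<and>
        (LINT w|M. norm (norm (f m w) * norm (g m w)) ^ p) \<le> (C + C') * (1 / sqrt (real m)) ^ ((n + k) * p)"
    using C C' meas eventually_sqrt_inverse_le_1
  proof eventually_elim
    case (elim m)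
    define s where "s = 1 / sqrt (real m)"
    have s: "s > 0" using elim by (simp add: s_def)
    have [measurable]: "(\<lambda>w. norm (f m w)) \<in> borel_measurable M" "(\<lambda>w. norm (g m w)) \<in> borel_measurable M"
      using elim by auto
    \<comment> \<open>The weights compensate for the different scales of the factors, so that both
      terms acquire the order s^((n+k)p).\<close>
    define R where "R = s ^ (k * p) / s ^ (n * p)"
    define R' where "R' = s ^ (n * p) / s ^ (k * p)"
    have RR: "R > 0" "R' > 0" "R * R' = 1" using s by (simp_all add: R_def R'_def)
    have le: "norm (norm (f m w) * norm (g m w)) ^ p
        \<le> R * norm (f m w) ^ (2 * p) + R' * norm (g m w) ^ (2 * p)" for w
    proof -
      let ?x = "norm (f m w) ^ p" and ?y = "norm (g m w) ^ p"
      have "0 \<le> R * (?x - R' * ?y)\<^sup>2" using RR by simp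
      also have "\<dots> = R * ?x\<^sup>2 - 2 * (R * R') * (?x * ?y) + (R * R') * R' * ?y\<^sup>2"
        by (simp add: power2_eq_square algebra_simps)
      finally have "2 * (?x * ?y) \<le> R * ?x\<^sup>2 + R' * ?y\<^sup>2" using RR(3) by simp
      moreover have "0 \<le> ?x * ?y" by simp
      ultimately have "?x * ?y \<le> R * ?x\<^sup>2 + R' * ?y\<^sup>2" by linarith
      then show ?thesis by (simp add: power_mult_distrib power_mult mult.commute[of 2 p])
    qed
    have int: "integrable M (\<lambda>w. R * norm (f m w) ^ (2 * p) + R' * norm (g m w) ^ (2 * p))"
      using elim by auto
    have int': "integrable M (\<lambda>w. norm (norm (f m w) * norm (g m w)) ^ p)"
      by (rule Bochner_Integration.integrable_bound[OF int]) (use le RR in \<open>auto intro!: AE_I2 simp: abs_mult intro: order_trans[OF _ abs_ge_self]\<close>)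
    have "(LINT w|M. norm (norm (f m w) * norm (g m w)) ^ p)
        \<le> (LINT w|M. R * norm (f m w) ^ (2 * p) + R' * norm (g m w) ^ (2 * p))"
      by (rule integral_mono[OF int' int le])
    also have "\<dots> = R * (LINT w|M. norm (f m w) ^ (2 * p)) + R' * (LINT w|M. norm (g m w) ^ (2 * p))"
      using elim by simp
    also have "\<dots> \<le> R * (C * s ^ (n * (2 * p))) + R' * (C' * s ^ (k * (2 * p)))"
      using elim RR unfolding s_def by (intro mult_left_mono add_mono) auto
    also have "\<dots> = (C + C') * s ^ ((n + k) * p)"
    proof -
      have "s ^ (n * (2 * p)) = s ^ (n * p) * s ^ (n * p)" "s ^ (k * (2 * p)) = s ^ (k * p) * s ^ (k * p)"
        "s ^ ((n + k) * p) = s ^ (n * p) * s ^ (k * p)"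
        by (simp_all only: power_add[symmetric]) (simp_all only: mult_2 mult_2_right distrib_left distrib_right)
      then show ?thesis using s by (simp add: R_def R'_def field_simps)
    qed
    finally show ?case using int' by (simp add: s_def)
  qed
  then show "\<exists>C. \<forall>\<^sub>F m in sequentially. integrable M (\<lambda>w. norm (norm (f m w) * norm (g m w)) ^ p) \<and>
        (LINT w|M. norm (norm (f m w) * norm (g m w)) ^ p) \<le> C * (1 / sqrt (real m)) ^ ((n + k) * p)" by blast
qed

lemma momO_mult:
  fixes f g :: "nat \<Rightarrow> 'a \<Rightarrow> real"
  assumes f: "momO M n f" and g: "momO M k g"
  shows "momO M (n + k) (\<lambda>m w. f m w * g m w)"
proof (rule momO_dominated[OF momO_mult_norm[OF f g]])
  show "\<forall>\<^sub>F m in sequentially. (\<lambda>w. f m w * g m w) \<in> borel_measurable M"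
    using momO_measurable[OF f] momO_measurable[OF g] by eventually_elim measurable
qed (auto simp: abs_mult)

lemma (in prob_space) momO_const:
  assumes "\<forall>\<^sub>F m in sequentially. norm (c m) \<le> C * (1 / sqrt (real m)) ^ n"
  shows "momO M n (\<lambda>m w. c m)"
  unfolding momO_def
proof (intro conjI allI)
  fix p :: nat
  have "\<forall>\<^sub>F m in sequentially. integrable M (\<lambda>w. norm (c m) ^ p) \<and>
        (LINT w|M. norm (c m) ^ p) \<le> C ^ p * (1 / sqrt (real m)) ^ (n * p)"
    using assms
  proof eventually_elim
    case (elim m)
    have "norm (c m) ^ p \<le> (C * (1 / sqrt (real m)) ^ n) ^ p" using elim by (intro power_mono) auto
    then show ?case by (simp add: prob_space power_mult_distrib power_mult)
  qed
  then show "\<exists>C. \<forall>\<^sub>F m in sequentially. integrable M (\<lambda>w. norm (c m) ^ p) \<and>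
        (LINT w|M. norm (c m) ^ p) \<le> C * (1 / sqrt (real m)) ^ (n * p)" by blast
qed simp

lemma (in prob_space) momO_const_0: "momO M 0 (\<lambda>m w. c)"
  by (rule momO_const[where C="norm c"]) simp

lemma (in prob_space) momO_zero: "momO M n (\<lambda>m w. 0)"
  by (rule momO_const[where C=0]) simp

lemma (in prob_space) momO_scale_bound:
  fixes f :: "nat \<Rightarrow> 'a \<Rightarrow> 'b::real_normed_vector" and c :: real
  assumes f: "momO M n f" and g: "\<forall>\<^sub>F m in sequentially. g m \<in> borel_measurable M"
    and le: "\<forall>\<^sub>F m in sequentially. \<forall>w\<in>space M. norm (g m w) \<le> c * norm (f m w)"
  shows "momO M n g"
proof (rule momO_dominated)
  show "momO M n (\<lambda>m w. norm c * norm (f m w))"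
    using momO_mult_norm[OF momO_const_0[of c] f] by simp
  show "\<forall>\<^sub>F m in sequentially. \<forall>w\<in>space M. norm (g m w) \<le> norm (norm c * norm (f m w))"
    using le
  proof eventually_elim
    case (elim m)
    show ?case
    proof
      fix w assume "w \<in> space M"
      then have "norm (g m w) \<le> c * norm (f m w)" using elim by blast
      also have "\<dots> \<le> \<bar>c\<bar> * norm (f m w)" by (intro mult_right_mono) auto
      finally show "norm (g m w) \<le> norm (norm c * norm (f m w))" by (simp add: abs_mult)
    qed
  qed
qed (rule g)

lemma (in prob_space) momO_linear:
  assumes f: "momO M n f" and h: "bounded_linear h"
  shows "momO M n (\<lambda>m w. h (f m w))"
proof -
  obtain c where c: "\<And>x. norm (h x) \<le> norm x * c" using bounded_linear.bounded[OF h] by blast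
  have [measurable]: "h \<in> borel_measurable borel"
    by (intro borel_measurable_continuous_onI linear_continuous_on h)
  show ?thesis
  proof (rule momO_scale_bound[OF f, where c=c])
    show "\<forall>\<^sub>F m in sequentially. (\<lambda>w. h (f m w)) \<in> borel_measurable M"
      using momO_measurable[OF f] by eventually_elim measurable
    show "\<forall>\<^sub>F m in sequentially. \<forall>w\<in>space M. norm (h (f m w)) \<le> c * norm (f m w)"
      by (intro always_eventually allI ballI) (simp add: c mult.commute[of c])
  qed
qed

lemma (in prob_space) momO_cmult: "momO M n f \<Longrightarrow> momO M n (\<lambda>m w. c * f m w)" for c :: real
  by (rule momO_linear[OF _ bounded_linear_mult_right])

lemma (in prob_space) momO_sum:
  fixes f :: "'i \<Rightarrow> nat \<Rightarrow> 'a \<Rightarrow> 'b::{second_countable_topology, real_normed_vector}"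
  assumes "\<And>i. i \<in> I \<Longrightarrow> momO M n (f i)"
  shows "momO M n (\<lambda>m w. \<Sum>i\<in>I. f i m w)"
  using assms
proof (induction I rule: infinite_finite_induct)
  case (insert i I)
  then have "momO M n (f i)" "momO M n (\<lambda>m w. \<Sum>i\<in>I. f i m w)" by auto
  from momO_add[OF this] show ?case using insert by simp
qed (auto intro: momO_zero)

lemma (in prob_space) momO_uminus: "momO M n f \<Longrightarrow> momO M n (\<lambda>m w. - f m w)"
  by (rule momO_linear[OF _ bounded_linear_minus[OF bounded_linear_ident]])

lemma (in prob_space) momO_diff:
  fixes f g :: "nat \<Rightarrow> 'a \<Rightarrow> 'b::{second_countable_topology, real_normed_vector}"
  shows "momO M n f \<Longrightarrow> momO M n g \<Longrightarrow> momO M n (\<lambda>m w. f m w - g m w)"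
  using momO_add[of M n f "\<lambda>m w. - g m w"] momO_uminus[of n g] by simp

lemma momO_cong:
  assumes "momO M n f" "\<forall>\<^sub>F m in sequentially. \<forall>w\<in>space M. f m w = g m w"
  shows "momO M n g"
proof (rule momO_dominated[OF assms(1)])
  show "\<forall>\<^sub>F m in sequentially. g m \<in> borel_measurable M"
    using momO_measurable[OF assms(1)] assms(2)
    by eventually_elim (metis (no_types, lifting) measurable_cong)
  show "\<forall>\<^sub>F m in sequentially. \<forall>w\<in>space M. norm (g m w) \<le> norm (f m w)"
    using assms(2) by eventually_elim simp
qed

lemma (in prob_space) momO_vec:
  fixes f :: "nat \<Rightarrow> 'a \<Rightarrow> ('b::euclidean_space)^'k"
  assumes "\<And>i. momO M n (\<lambda>m w. f m w $ i)"
  shows "momO M n f"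
proof (rule momO_dominated)
  show "momO M n (\<lambda>m w. \<Sum>i\<in>UNIV. norm (f m w $ i))"
    by (intro momO_sum momO_norm assms)
  have "\<forall>\<^sub>F m in sequentially. \<forall>i. (\<lambda>w. f m w $ i) \<in> borel_measurable M"
    by (rule eventually_all_finite) (rule momO_measurable[OF assms])
  then show "\<forall>\<^sub>F m in sequentially. f m \<in> borel_measurable M"
  proof eventually_elim
    case (elim m)
    show ?case
    proof (rule borel_measurable_euclidean_space[THEN iffD2, OF ballI])
      fix b :: "'b^'k" assume "b \<in> Basis"
      then obtain i c where b: "b = axis i c" by (auto simp: Basis_vec_def)
      have [measurable]: "(\<lambda>w. f m w $ i) \<in> borel_measurable M" using elim by blast
      show "(\<lambda>w. f m w \<bullet> b) \<in> borel_measurable M" unfolding b inner_axis by measurable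
    qed
  qed
  show "\<forall>\<^sub>F m in sequentially. \<forall>w\<in>space M. norm (f m w) \<le> norm (\<Sum>i\<in>UNIV. norm (f m w $ i))"
  proof (intro always_eventually allI ballI)
    fix m w
    have "norm (f m w) \<le> (\<Sum>i\<in>UNIV. norm (f m w $ i))"
      unfolding norm_vec_def[of "f m w"] by (rule L2_set_le_sum) simp
    also have "\<dots> \<le> norm (\<Sum>i\<in>UNIV. norm (f m w $ i))" by simp
    finally show "norm (f m w) \<le> norm (\<Sum>i\<in>UNIV. norm (f m w $ i))" .
  qed
qed

lemma (in prob_space) momO_nth:
  fixes f :: "nat \<Rightarrow> 'a \<Rightarrow> ('b::real_normed_vector)^'k"
  shows "momO M n f \<Longrightarrow> momO M n (\<lambda>m w. f m w $ i)"
  by (rule momO_linear[OF _ bounded_linear_vec_nth])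

lemma (in prob_space) momO_bilinear:
  fixes h :: "'b::{second_countable_topology, real_normed_vector} \<Rightarrow> 'c::{second_countable_topology, real_normed_vector}
     \<Rightarrow> 'd::{second_countable_topology, real_normed_vector}"
  assumes h: "bounded_bilinear h" and f: "momO M n f" and g: "momO M k g"
  shows "momO M (n + k) (\<lambda>m w. h (f m w) (g m w))"
proof -
  interpret h: bounded_bilinear h by (rule h)
  obtain K where K: "\<And>x y. norm (h x y) \<le> norm x * norm y * K" using h.bounded by blast
  show ?thesis
  proof (rule momO_scale_bound[OF momO_mult_norm[OF f g], where c=K])
    show "\<forall>\<^sub>F m in sequentially. (\<lambda>w. h (f m w) (g m w)) \<in> borel_measurable M"
      using momO_measurable[OF f] momO_measurable[OF g]
    proof eventually_elim
      case (elim m)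
      show ?case
        by (rule borel_measurable_continuous_Pair[OF elim]) (intro h.continuous_on continuous_intros)
    qed
    show "\<forall>\<^sub>F m in sequentially. \<forall>w\<in>space M. norm (h (f m w) (g m w)) \<le> K * norm (norm (f m w) * norm (g m w))"
      using K by (intro always_eventually allI ballI) (simp add: mult_ac)
  qed
qed

lemmas (in prob_space) momO_mv = momO_bilinear[OF bounded_bilinear_matrix_vector]
lemmas (in prob_space) momO_outer = momO_bilinear[OF bounded_bilinear_outer]
lemmas (in prob_space) momO_scaleR = momO_bilinear[OF bounded_bilinear_scaleR]

lemma (in prob_space) momO_inverse_nat: "momO M 2 (\<lambda>m w. 1 / real m)"
  by (rule momO_const[where C=1], rule always_eventually) (simp add: power_divide)

lemma (in prob_space) momO_cmult_inverse_nat: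
  fixes f :: "nat \<Rightarrow> 'a \<Rightarrow> 'b::{second_countable_topology, real_normed_vector}"
  shows "momO M n f \<Longrightarrow> momO M (2 + n) (\<lambda>m w. (1 / real m) *\<^sub>R f m w)"
  by (rule momO_scaleR[OF momO_inverse_nat])

text \<open>The case p = 1: this is how orders in all moments are turned back into bounds for
  expectations.\<close>

lemma momO_expectation:
  fixes f :: "nat \<Rightarrow> 'a \<Rightarrow> 'b::{banach, second_countable_topology}"
  assumes f: "momO M n f"
  obtains C where "\<forall>\<^sub>F m in sequentially. integrable M (f m) \<and> norm (LINT w|M. f m w) \<le> C * (1 / sqrt (real m)) ^ n"
proof -
  obtain C where "0 \<le> C" and C: "\<forall>\<^sub>F m in sequentially. integrable M (\<lambda>w. norm (f m w) ^ 1) \<and>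
        (LINT w|M. norm (f m w) ^ 1) \<le> C * (1 / sqrt (real m)) ^ (n * 1)"
    by (rule momO_moment[OF f])
  have "\<forall>\<^sub>F m in sequentially. integrable M (f m) \<and> norm (LINT w|M. f m w) \<le> C * (1 / sqrt (real m)) ^ n"
    using C momO_measurable[OF f]
  proof eventually_elim
    case (elim m)
    then have "integrable M (f m)" using integrable_norm_iff[of "f m" M] by simp
    moreover have "norm (LINT w|M. f m w) \<le> (LINT w|M. norm (f m w))" by (rule integral_norm_bound)
    moreover have "(LINT w|M. norm (f m w)) \<le> C * (1 / sqrt (real m)) ^ n" using elim by simp
    ultimately show ?case by linarith
  qed
  then show ?thesis using that by blast
qed

lemma power_le_fact_exp: "0 \<le> x \<Longrightarrow> x ^ p \<le> fact p * exp x" for x :: real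
proof -
  assume x: "0 \<le> x"
  have "x ^ p / fact p \<le> exp x"
  proof -
    have "(\<Sum>n\<in>{p}. x ^ n /\<^sub>R fact n) \<le> (\<Sum>n. x ^ n /\<^sub>R fact n)"
      by (rule sum_le_suminf[OF summable_exp_generic]) (use x in auto)
    then show ?thesis by (simp add: exp_def divide_inverse mult.commute)
  qed
  then show ?thesis by (simp add: field_simps)
qed

text \<open>One exponential moment at the scale m^(n/2) controls all powers, since x^p \<le> p! e^x
  for nonnegative x.\<close>

lemma (in prob_space) momO_from_exp:
  fixes f :: "nat \<Rightarrow> 'a \<Rightarrow> real"
  assumes r: "r > 0"
    and f: "\<forall>\<^sub>F m in sequentially. f m \<in> borel_measurable M"
    and e: "\<forall>\<^sub>F m in sequentially. integrable M (\<lambda>w. exp (r * sqrt (real m) ^ n * \<bar>f m w\<bar>)) \<and>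
       expectation (\<lambda>w. exp (r * sqrt (real m) ^ n * \<bar>f m w\<bar>)) \<le> K"
  shows "momO M n f"
  unfolding momO_def
proof (intro conjI allI)
  fix p :: nat
  have "\<forall>\<^sub>F m in sequentially. integrable M (\<lambda>w. norm (f m w) ^ p) \<and>
        (LINT w|M. norm (f m w) ^ p) \<le> (fact p * (1 / r) ^ p * K) * (1 / sqrt (real m)) ^ (n * p)"
    using f e eventually_sqrt_inverse_le_1
  proof eventually_elim
    case (elim m)
    define s where "s = r * sqrt (real m) ^ n"
    have s: "s > 0" using elim r by (simp add: s_def)
    have [measurable]: "f m \<in> borel_measurable M" using elim by auto
    have le: "norm (f m w) ^ p \<le> fact p * (1 / s) ^ p * exp (s * \<bar>f m w\<bar>)" for w
    proof -
      have "(s * \<bar>f m w\<bar>) ^ p \<le> fact p * exp (s * \<bar>f m w\<bar>)" using s by (intro power_le_fact_exp) auto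
      then show ?thesis using s by (simp add: power_mult_distrib field_simps)
    qed
    have int: "integrable M (\<lambda>w. fact p * (1 / s) ^ p * exp (s * \<bar>f m w\<bar>))"
      using elim by (auto simp: s_def)
    have int': "integrable M (\<lambda>w. norm (f m w) ^ p)"
      by (rule Bochner_Integration.integrable_bound[OF int]) (use le s in \<open>auto intro!: AE_I2 simp: power_abs[symmetric] abs_mult\<close>)
    have "(LINT w|M. norm (f m w) ^ p) \<le> (LINT w|M. fact p * (1 / s) ^ p * exp (s * \<bar>f m w\<bar>))"
      by (rule integral_mono[OF int' int le])
    also have "\<dots> \<le> fact p * (1 / s) ^ p * K"
      using elim s by (auto simp: s_def intro!: mult_left_mono)
    also have "(1 / s) ^ p = (1 / r) ^ p * (1 / sqrt (real m)) ^ (n * p)"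
      by (simp add: s_def power_mult_distrib power_divide power_mult)
    finally show ?case using int' by (simp add: mult_ac)
  qed
  then show "\<exists>C. \<forall>\<^sub>F m in sequentially. integrable M (\<lambda>w. norm (f m w) ^ p) \<and>
        (LINT w|M. norm (f m w) ^ p) \<le> C * (1 / sqrt (real m)) ^ (n * p)" by blast
qed (rule f)

lemma integrable_exp_abs:
  fixes Z :: "'a \<Rightarrow> real"
  assumes [measurable]: "Z \<in> borel_measurable M"
    and "integrable M (\<lambda>w. exp (s * Z w))" "integrable M (\<lambda>w. exp (- s * Z w))" "s \<ge> 0"
  shows "integrable M (\<lambda>w. exp (s * \<bar>Z w\<bar>))"
    "(LINT w|M. exp (s * \<bar>Z w\<bar>)) \<le> (LINT w|M. exp (s * Z w)) + (LINT w|M. exp (- s * Z w))"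
proof -
  have int: "integrable M (\<lambda>w. exp (s * Z w) + exp (- s * Z w))" using assms by auto
  have le: "exp (s * \<bar>Z w\<bar>) \<le> exp (s * Z w) + exp (- s * Z w)" for w
    by (cases "Z w \<ge> 0") (auto simp: add_increasing add_increasing2)
  show int': "integrable M (\<lambda>w. exp (s * \<bar>Z w\<bar>))"
    by (rule Bochner_Integration.integrable_bound[OF int]) (use le in \<open>auto intro!: AE_I2 intro: order_trans[OF _ abs_ge_self]\<close>)
  have "(LINT w|M. exp (s * \<bar>Z w\<bar>)) \<le> (LINT w|M. exp (s * Z w) + exp (- s * Z w))"
    by (rule integral_mono[OF int' int le])
  then show "(LINT w|M. exp (s * \<bar>Z w\<bar>)) \<le> (LINT w|M. exp (s * Z w)) + (LINT w|M. exp (- s * Z w))"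
    using assms by simp
qed

section \<open>Exponential moments\<close>

text \<open>The Chernoff bound at scale \<open>1 / sqrt m\<close> controls all moments of a normalized centred sum at once.\<close>

lemma exp_le_quadratic: "exp x \<le> 1 + x + x\<^sup>2 * exp \<bar>x\<bar>" for x :: real
proof -
  obtain t where t: "\<bar>t\<bar> \<le> \<bar>x\<bar>" "exp x = (\<Sum>m<2. x ^ m / fact m) + exp t / fact 2 * x ^ 2"
    using Maclaurin_exp_le by blast
  have "exp t / fact 2 * x ^ 2 \<le> exp \<bar>x\<bar> * x ^ 2"
  proof (intro mult_right_mono)
    have "exp t \<le> exp \<bar>x\<bar>" using t(1) by simp
    moreover have "exp t / fact 2 \<le> exp t" by (simp add: fact_numeral)
    ultimately show "exp t / fact 2 \<le> exp \<bar>x\<bar>" by linarith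
  qed simp
  then show ?thesis using t(2) by (simp add: numeral_2_eq_2 mult.commute)
qed

text \<open>In the quadratic expansion of exp the linear term has mean zero, so the exponential
  moment is 1 + O(t^2). Restricting |t| to c/2 leaves room for the square in front of the
  exponential.\<close>

lemma (in prob_space) centered_mgf_bound:
  fixes Y :: "'a \<Rightarrow> real"
  assumes [measurable]: "Y \<in> borel_measurable M"
    and c: "c > 0" and int: "integrable M (\<lambda>w. exp (c * \<bar>Y w\<bar>))" and K: "expectation (\<lambda>w. exp (c * \<bar>Y w\<bar>)) \<le> K"
    and zero: "expectation Y = 0" and t: "\<bar>t\<bar> \<le> c / 2"
  shows "integrable M (\<lambda>w. exp (t * Y w))" "expectation (\<lambda>w. exp (t * Y w)) \<le> exp (8 * K / c\<^sup>2 * t\<^sup>2)"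
proof -
  have intY: "integrable M Y"
  proof (rule Bochner_Integration.integrable_bound[OF integrable_mult_right[OF int, of "1/c"]])
    have "\<bar>Y w\<bar> \<le> 1 / c * exp (c * \<bar>Y w\<bar>)" for w
    proof -
      have "c * \<bar>Y w\<bar> \<le> exp (c * \<bar>Y w\<bar>)" using exp_ge_add_one_self[of "c * \<bar>Y w\<bar>"] by linarith
      then show ?thesis using c by (simp add: field_simps)
    qed
    then show "AE w in M. norm (Y w) \<le> norm (1 / c * exp (c * \<bar>Y w\<bar>))"
      using c by (intro AE_I2) (simp add: abs_mult)
  qed simp
  have le: "exp (t * Y w) \<le> 1 + t * Y w + 8 / c\<^sup>2 * t\<^sup>2 * exp (c * \<bar>Y w\<bar>)" for w
  proof -
    \<comment> \<open>Half of the exponent c pays for the square of Y, the other half for exp |tY|.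
      The constant 8 / c^2 is 2! (2/c)^2.\<close>
    have "(c / 2 * \<bar>Y w\<bar>) ^ 2 \<le> fact 2 * exp (c / 2 * \<bar>Y w\<bar>)" using c by (intro power_le_fact_exp) auto
    then have 1: "(Y w)\<^sup>2 \<le> 8 / c\<^sup>2 * exp (c / 2 * \<bar>Y w\<bar>)" using c by (simp add: power_mult_distrib field_simps power2_eq_square fact_numeral)
    have 2: "exp \<bar>t * Y w\<bar> \<le> exp (c / 2 * \<bar>Y w\<bar>)" using mult_right_mono[OF t, of "\<bar>Y w\<bar>"] by (simp add: abs_mult)
    have "(Y w)\<^sup>2 * exp \<bar>t * Y w\<bar> \<le> (8 / c\<^sup>2 * exp (c / 2 * \<bar>Y w\<bar>)) * exp (c / 2 * \<bar>Y w\<bar>)"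
      by (rule mult_mono[OF 1 2]) auto
    also have "\<dots> = 8 / c\<^sup>2 * exp (c * \<bar>Y w\<bar>)" by (simp add: exp_add[symmetric])
    finally have "t\<^sup>2 * ((Y w)\<^sup>2 * exp \<bar>t * Y w\<bar>) \<le> t\<^sup>2 * (8 / c\<^sup>2 * exp (c * \<bar>Y w\<bar>))"
      by (rule mult_left_mono) simp
    then show ?thesis using exp_le_quadratic[of "t * Y w"] by (simp add: power_mult_distrib mult_ac)
  qed
  have int1: "integrable M (\<lambda>w. 1 + t * Y w + 8 / c\<^sup>2 * t\<^sup>2 * exp (c * \<bar>Y w\<bar>))"
    using intY int by auto
  show int2: "integrable M (\<lambda>w. exp (t * Y w))"
    by (rule Bochner_Integration.integrable_bound[OF int1]) (use le in \<open>auto intro!: AE_I2 intro: order_trans[OF _ abs_ge_self]\<close>)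
  have "expectation (\<lambda>w. exp (t * Y w)) \<le> expectation (\<lambda>w. 1 + t * Y w + 8 / c\<^sup>2 * t\<^sup>2 * exp (c * \<bar>Y w\<bar>))"
    by (rule integral_mono[OF int2 int1 le])
  also have "\<dots> = 1 + 8 / c\<^sup>2 * t\<^sup>2 * expectation (\<lambda>w. exp (c * \<bar>Y w\<bar>))"
    using intY int zero by (simp add: prob_space)
  also have "\<dots> \<le> 1 + 8 / c\<^sup>2 * t\<^sup>2 * K" using K by (intro add_left_mono mult_left_mono) auto
  also have "\<dots> \<le> exp (8 * K / c\<^sup>2 * t\<^sup>2)" using exp_ge_add_one_self[of "8 * K / c\<^sup>2 * t\<^sup>2"] by (simp add: mult_ac)
  finally show "expectation (\<lambda>w. exp (t * Y w)) \<le> exp (8 * K / c\<^sup>2 * t\<^sup>2)" .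
qed

lemma (in prob_space) indep_vars_exp_sum:
  fixes Y :: "'i \<Rightarrow> 'a \<Rightarrow> real"
  assumes ind: "indep_vars (\<lambda>_. borel) Y J" and fin: "finite J"
    and int: "\<And>j. j \<in> J \<Longrightarrow> integrable M (\<lambda>w. exp (t * Y j w))"
  shows "integrable M (\<lambda>w. exp (t * (\<Sum>j\<in>J. Y j w)))"
    "expectation (\<lambda>w. exp (t * (\<Sum>j\<in>J. Y j w))) = (\<Prod>j\<in>J. expectation (\<lambda>w. exp (t * Y j w)))"
proof -
  have ind': "indep_vars (\<lambda>_. borel) (\<lambda>j w. exp (t * Y j w)) J"
    by (rule indep_vars_compose2[OF ind]) simp
  have eq: "exp (t * (\<Sum>j\<in>J. Y j w)) = (\<Prod>j\<in>J. exp (t * Y j w))" for w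
    by (simp add: sum_distrib_left exp_sum[OF fin])
  show "integrable M (\<lambda>w. exp (t * (\<Sum>j\<in>J. Y j w)))"
    unfolding eq by (rule indep_vars_integrable[OF fin ind' int])
  show "expectation (\<lambda>w. exp (t * (\<Sum>j\<in>J. Y j w))) = (\<Prod>j\<in>J. expectation (\<lambda>w. exp (t * Y j w)))"
    unfolding eq by (rule indep_vars_lebesgue_integral[OF fin ind' int])
qed

text \<open>At t = (c/2) / sqrt m each factor of the moment generating function is at most exp
  (2K/m), and there are at most m factors. The set A allows areas to be left out without changing
  the normalization.\<close>

lemma (in prob_space) momO_centered_sum:
  fixes Y :: "nat \<Rightarrow> 'a \<Rightarrow> real"
  assumes ind: "indep_vars (\<lambda>_. borel) Y UNIV"
    and c: "c > 0" and int: "\<And>i. integrable M (\<lambda>w. exp (c * \<bar>Y i w\<bar>))"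
    and K: "\<And>i. expectation (\<lambda>w. exp (c * \<bar>Y i w\<bar>)) \<le> K"
    and zero: "\<And>i. expectation (Y i) = 0"
  shows "momO M 1 (\<lambda>m w. (\<Sum>i\<in>{..<m} - A. Y i w) / real m)"
proof (rule momO_from_exp[where r="c/2" and K="2 * exp (2 * K)"])
  have [measurable]: "Y i \<in> borel_measurable M" for i using ind by (auto simp: indep_vars_def)
  have K0: "K \<ge> 0" by (rule order_trans[OF Bochner_Integration.integral_nonneg K[of 0]]) simp
  show "\<forall>\<^sub>F m in sequentially. (\<lambda>w. (\<Sum>i\<in>{..<m} - A. Y i w) / real m) \<in> borel_measurable M" by simp
  show "\<forall>\<^sub>F m in sequentially. integrable M (\<lambda>w. exp (c / 2 * sqrt (real m) ^ 1 * \<bar>(\<Sum>i\<in>{..<m} - A. Y i w) / real m\<bar>)) \<and>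
       expectation (\<lambda>w. exp (c / 2 * sqrt (real m) ^ 1 * \<bar>(\<Sum>i\<in>{..<m} - A. Y i w) / real m\<bar>)) \<le> 2 * exp (2 * K)"
    using eventually_ge_at_top[of 1]
  proof eventually_elim
    case (elim m)
    define J where "J = {..<m} - A"
    have J: "finite J" "card J \<le> m" unfolding J_def using card_mono[of "{..<m}" "{..<m} - A"] by auto
    define t where "t = c / 2 / sqrt (real m)"
    have t: "t > 0" "t \<le> c / 2" "t\<^sup>2 = c\<^sup>2 / (4 * real m)" using c elim by (auto simp: t_def field_simps power_divide)
    have eq: "c / 2 * sqrt (real m) ^ 1 * \<bar>(\<Sum>i\<in>{..<m} - A. Y i w) / real m\<bar> = t * \<bar>\<Sum>i\<in>J. Y i w\<bar>" for w
    proof -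
      have "c / 2 * sqrt (real m) ^ 1 * \<bar>(\<Sum>i\<in>J. Y i w) / real m\<bar>
          = c / 2 * (sqrt (real m) / real m) * \<bar>\<Sum>i\<in>J. Y i w\<bar>" by simp
      also have "sqrt (real m) / real m = 1 / sqrt (real m)" using elim by (simp add: real_div_sqrt field_simps)
      finally show ?thesis by (simp add: J_def t_def)
    qed
    have ind': "indep_vars (\<lambda>_. borel) Y J" by (rule indep_vars_subset[OF ind]) auto
    have bnd: "integrable M (\<lambda>w. exp (u * (\<Sum>j\<in>J. Y j w))) \<and> expectation (\<lambda>w. exp (u * (\<Sum>j\<in>J. Y j w))) \<le> exp (2 * K)"
      if u: "\<bar>u\<bar> = t" for u
    proof -
      have uc: "\<bar>u\<bar> \<le> c / 2" using u t by simp
      note mg = centered_mgf_bound[OF _ c int K zero uc]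
      have i: "integrable M (\<lambda>w. exp (u * Y j w))" for j by (rule mg) simp
      have u2: "u\<^sup>2 = c\<^sup>2 / (4 * real m)" using u t by (metis power2_abs)
      have "expectation (\<lambda>w. exp (u * (\<Sum>j\<in>J. Y j w))) = (\<Prod>j\<in>J. expectation (\<lambda>w. exp (u * Y j w)))"
        by (rule indep_vars_exp_sum(2)[OF ind' J(1) i])
      also have "\<dots> \<le> (\<Prod>j\<in>J. exp (8 * K / c\<^sup>2 * u\<^sup>2))"
      proof (rule prod_mono)
        fix j
        have "expectation (\<lambda>w. exp (u * Y j w)) \<le> exp (8 * K / c\<^sup>2 * u\<^sup>2)" by (rule mg(2)) simp
        then show "0 \<le> expectation (\<lambda>w. exp (u * Y j w)) \<and> expectation (\<lambda>w. exp (u * Y j w)) \<le> exp (8 * K / c\<^sup>2 * u\<^sup>2)"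
          by simp
      qed
      also have "\<dots> = exp (real (card J) * (8 * K / c\<^sup>2 * u\<^sup>2))" by (simp only: exp_of_nat_mult prod_constant)
      also have "\<dots> \<le> exp (2 * K)"
      proof -
        have "real (card J) * (8 * K / c\<^sup>2 * u\<^sup>2) \<le> real m * (8 * K / c\<^sup>2 * u\<^sup>2)"
          using J K0 by (intro mult_right_mono) auto
        also have "\<dots> = 2 * K" using c elim by (simp add: u2)
        finally show ?thesis by simp
      qed
      finally show ?thesis using indep_vars_exp_sum(1)[OF ind' J(1) i] by simp
    qed
    have m: "(\<lambda>w. \<Sum>i\<in>J. Y i w) \<in> borel_measurable M" by measurable
    note b1 = bnd[of t] and b2 = bnd[of "- t"]
    show ?case unfolding eq
      using integrable_exp_abs[OF m, of t] b1 b2 t by auto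
  qed
qed (use c in simp)

section \<open>Moments from the moment generating function\<close>

text \<open>The constant coefficient vanishes on letting s tend to 0; division by s then lowers N by
  one.\<close>

lemma polynomial_small_zero:
  fixes d :: "nat \<Rightarrow> real"
  assumes "\<And>s. 0 < s \<Longrightarrow> s \<le> 1 \<Longrightarrow> \<bar>\<Sum>n<N. d n * s ^ n\<bar> \<le> C * s ^ N" "n < N"
  shows "d n = 0"
  using assms
proof (induction N arbitrary: d n)
  case (Suc N)
  define B where "B = \<bar>C\<bar> + (\<Sum>n<N. \<bar>d (Suc n)\<bar>)"
  have split: "(\<Sum>n<Suc N. d n * s ^ n) = d 0 + s * (\<Sum>n<N. d (Suc n) * s ^ n)" for s
    by (simp add: sum.lessThan_Suc_shift sum_distrib_left mult_ac del: sum.lessThan_Suc)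
  have d0: "d 0 = 0"
  proof (rule ccontr)
    assume nz: "d 0 \<noteq> 0"
    have le: "\<bar>d 0\<bar> \<le> s * B" if s: "0 < s" "s \<le> 1" for s
    proof -
      have "\<bar>d 0\<bar> \<le> \<bar>\<Sum>n<Suc N. d n * s ^ n\<bar> + s * \<bar>\<Sum>n<N. d (Suc n) * s ^ n\<bar>"
        unfolding split using s abs_triangle_ineq4[of "d 0 + s * (\<Sum>n<N. d (Suc n) * s ^ n)" "s * (\<Sum>n<N. d (Suc n) * s ^ n)"]
        by (simp add: abs_mult)
      also have "\<dots> \<le> \<bar>C\<bar> * s + s * (\<Sum>n<N. \<bar>d (Suc n)\<bar>)"
      proof (intro add_mono mult_left_mono)
        have "\<bar>\<Sum>n<Suc N. d n * s ^ n\<bar> \<le> C * s ^ Suc N" using Suc.prems(1) s by blast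
        also have "\<dots> \<le> \<bar>C\<bar> * s" 
          using s by (intro mult_mono) (auto simp: power_le_one mult_left_le)
        finally show "\<bar>\<Sum>n<Suc N. d n * s ^ n\<bar> \<le> \<bar>C\<bar> * s" .
        have "\<bar>\<Sum>n<N. d (Suc n) * s ^ n\<bar> \<le> (\<Sum>n<N. \<bar>d (Suc n) * s ^ n\<bar>)" by (rule sum_abs)
        also have "\<dots> \<le> (\<Sum>n<N. \<bar>d (Suc n)\<bar>)"
          using s by (intro sum_mono) (auto simp: abs_mult power_le_one mult_left_le)
        finally show "\<bar>\<Sum>n<N. d (Suc n) * s ^ n\<bar> \<le> (\<Sum>n<N. \<bar>d (Suc n)\<bar>)" .
      qed (use s in auto)
      finally show ?thesis by (simp add: B_def algebra_simps)
    qed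
    have B: "B \<ge> 0" by (simp add: B_def sum_nonneg)
    \<comment> \<open>Small enough that s B cannot exceed half of |d 0|.\<close>
    define s where "s = min 1 (\<bar>d 0\<bar> / (2 * (B + 1)))"
    have "0 < s" "s \<le> 1" using nz B by (auto simp: s_def)
    from le[OF this] have "\<bar>d 0\<bar> \<le> s * B" .
    also have "\<dots> \<le> \<bar>d 0\<bar> / (2 * (B + 1)) * (B + 1)"
      using B by (intro mult_mono) (auto simp: s_def)
    also have "\<dots> = \<bar>d 0\<bar> / 2" using B by (simp add: divide_simps)
    finally show False using nz by simp
  qed
  show ?case
  proof (cases n)
    case (Suc k)
    have "d (Suc k) = 0"
    proof (rule Suc.IH[of "\<lambda>n. d (Suc n)"])
      fix s :: real assume s: "0 < s" "s \<le> 1"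
      have "s * \<bar>\<Sum>n<N. d (Suc n) * s ^ n\<bar> \<le> s * (C * s ^ N)"
        using Suc.prems(1)[OF s] unfolding split d0 using s by (simp add: abs_mult mult_ac)
      then show "\<bar>\<Sum>n<N. d (Suc n) * s ^ n\<bar> \<le> C * s ^ N" using s by simp
    qed (use Suc Suc.prems in simp)
    then show ?thesis using Suc by simp
  qed (simp add: d0)
qed simp

lemma exp_taylor_bound: "\<bar>exp x - (\<Sum>m<n. x ^ m / fact m)\<bar> \<le> \<bar>x\<bar> ^ n * exp \<bar>x\<bar>" for x :: real
proof -
  obtain t where t: "\<bar>t\<bar> \<le> \<bar>x\<bar>" "exp x = (\<Sum>m<n. x ^ m / fact m) + exp t / fact n * x ^ n"
    using Maclaurin_exp_le by blast
  have "\<bar>exp t / fact n * x ^ n\<bar> = (exp t / fact n) * \<bar>x\<bar> ^ n" by (simp add: abs_mult power_abs)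
  also have "\<dots> \<le> exp \<bar>x\<bar> * \<bar>x\<bar> ^ n"
  proof (intro mult_right_mono)
    have "exp t / fact n \<le> exp t / 1" by (intro divide_left_mono) (auto simp: fact_ge_1)
    also have "\<dots> \<le> exp \<bar>x\<bar>" using t by simp
    finally show "exp t / fact n \<le> exp \<bar>x\<bar>" .
  qed simp
  finally show ?thesis using t(2) by (simp add: mult.commute)
qed

text \<open>Both sides of the identity for the moment generating function are expanded to degree 4
  with an error O(s^5), and the coefficients are compared. This avoids differentiation under the
  integral.\<close>

lemma (in prob_space) normal_mgf_moments:
  fixes Z :: "'a \<Rightarrow> real"
  assumes [measurable]: "Z \<in> borel_measurable M"
    and int: "\<And>s. integrable M (\<lambda>w. exp (s * Z w))"
    and mgf: "\<And>s. expectation (\<lambda>w. exp (s * Z w)) = exp (s\<^sup>2 * v / 2)"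
  shows "expectation Z = 0" "expectation (\<lambda>w. (Z w)\<^sup>2) = v" "expectation (\<lambda>w. Z w ^ 4) = 3 * v\<^sup>2"
proof -
  have int_e: "integrable M (\<lambda>w. exp (s * \<bar>Z w\<bar>))" if "s \<ge> 0" for s
    by (rule integrable_exp_abs(1)) (use int[of s] int[of "-s"] that in auto)
  have intZe: "integrable M (\<lambda>w. \<bar>Z w\<bar> ^ n * exp \<bar>Z w\<bar>)" for n
  proof (rule Bochner_Integration.integrable_bound)
    show "integrable M (\<lambda>w. fact n * exp (2 * \<bar>Z w\<bar>))" using int_e[of 2] by auto
    have "\<bar>Z w\<bar> ^ n * exp \<bar>Z w\<bar> \<le> (fact n * exp \<bar>Z w\<bar>) * exp \<bar>Z w\<bar>" for w
      by (intro mult_right_mono power_le_fact_exp) auto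
    then show "AE w in M. norm (\<bar>Z w\<bar> ^ n * exp \<bar>Z w\<bar>) \<le> norm (fact n * exp (2 * \<bar>Z w\<bar>))"
      by (intro AE_I2) (simp add: abs_mult mult.assoc exp_add[symmetric])
  qed simp
  have intZ: "integrable M (\<lambda>w. Z w ^ n)" for n
  proof (rule Bochner_Integration.integrable_bound[OF intZe[of n]])
    show "AE w in M. norm (Z w ^ n) \<le> norm (\<bar>Z w\<bar> ^ n * exp \<bar>Z w\<bar>)"
      by (intro AE_I2) (simp add: abs_mult power_abs mult_left_le mult_le_cancel_left1)
  qed simp
  define mu where "mu n = expectation (\<lambda>w. Z w ^ n)" for n
  \<comment> \<open>Taylor coefficients of exp (s^2 v / 2) up to degree 4.\<close>
  define g where "g = (\<lambda>n::nat. if n = 0 then 1 else if n = 2 then v / 2 else if n = 4 then v\<^sup>2 / 8 else 0)"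
  define C where "C = expectation (\<lambda>w. \<bar>Z w\<bar> ^ 5 * exp \<bar>Z w\<bar>) + (\<bar>v\<bar> / 2) ^ 3 * exp (\<bar>v\<bar> / 2)"
  have five: "{..<5::nat} = {0, 1, 2, 3, 4}" and three: "{..<3::nat} = {0, 1, 2}" by auto
  have small: "\<bar>\<Sum>n<5. (mu n / fact n - g n) * s ^ n\<bar> \<le> C * s ^ 5" if s: "0 < s" "s \<le> 1" for s
  proof -
    have e: "expectation (\<lambda>w. \<Sum>n<5. (s * Z w) ^ n / fact n) = (\<Sum>n<5. mu n / fact n * s ^ n)"
      using intZ by (simp add: mu_def power_mult_distrib mult_ac)
    have i: "integrable M (\<lambda>w. \<Sum>n<5. (s * Z w) ^ n / fact n)"
      using intZ by (simp add: power_mult_distrib)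
    have "\<bar>expectation (\<lambda>w. exp (s * Z w)) - (\<Sum>n<5. mu n / fact n * s ^ n)\<bar>
       = \<bar>expectation (\<lambda>w. exp (s * Z w) - (\<Sum>n<5. (s * Z w) ^ n / fact n))\<bar>"
      unfolding e[symmetric] using i int by simp
    also have "\<dots> \<le> expectation (\<lambda>w. \<bar>exp (s * Z w) - (\<Sum>n<5. (s * Z w) ^ n / fact n)\<bar>)"
      using integral_norm_bound[of M "\<lambda>w. exp (s * Z w) - (\<Sum>n<5. (s * Z w) ^ n / fact n)"] by simp
    also have "\<dots> \<le> expectation (\<lambda>w. s ^ 5 * (\<bar>Z w\<bar> ^ 5 * exp \<bar>Z w\<bar>))"
    proof (rule integral_mono)
      fix w
      have "\<bar>exp (s * Z w) - (\<Sum>n<5. (s * Z w) ^ n / fact n)\<bar> \<le> \<bar>s * Z w\<bar> ^ 5 * exp \<bar>s * Z w\<bar>"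
        by (rule exp_taylor_bound)
      also have "\<dots> \<le> \<bar>s * Z w\<bar> ^ 5 * exp \<bar>Z w\<bar>"
        using s by (intro mult_left_mono) (auto simp: abs_mult mult_left_le_one_le)
      finally show "\<bar>exp (s * Z w) - (\<Sum>n<5. (s * Z w) ^ n / fact n)\<bar> \<le> s ^ 5 * (\<bar>Z w\<bar> ^ 5 * exp \<bar>Z w\<bar>)"
        using s by (simp add: abs_mult power_mult_distrib mult_ac)
    qed (use i int intZe in auto)
    also have "\<dots> = s ^ 5 * expectation (\<lambda>w. \<bar>Z w\<bar> ^ 5 * exp \<bar>Z w\<bar>)" by simp
    finally have 1: "\<bar>exp (s\<^sup>2 * v / 2) - (\<Sum>n<5. mu n / fact n * s ^ n)\<bar> \<le> s ^ 5 * expectation (\<lambda>w. \<bar>Z w\<bar> ^ 5 * exp \<bar>Z w\<bar>)"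
      by (simp add: mgf)
    have gs: "(\<Sum>n<5. g n * s ^ n) = (\<Sum>n<3. (s\<^sup>2 * v / 2) ^ n / fact n)"
      unfolding five three by (simp add: g_def fact_numeral power2_eq_square field_simps eval_nat_numeral)
    have "\<bar>exp (s\<^sup>2 * v / 2) - (\<Sum>n<5. g n * s ^ n)\<bar> \<le> \<bar>s\<^sup>2 * v / 2\<bar> ^ 3 * exp \<bar>s\<^sup>2 * v / 2\<bar>"
      unfolding gs by (rule exp_taylor_bound)
    also have "\<dots> \<le> (s ^ 5 * (\<bar>v\<bar> / 2) ^ 3) * exp (\<bar>v\<bar> / 2)"
    proof (intro mult_mono)
      have "\<bar>s\<^sup>2 * v / 2\<bar> ^ 3 = s ^ 6 * (\<bar>v\<bar> / 2) ^ 3" using s by (simp add: abs_mult power_mult_distrib power_divide power_mult[symmetric])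
      also have "\<dots> \<le> s ^ 5 * (\<bar>v\<bar> / 2) ^ 3" using s by (intro mult_right_mono power_decreasing) auto
      finally show "\<bar>s\<^sup>2 * v / 2\<bar> ^ 3 \<le> s ^ 5 * (\<bar>v\<bar> / 2) ^ 3" .
      show "exp \<bar>s\<^sup>2 * v / 2\<bar> \<le> exp (\<bar>v\<bar> / 2)" using s by (simp add: abs_mult mult_left_le_one_le power_le_one)
    qed (use s in auto)
    finally have 2: "\<bar>exp (s\<^sup>2 * v / 2) - (\<Sum>n<5. g n * s ^ n)\<bar> \<le> s ^ 5 * ((\<bar>v\<bar> / 2) ^ 3 * exp (\<bar>v\<bar> / 2))"
      by (simp add: mult_ac)
    have "(\<Sum>n<5. (mu n / fact n - g n) * s ^ n) = (\<Sum>n<5. mu n / fact n * s ^ n) - (\<Sum>n<5. g n * s ^ n)"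
      by (simp add: sum_subtractf algebra_simps)
    then show ?thesis using 1 2 by (simp add: C_def algebra_simps)
  qed
  note z = polynomial_small_zero[OF small]
  show "expectation Z = 0" using z[of 1] by (simp add: mu_def g_def)
  show "expectation (\<lambda>w. (Z w)\<^sup>2) = v" using z[of 2] by (simp add: mu_def g_def fact_numeral)
  show "expectation (\<lambda>w. Z w ^ 4) = 3 * v\<^sup>2" using z[of 4] by (simp add: mu_def g_def fact_numeral)
qed

section \<open>Measurability of matrix operations\<close>


lemma borel_measurable_matrix_vector [measurable]:
  fixes f :: "'z \<Rightarrow> real^'n^'m" and g :: "'z \<Rightarrow> real^'n"
  assumes "f \<in> borel_measurable M" "g \<in> borel_measurable M"
  shows "(\<lambda>w. f w *v g w) \<in> borel_measurable M"
  using assms by (intro borel_measurable_continuous_Pair[OF assms] mv.continuous_on continuous_intros)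

lemma borel_measurable_matrix_mult [measurable]:
  fixes f :: "'z \<Rightarrow> real^'n^'m" and g :: "'z \<Rightarrow> real^'p^'n"
  assumes "f \<in> borel_measurable M" "g \<in> borel_measurable M"
  shows "(\<lambda>w. f w ** g w) \<in> borel_measurable M"
  using assms by (intro borel_measurable_continuous_Pair[OF assms] mm.continuous_on continuous_intros)

lemma borel_measurable_outer [measurable]:
  fixes f g :: "'z \<Rightarrow> real^'n"
  assumes "f \<in> borel_measurable M" "g \<in> borel_measurable M"
  shows "(\<lambda>w. outer (f w) (g w)) \<in> borel_measurable M"
  using assms by (intro borel_measurable_continuous_Pair[OF assms] outer.continuous_on continuous_intros)

lemma borel_measurable_vec_lambda:
  fixes f :: "'z \<Rightarrow> 'n::finite \<Rightarrow> 'b::euclidean_space"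
  assumes "\<And>i. (\<lambda>w. f w i) \<in> borel_measurable M"
  shows "(\<lambda>w. \<chi> i. f w i) \<in> borel_measurable M"
proof (rule borel_measurable_euclidean_space[THEN iffD2, OF ballI])
  fix b :: "'b^'n" assume "b \<in> Basis"
  then obtain i c where b: "b = axis i c" by (auto simp: Basis_vec_def)
  have [measurable]: "(\<lambda>w. f w i) \<in> borel_measurable M" by (rule assms)
  show "(\<lambda>w. (\<chi> i. f w i) \<bullet> b) \<in> borel_measurable M" unfolding b inner_axis by simp
qed

lemma borel_measurable_vec_nth' [measurable (raw)]:
  fixes f :: "'z \<Rightarrow> ('b::real_normed_vector)^'n"
  assumes "f \<in> borel_measurable M"
  shows "(\<lambda>w. f w $ i) \<in> borel_measurable M"
  by (rule borel_measurable_continuous_on[OF _ assms]) (intro continuous_intros)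

text \<open>\<open>matrix_inv\<close> is a Hilbert choice, and for every singular matrix the
  predicate is the same empty one, so the value is one fixed matrix. This is what makes
  \<open>matrix_inv\<close> measurable everywhere.\<close>

lemma matrix_inv_not_invertible:
  assumes "\<not> invertible (A :: real^'n^'n)"
  shows "matrix_inv A = matrix_inv 0"
proof -
  have "(mat 1 :: real^'n^'n) \<noteq> 0" by (simp add: vec_eq_iff mat_def)
  then have "\<not> invertible (0 :: real^'n^'n)" unfolding invertible_def by (metis times0_left)
  then have "(\<lambda>B. A ** B = mat 1 \<and> B ** A = mat 1) = (\<lambda>B. (0 :: real^'n^'n) ** B = mat 1 \<and> B ** 0 = mat 1)"
    using assms unfolding invertible_def by blast
  then show ?thesis unfolding matrix_inv_def by simp
qed

lemma matrix_inv_cramer: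
  assumes "det (A :: real^'n^'n) \<noteq> 0"
  shows "matrix_inv A $ i $ j = det (\<chi> p q. if q = i then axis j 1 $ p else A $ p $ q) / det A"
proof -
  have inv: "invertible A" using assms by (simp add: invertible_det_nz)
  have "A *v (matrix_inv A *v axis j 1) = axis j 1" by (simp add: matrix_inv_vector inv)
  then have "matrix_inv A *v axis j 1 = (\<chi> i. det (\<chi> p q. if q = i then axis j 1 $ p else A $ p $ q) / det A)"
    using cramer[OF assms, of "matrix_inv A *v axis j 1" "axis j 1"] by simp
  moreover have "(matrix_inv A *v axis j 1) $ i = matrix_inv A $ i $ j"
    by (simp add: matrix_vector_mult_basis column_def)
  ultimately show ?thesis by simp
qed

lemma borel_measurable_det:
  fixes f :: "'z \<Rightarrow> real^'n^'n"
  assumes "\<And>i j. (\<lambda>w. f w $ i $ j) \<in> borel_measurable M"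
  shows "(\<lambda>w. det (f w)) \<in> borel_measurable M"
  unfolding det_def using assms by measurable

text \<open>Cramer's rule where the determinant is nonzero, a constant elsewhere.\<close>

lemma borel_measurable_matrix_inv [measurable]:
  fixes f :: "'z \<Rightarrow> real^'n^'n"
  assumes [measurable]: "f \<in> borel_measurable M"
  shows "(\<lambda>w. matrix_inv (f w)) \<in> borel_measurable M"
proof -
  have [measurable]: "(\<lambda>w. det (f w)) \<in> borel_measurable M"
    by (rule borel_measurable_det) measurable
  have [measurable]: "(\<lambda>w. det (\<chi> p q. if q = i then axis j 1 $ p else f w $ p $ q)) \<in> borel_measurable M" for i j
  proof (rule borel_measurable_det)
    fix p q
    show "(\<lambda>w. (\<chi> p q. if q = i then axis j 1 $ p else f w $ p $ q) $ p $ q) \<in> borel_measurable M"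
      by (cases "q = i") simp_all
  qed
  have "matrix_inv (f w) = (if det (f w) = 0 then matrix_inv 0
     else (\<chi> i j. det (\<chi> p q. if q = i then axis j 1 $ p else f w $ p $ q) / det (f w)))" for w
    using matrix_inv_not_invertible[of "f w"] matrix_inv_cramer[of "f w"]
    by (auto simp: invertible_det_nz vec_eq_iff)
  moreover have "(\<lambda>w. (\<chi> i j. det (\<chi> p q. if q = i then axis j 1 $ p else f w $ p $ q) / det (f w))) \<in> borel_measurable M"
    by (intro borel_measurable_vec_lambda) measurable
  ultimately show ?thesis by simp
qed

text \<open>A spectral form is symmetric, so for other arguments the description has no witness and
  \<open>psd_part\<close> takes one unspecified value.\<close>

lemma psd_part_not_symmetric:
  assumes "transpose A \<noteq> A"
  shows "psd_part A = (THE B. False)"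
proof -
  have "(\<lambda>B. \<exists>H l. orthogonal_matrix H \<and> A = H ** diag_mat l ** transpose H \<and>
      B = H ** diag_mat (\<chi> i. max 0 (l $ i)) ** transpose H) = (\<lambda>B. False)"
    using assms spectral_transpose by blast
  then show ?thesis unfolding psd_part_def by simp
qed

text \<open>On the closed set of symmetric matrices the map is 1-Lipschitz, hence continuous, and
  off this set it is constant.\<close>

lemma borel_measurable_psd_part [measurable]:
  fixes f :: "'z \<Rightarrow> real^'n^'n"
  assumes [measurable]: "f \<in> borel_measurable M"
  shows "(\<lambda>w. psd_part (f w)) \<in> borel_measurable M"
proof -
  let ?S = "{A :: real^'n^'n. transpose A = A}"
  have "closed ?S"
    by (intro closed_Collect_eq linear_continuous_on bounded_linear_transpose continuous_intros)
  then have S [measurable]: "?S \<in> sets borel" by simp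
  have "1-lipschitz_on ?S psd_part"
    by (rule lipschitz_onI) (auto simp: dist_norm psd_part_nonexpansive)
  then have "continuous_on ?S psd_part" by (rule lipschitz_on_continuous_on)
  then have "psd_part \<in> borel_measurable (restrict_space borel ?S)"
    by (rule borel_measurable_continuous_on_restrict)
  then have m: "(\<lambda>A. if A \<in> ?S then psd_part A else (THE B. False)) \<in> borel_measurable borel"
    by (subst (asm) measurable_restrict_space_iff[where c="THE B. False"]) auto
  have "psd_part (f w) = (\<lambda>A. if A \<in> ?S then psd_part A else (THE B. False)) (f w)" for w
    using psd_part_not_symmetric[of "f w"] by simp
  with measurable_compose[OF assms m] show ?thesis by simp
qed

section \<open>Centred normal vectors\<close>

text \<open>Centred normal laws enter only through their moment generating function.\<close>

definition centred_normal :: "'a measure \<Rightarrow> ('a \<Rightarrow> real^'k) \<Rightarrow> real^'k^'k \<Rightarrow> bool" where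
  "centred_normal M U S \<longleftrightarrow> U \<in> borel_measurable M \<and> transpose S = S \<and>
     (\<forall>t. integrable M (\<lambda>w. exp (t \<bullet> U w)) \<and> (LINT w|M. exp (t \<bullet> U w)) = exp (t \<bullet> (S *v t) / 2))"

lemma centred_normal_measurable: "centred_normal M U S \<Longrightarrow> U \<in> borel_measurable M"
  by (simp add: centred_normal_def)

lemma centred_normal_linear:
  fixes A :: "real^'n^'m"
  assumes "centred_normal M U S"
  shows "centred_normal M (\<lambda>w. A *v U w) (A ** S ** transpose A)"
  unfolding centred_normal_def
proof (intro conjI allI)
  have [measurable]: "U \<in> borel_measurable M" by (rule centred_normal_measurable[OF assms])
  show "(\<lambda>w. A *v U w) \<in> borel_measurable M" by measurable
  show "transpose (A ** S ** transpose A) = A ** S ** transpose A"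
    using assms by (simp add: centred_normal_def matrix_transpose_mul matrix_mul_assoc)
  fix t
  have "t \<bullet> (A *v x) = (transpose A *v t) \<bullet> x" for x by (rule inner_matrix_vector)
  moreover have "t \<bullet> ((A ** S ** transpose A) *v t) = (transpose A *v t) \<bullet> (S *v (transpose A *v t))"
    by (simp add: inner_matrix_vector matrix_vector_mul_assoc[symmetric])
  ultimately show "integrable M (\<lambda>w. exp (t \<bullet> (A *v U w)))"
    "(LINT w|M. exp (t \<bullet> (A *v U w))) = exp (t \<bullet> ((A ** S ** transpose A) *v t) / 2)"
    using assms by (simp_all add: centred_normal_def)
qed

lemma (in prob_space) centred_normal_sum:
  fixes U :: "'i \<Rightarrow> 'a \<Rightarrow> real^'k"
  assumes ind: "indep_vars (\<lambda>_. borel) U J" and fin: "finite J"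
    and U: "\<And>j. j \<in> J \<Longrightarrow> centred_normal M (U j) (S j)"
  shows "centred_normal M (\<lambda>w. \<Sum>j\<in>J. U j w) (\<Sum>j\<in>J. S j)"
  unfolding centred_normal_def
proof (intro conjI allI)
  show "(\<lambda>w. \<Sum>j\<in>J. U j w) \<in> borel_measurable M"
    using U centred_normal_measurable by (intro borel_measurable_sum) blast
  show "transpose (\<Sum>j\<in>J. S j) = (\<Sum>j\<in>J. S j)"
    using U by (auto simp: transpose_sum centred_normal_def intro!: sum.cong)
  fix t
  have ind': "indep_vars (\<lambda>_. borel) (\<lambda>j w. t \<bullet> U j w) J"
    by (rule indep_vars_compose2[OF ind]) simp
  have int: "integrable M (\<lambda>w. exp (1 * (t \<bullet> U j w)))" if "j \<in> J" for j
    using U[OF that] by (simp add: centred_normal_def)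
  show "integrable M (\<lambda>w. exp (t \<bullet> (\<Sum>j\<in>J. U j w)))"
    using indep_vars_exp_sum(1)[OF ind' fin int] by (simp add: inner_sum_right)
  have "expectation (\<lambda>w. exp (t \<bullet> (\<Sum>j\<in>J. U j w))) = (\<Prod>j\<in>J. expectation (\<lambda>w. exp (t \<bullet> U j w)))"
    using indep_vars_exp_sum(2)[OF ind' fin int] by (simp add: inner_sum_right)
  also have "\<dots> = (\<Prod>j\<in>J. exp (t \<bullet> (S j *v t) / 2))"
    using U by (intro prod.cong) (auto simp: centred_normal_def)
  also have "\<dots> = exp (t \<bullet> ((\<Sum>j\<in>J. S j) *v t) / 2)"
    by (simp add: exp_sum[OF fin, symmetric] mv.sum_left inner_sum_right sum_divide_distrib)
  finally show "expectation (\<lambda>w. exp (t \<bullet> (\<Sum>j\<in>J. U j w))) = exp (t \<bullet> ((\<Sum>j\<in>J. S j) *v t) / 2)" .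
qed

lemma (in prob_space) centred_normal_add:
  fixes U V :: "'a \<Rightarrow> real^'k"
  assumes ind: "indep_var borel U borel V" and U: "centred_normal M U S" and V: "centred_normal M V T"
  shows "centred_normal M (\<lambda>w. U w + V w) (S + T)"
proof -
  have "indep_vars (\<lambda>_. borel) (case_bool U V) UNIV"
  proof -
    have "case_bool borel borel = (\<lambda>_. borel :: (real^'k) measure)" by (rule ext) (simp split: bool.split)
    then show ?thesis using ind unfolding indep_var_def by simp
  qed
  from centred_normal_sum[OF this, of "case_bool S T"] show ?thesis
    using U V by (simp add: UNIV_bool add.commute split: bool.split)
qed

text \<open>\<open>momO\<close> counts powers of m^(-1/2), so order n requires a covariance of order
  m^(-n), which is the exponent \<open>2 * n\<close>. At the scale m^(n/2) the exponential moment of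
  a coordinate is then at most exp (C/2), for either sign.\<close>

lemma (in prob_space) centred_normal_momO:
  fixes U :: "nat \<Rightarrow> 'a \<Rightarrow> real^'k"
  assumes U: "\<forall>\<^sub>F m in sequentially. centred_normal M (U m) (S m)"
    and S: "\<forall>\<^sub>F m in sequentially. norm (S m) \<le> C * (1 / sqrt (real m)) ^ (2 * n)"
  shows "momO M n U"
proof (rule momO_vec)
  fix p :: 'k
  show "momO M n (\<lambda>m w. U m w $ p)"
  proof (rule momO_from_exp[where r=1 and K="2 * exp (C / 2)"])
    show "\<forall>\<^sub>F m in sequentially. (\<lambda>w. U m w $ p) \<in> borel_measurable M"
      using U by eventually_elim (auto dest: centred_normal_measurable)
    show "\<forall>\<^sub>F m in sequentially. integrable M (\<lambda>w. exp (1 * sqrt (real m) ^ n * \<bar>U m w $ p\<bar>)) \<and>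
       expectation (\<lambda>w. exp (1 * sqrt (real m) ^ n * \<bar>U m w $ p\<bar>)) \<le> 2 * exp (C / 2)"
      using U S eventually_ge_at_top[of 1]
    proof eventually_elim
      case (elim m)
      let ?s = "sqrt (real m) ^ n"
      have [measurable]: "U m \<in> borel_measurable M" using elim centred_normal_measurable by blast
      have ax: "(r *\<^sub>R axis p 1) \<bullet> x = r * x $ p" for r and x :: "real^'k"
        by (simp add: inner_axis' )
      have bnd: "integrable M (\<lambda>w. exp (r * U m w $ p)) \<and> expectation (\<lambda>w. exp (r * U m w $ p)) \<le> exp (C / 2)"
        if r: "\<bar>r\<bar> = ?s" for r
      proof -
        have r2: "r\<^sup>2 = sqrt (real m) ^ (2 * n)" using r by (metis power2_abs power_mult mult.commute)
        have "norm (r *\<^sub>R axis p 1 :: real^'k) = \<bar>r\<bar>" by simp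
        then have "(r *\<^sub>R axis p 1) \<bullet> (S m *v (r *\<^sub>R axis p 1)) \<le> norm (S m) * r\<^sup>2"
          using inner_matrix_le_norm[of "r *\<^sub>R axis p 1" "S m"] by (simp only: dot_square_norm power2_abs)
        also have "\<dots> \<le> C * (1 / sqrt (real m)) ^ (2 * n) * r\<^sup>2" using elim by (intro mult_right_mono) auto
        also have "\<dots> = C" using elim by (simp add: r2 power_divide)
        finally show ?thesis using elim(1) unfolding centred_normal_def
          by (auto simp: ax[symmetric] simp del: inner_scaleR_left)
      qed
      have "integrable M (\<lambda>w. exp (?s * \<bar>U m w $ p\<bar>)) \<and>
         expectation (\<lambda>w. exp (?s * \<bar>U m w $ p\<bar>)) \<le> 2 * exp (C / 2)"
        using integrable_exp_abs[of "\<lambda>w. U m w $ p" M ?s] bnd[of ?s] bnd[of "- ?s"] by auto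
      then show ?case by simp
    qed
  qed simp
qed

lemma (in prob_space) centred_normal_momO_0:
  "centred_normal M U S \<Longrightarrow> momO M 0 (\<lambda>m. U)"
  by (rule centred_normal_momO[where C="norm S" and S="\<lambda>_. S"]) auto

lemma momO_integrable:
  fixes f :: "'a \<Rightarrow> 'b::{banach, second_countable_topology}"
  assumes "momO M n (\<lambda>m. f)"
  shows "integrable M f"
proof -
  obtain C where "\<forall>\<^sub>F m in sequentially. integrable M f \<and> norm (LINT w|M. f w) \<le> C * (1 / sqrt (real m)) ^ n"
    by (rule momO_expectation[OF assms])
  then have "\<forall>\<^sub>F m::nat in sequentially. integrable M f" by eventually_elim simp
  then show ?thesis by simp
qed

text \<open>Polarization: the mixed moments are combinations of second and fourth moments of scalar
  projections. The last formula is the rule of Isserlis (Wick) with its three pairings.\<close>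

lemma (in prob_space) centred_normal_moments:
  assumes U: "centred_normal M U S"
  shows "expectation (\<lambda>w. a \<bullet> U w) = 0"
    "expectation (\<lambda>w. (a \<bullet> U w) * (b \<bullet> U w)) = a \<bullet> (S *v b)"
    "expectation (\<lambda>w. (a \<bullet> U w) * (b \<bullet> U w) * ((c \<bullet> U w) * (d \<bullet> U w))) =
       (a \<bullet> (S *v b)) * (c \<bullet> (S *v d)) + (a \<bullet> (S *v c)) * (b \<bullet> (S *v d)) + (a \<bullet> (S *v d)) * (b \<bullet> (S *v c))"
proof -
  have [measurable]: "U \<in> borel_measurable M" by (rule centred_normal_measurable[OF U])
  define B where "B x y = x \<bullet> (S *v y)" for x y
  have sym: "B x y = B y x" for x y
    unfolding B_def using U by (subst inner_matrix_vector) (simp add: centred_normal_def inner_commute)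
  have Badd: "B (x + y) z = B x z + B y z" "B x (y + z) = B x y + B x z"
    "B (x - y) z = B x z - B y z" "B x (y - z) = B x y - B x z" for x y z
    by (simp_all add: B_def inner_add_left inner_diff_left inner_add_right inner_diff_right
        mv.add_right mv.diff_right)
  have Z: "expectation (\<lambda>w. t \<bullet> U w) = 0" "expectation (\<lambda>w. (t \<bullet> U w)\<^sup>2) = B t t"
     "expectation (\<lambda>w. (t \<bullet> U w) ^ 4) = 3 * (B t t)\<^sup>2" for t
  proof -
    have i: "integrable M (\<lambda>w. exp (s * (t \<bullet> U w)))" for s
      using U[unfolded centred_normal_def, THEN conjunct2, THEN conjunct2, rule_format, of "s *\<^sub>R t"] by simp
    have e: "expectation (\<lambda>w. exp (s * (t \<bullet> U w))) = exp (s\<^sup>2 * B t t / 2)" for s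
      using U[unfolded centred_normal_def, THEN conjunct2, THEN conjunct2, rule_format, of "s *\<^sub>R t"]
      by (simp add: mv.scaleR_right B_def power2_eq_square mult_ac)
    show "expectation (\<lambda>w. t \<bullet> U w) = 0" "expectation (\<lambda>w. (t \<bullet> U w)\<^sup>2) = B t t"
     "expectation (\<lambda>w. (t \<bullet> U w) ^ 4) = 3 * (B t t)\<^sup>2"
      by (rule normal_mgf_moments[OF _ i e]; measurable)+
  qed
  show "expectation (\<lambda>w. a \<bullet> U w) = 0" by (rule Z)
  have m1: "momO M 0 (\<lambda>m w. t \<bullet> U w)" for t
    by (rule momO_linear[OF centred_normal_momO_0[OF U] bounded_linear_inner_right])
  have m2: "momO M 0 (\<lambda>m w. (t \<bullet> U w) * (s \<bullet> U w))" for t s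
    using momO_mult[OF m1 m1] by simp
  have m4: "momO M 0 (\<lambda>m w. (t \<bullet> U w) * (s \<bullet> U w) * ((x \<bullet> U w) * (y \<bullet> U w)))" for t s x y
    using momO_mult[OF m2 m2] by simp
  note i2 = momO_integrable[OF m2] and i4 = momO_integrable[OF m4]
  have i2': "integrable M (\<lambda>w. (t \<bullet> U w)\<^sup>2)" for t using i2[of t t] by (simp add: power2_eq_square)
  have i4': "integrable M (\<lambda>w. (t \<bullet> U w) ^ 4)" for t using i4[of t t t t] by (simp add: eval_nat_numeral mult_ac)
  have i22: "integrable M (\<lambda>w. (t \<bullet> U w)\<^sup>2 * (s \<bullet> U w)\<^sup>2)" for t s
    using i4[of t t s s] by (simp add: power2_eq_square)
  have "expectation (\<lambda>w. (a \<bullet> U w) * (b \<bullet> U w))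
      = expectation (\<lambda>w. (((a + b) \<bullet> U w)\<^sup>2 - ((a - b) \<bullet> U w)\<^sup>2) / 4)"
    by (simp add: inner_add_left inner_diff_left power2_eq_square algebra_simps)
  also have "\<dots> = (B (a + b) (a + b) - B (a - b) (a - b)) / 4" using i2' by (simp add: Z)
  also have "\<dots> = B a b" by (simp add: Badd sym[of b a])
  finally show "expectation (\<lambda>w. (a \<bullet> U w) * (b \<bullet> U w)) = a \<bullet> (S *v b)" by (simp add: B_def)
  have E22: "expectation (\<lambda>w. (x \<bullet> U w)\<^sup>2 * (y \<bullet> U w)\<^sup>2) = B x x * B y y + 2 * (B x y)\<^sup>2" for x y
  proof -
    \<comment> \<open>From (x + y)^4 + (x - y)^4 = 2x^4 + 12x^2y^2 + 2y^4.\<close>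
    have "(x \<bullet> U w)\<^sup>2 * (y \<bullet> U w)\<^sup>2
       = (((x + y) \<bullet> U w) ^ 4 + ((x - y) \<bullet> U w) ^ 4 - 2 * (x \<bullet> U w) ^ 4 - 2 * (y \<bullet> U w) ^ 4) / 12" for w
      by (simp add: inner_add_left inner_diff_left) algebra
    then have "expectation (\<lambda>w. (x \<bullet> U w)\<^sup>2 * (y \<bullet> U w)\<^sup>2) = expectation (\<lambda>w. (((x + y) \<bullet> U w) ^ 4
        + ((x - y) \<bullet> U w) ^ 4 - 2 * (x \<bullet> U w) ^ 4 - 2 * (y \<bullet> U w) ^ 4) / 12)"
      by presburger
    also have "\<dots> = (3 * (B (x + y) (x + y))\<^sup>2 + 3 * (B (x - y) (x - y))\<^sup>2 - 2 * (3 * (B x x)\<^sup>2) - 2 * (3 * (B y y)\<^sup>2)) / 12"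
      using i4' by (simp add: Z)
    also have "\<dots> = B x x * B y y + 2 * (B x y)\<^sup>2"
      by (simp add: Badd sym[of y x]) algebra
    finally show ?thesis .
  qed
  \<comment> \<open>The identity 4ab = (a + b)^2 - (a - b)^2, used for both pairs of
    factors.\<close>
  have "(a \<bullet> U w) * (b \<bullet> U w) * ((c \<bullet> U w) * (d \<bullet> U w)) =
     (((a + b) \<bullet> U w)\<^sup>2 * ((c + d) \<bullet> U w)\<^sup>2 - ((a + b) \<bullet> U w)\<^sup>2 * ((c - d) \<bullet> U w)\<^sup>2
     - ((a - b) \<bullet> U w)\<^sup>2 * ((c + d) \<bullet> U w)\<^sup>2 + ((a - b) \<bullet> U w)\<^sup>2 * ((c - d) \<bullet> U w)\<^sup>2) / 16" for w
    by (simp add: inner_add_left inner_diff_left) algebra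
  then have "expectation (\<lambda>w. (a \<bullet> U w) * (b \<bullet> U w) * ((c \<bullet> U w) * (d \<bullet> U w))) = expectation (\<lambda>w.
     (((a + b) \<bullet> U w)\<^sup>2 * ((c + d) \<bullet> U w)\<^sup>2 - ((a + b) \<bullet> U w)\<^sup>2 * ((c - d) \<bullet> U w)\<^sup>2
     - ((a - b) \<bullet> U w)\<^sup>2 * ((c + d) \<bullet> U w)\<^sup>2 + ((a - b) \<bullet> U w)\<^sup>2 * ((c - d) \<bullet> U w)\<^sup>2) / 16)"
    by presburger
  also have "\<dots> = (B (a + b) (a + b) * B (c + d) (c + d) + 2 * (B (a + b) (c + d))\<^sup>2
     - (B (a + b) (a + b) * B (c - d) (c - d) + 2 * (B (a + b) (c - d))\<^sup>2)
     - (B (a - b) (a - b) * B (c + d) (c + d) + 2 * (B (a - b) (c + d))\<^sup>2)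
     + (B (a - b) (a - b) * B (c - d) (c - d) + 2 * (B (a - b) (c - d))\<^sup>2)) / 16"
    using i22 by (simp add: E22)
  also have "\<dots> = B a b * B c d + B a c * B b d + B a d * B b c"
    by (simp add: Badd sym[of b a] sym[of d c]) algebra
  finally show "expectation (\<lambda>w. (a \<bullet> U w) * (b \<bullet> U w) * ((c \<bullet> U w) * (d \<bullet> U w))) =
       (a \<bullet> (S *v b)) * (c \<bullet> (S *v d)) + (a \<bullet> (S *v c)) * (b \<bullet> (S *v d)) + (a \<bullet> (S *v d)) * (b \<bullet> (S *v c))"
    by (simp add: B_def)
qed

text \<open>The order of the indices is that of a product of the entries (p, r) and (q, l) of the
  outer square of U.\<close>

lemma (in prob_space) centred_normal_nth:
  assumes U: "centred_normal M U S"
  shows "expectation (\<lambda>w. U w $ p) = 0"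
    "expectation (\<lambda>w. U w $ p * U w $ q) = S $ p $ q"
    "expectation (\<lambda>w. U w $ p * U w $ r * (U w $ q * U w $ l)) =
       S $ p $ r * S $ q $ l + S $ p $ q * S $ r $ l + S $ p $ l * S $ r $ q"
  using centred_normal_moments[OF U, of "axis p 1"]
    centred_normal_moments(2)[OF U, of "axis p 1" "axis q 1"]
    centred_normal_moments(3)[OF U, of "axis p 1" "axis r 1" "axis q 1" "axis l 1"]
  by (simp_all add: inner_axis' matrix_vector_mult_basis column_def)

lemma integral_matrix_nth:
  fixes f :: "'z \<Rightarrow> real^'n^'m"
  assumes "integrable N f"
  shows "(LINT w|N. f w) $ p $ q = (LINT w|N. f w $ p $ q)"
  using integral_bounded_linear[OF bounded_linear_compose[OF bounded_linear_vec_nth[of q] bounded_linear_vec_nth[of p]] assms]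
  by simp

lemma (in prob_space) centred_normal_outer:
  assumes U: "centred_normal M U S"
  shows "integrable M (\<lambda>w. outer (U w) (U w))" "expectation (\<lambda>w. outer (U w) (U w)) = S"
proof -
  have m: "momO M 0 (\<lambda>m w. outer (U w) (U w))"
  proof (intro momO_vec)
    fix p q
    show "momO M 0 (\<lambda>m w. outer (U w) (U w) $ p $ q)"
      using momO_mult[OF momO_nth[OF centred_normal_momO_0[OF U]] momO_nth[OF centred_normal_momO_0[OF U]], of p q]
      by simp
  qed
  then show int: "integrable M (\<lambda>w. outer (U w) (U w))" by (rule momO_integrable)
  have "expectation (\<lambda>w. outer (U w) (U w)) $ p $ q = expectation (\<lambda>w. outer (U w) (U w) $ p $ q)" for p q
    using integral_bounded_linear[OF bounded_linear_compose[OF bounded_linear_vec_nth[of q] bounded_linear_vec_nth[of p]] int]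
    by simp
  then show "expectation (\<lambda>w. outer (U w) (U w)) = S"
    by (simp add: vec_eq_iff centred_normal_nth[OF U])
qed

section \<open>The normal density\<close>

lemma nn_integral_lborel_affine:
  fixes t :: "'b::euclidean_space" and f :: "'b \<Rightarrow> ennreal"
  assumes [measurable]: "f \<in> borel_measurable borel" and c: "c \<noteq> 0"
  shows "(\<integral>\<^sup>+x. f x \<partial>lborel) = ennreal (\<bar>c\<bar> ^ DIM('b)) * (\<integral>\<^sup>+x. f (t + c *\<^sub>R x) \<partial>lborel)"
  by (subst lborel_affine[OF c, of t])
     (simp add: nn_integral_density nn_integral_distr nn_integral_cmult)

lemma borel_measurable_mvn_density [measurable]: "mvn_density mu S \<in> borel_measurable borel"
  unfolding mvn_density_def[abs_def] by measurable

lemma (in prob_space) distributed_total_mass: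
  assumes "distributed M N V f"
  shows "(\<integral>\<^sup>+x. f x \<partial>N) = 1"
  using distributed_nn_integral[OF assms, of "\<lambda>_. 1"] by (simp add: emeasure_space_1)

text \<open>A nonpositive value would make the density nowhere positive (division by zero gives 0),
  against total mass one. The sign of the determinant thus follows from the existence of V.\<close>

lemma (in prob_space) mvn_normalizer_pos:
  fixes V :: "'a \<Rightarrow> real^'k"
  assumes "distributed M lborel V (\<lambda>x. ennreal (mvn_density 0 S x))"
  shows "sqrt ((2 * pi) ^ CARD('k) * det S) > 0"
proof (rule ccontr)
  assume "\<not> sqrt ((2 * pi) ^ CARD('k) * det S) > 0"
  then have "mvn_density 0 S x \<le> 0" for x
    unfolding mvn_density_def by (intro divide_nonneg_nonpos) auto
  then have "(\<integral>\<^sup>+x. ennreal (mvn_density 0 S x) \<partial>lborel) = 0" by (simp add: ennreal_neg)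
  then show False using distributed_total_mass[OF assms] by simp
qed

text \<open>Completing the square: an exponential tilt of the normal density is a translation by St,
  up to a factor.\<close>

lemma mvn_density_tilt:
  assumes S: "transpose S = S" "invertible S"
  shows "mvn_density 0 S x * exp (t \<bullet> x) = exp (t \<bullet> (S *v t) / 2) * mvn_density 0 S (x - S *v t)"
proof -
  let ?P = "matrix_inv S"
  have sP: "transpose ?P = ?P" by (rule transpose_matrix_inv[OF S(2,1)])
  have PS: "?P *v (S *v t) = t" by (rule matrix_inv_vector[OF S(2)])
  have "(S *v t) \<bullet> (?P *v x) = t \<bullet> x"
    by (subst inner_matrix_vector) (simp add: sP PS)
  then have "(x - S *v t) \<bullet> (?P *v (x - S *v t)) = x \<bullet> (?P *v x) - 2 * (t \<bullet> x) + t \<bullet> (S *v t)"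
    by (simp add: inner_diff_left inner_diff_right mv.diff_right PS inner_commute)
  then show ?thesis unfolding mvn_density_def
    by (simp add: exp_add[symmetric] algebra_simps) (simp add: field_simps)
qed

text \<open>After the tilt, translation invariance of Lebesgue measure leaves the total mass of the
  density, which is one because it belongs to the law of V. The normalizing constant is never
  evaluated.\<close>

lemma (in prob_space) mvn_density_centred_normal:
  fixes V :: "'a \<Rightarrow> real^'k"
  assumes S: "pos_def S" and V: "distributed M lborel V (\<lambda>x. ennreal (mvn_density 0 S x))"
  shows "centred_normal M V S"
  unfolding centred_normal_def
proof (intro conjI allI)
  have sym: "transpose S = S" "invertible S" using S by (auto simp: pos_def_def pos_def_invertible)
  show [measurable]: "V \<in> borel_measurable M" using distributed_measurable[OF V] by simp
  show "transpose S = S" by (rule sym)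
  fix t
  let ?c = "exp (t \<bullet> (S *v t) / 2)"
  have "(\<integral>\<^sup>+w. ennreal (exp (t \<bullet> V w)) \<partial>M) = (\<integral>\<^sup>+x. ennreal (mvn_density 0 S x) * ennreal (exp (t \<bullet> x)) \<partial>lborel)"
    by (subst distributed_nn_integral[OF V]) auto
  also have "\<dots> = (\<integral>\<^sup>+x. ennreal ?c * ennreal (mvn_density 0 S (x - S *v t)) \<partial>lborel)"
    using mvn_density_tilt[OF sym, of _ t]
    by (intro nn_integral_cong) (simp add: ennreal_mult'[symmetric] ennreal_mult''[symmetric])
  also have "\<dots> = ennreal ?c * (\<integral>\<^sup>+x. ennreal (mvn_density 0 S (x - S *v t)) \<partial>lborel)"
    by (rule nn_integral_cmult) measurable
  also have "(\<integral>\<^sup>+x. ennreal (mvn_density 0 S (x - S *v t)) \<partial>lborel) = (\<integral>\<^sup>+x. ennreal (mvn_density 0 S x) \<partial>lborel)"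
    using nn_integral_lborel_affine[of "\<lambda>x. ennreal (mvn_density 0 S x)" 1 "- (S *v t)"] by simp
  also have "\<dots> = 1" by (rule distributed_total_mass[OF V])
  finally have eq: "(\<integral>\<^sup>+w. ennreal (exp (t \<bullet> V w)) \<partial>M) = ennreal ?c" by simp
  show "integrable M (\<lambda>w. exp (t \<bullet> V w))"
    by (rule integrableI_nn_integral_finite[OF _ _ eq]) auto
  show "expectation (\<lambda>w. exp (t \<bullet> V w)) = ?c"
    by (subst integral_eq_nn_integral) (auto simp: eq)
qed

text \<open>Since |x|^2 / s is at most the form of the inverse covariance at x, the factor exp
  (|x|^2 / (4s)) uses up at most half of the exponent. What remains is the density at x / sqrt 2,
  and rescaling contributes \<open>sqrt 2 ^ CARD('k)\<close>. The bound involves S only through s,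
  so it can be made uniform over the areas.\<close>

lemma (in prob_space) mvn_density_exp_square:
  fixes V :: "'a \<Rightarrow> real^'k"
  assumes S: "pos_def S" and V: "distributed M lborel V (\<lambda>x. ennreal (mvn_density 0 S x))"
    and s: "s > 0" "\<And>x. x \<bullet> (S *v x) \<le> s * (x \<bullet> x)"
  shows "integrable M (\<lambda>w. exp ((norm (V w))\<^sup>2 / (4 * s)))"
    "expectation (\<lambda>w. exp ((norm (V w))\<^sup>2 / (4 * s))) \<le> sqrt 2 ^ CARD('k)"
proof -
  have [measurable]: "V \<in> borel_measurable M" using distributed_measurable[OF V] by simp
  let ?P = "matrix_inv S" and ?Z = "sqrt ((2 * pi) ^ CARD('k) * det S)"
  have Z: "?Z > 0" by (rule mvn_normalizer_pos[OF V])
  let ?r = "1 / sqrt 2"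
  have le: "mvn_density 0 S x * exp ((norm x)\<^sup>2 / (4 * s)) \<le> mvn_density 0 S (?r *\<^sub>R x)" for x
  proof -
    have "x \<bullet> x \<le> s * (x \<bullet> (?P *v x))"
      by (rule psd_matrix_inv_ge) (use S s in \<open>auto simp: pos_def_imp_psd pos_def_invertible\<close>)
    then have 1: "(norm x)\<^sup>2 / (4 * s) \<le> x \<bullet> (?P *v x) / 4"
      using s by (simp add: dot_square_norm field_simps)
    have 2: "(?r *\<^sub>R x) \<bullet> (?P *v (?r *\<^sub>R x)) = x \<bullet> (?P *v x) / 2"
      by (simp add: mv.scaleR_right field_simps)
    have "mvn_density 0 S x * exp ((norm x)\<^sup>2 / (4 * s)) = exp (- (x \<bullet> (?P *v x)) / 2 + (norm x)\<^sup>2 / (4 * s)) / ?Z"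
      unfolding mvn_density_def by (simp only: exp_add diff_zero times_divide_eq_left)
    also have "\<dots> \<le> exp (- ((?r *\<^sub>R x) \<bullet> (?P *v (?r *\<^sub>R x))) / 2) / ?Z"
      unfolding 2 using 1 Z by (intro divide_right_mono) auto
    finally show ?thesis by (simp add: mvn_density_def)
  qed
  have "(\<integral>\<^sup>+w. ennreal (exp ((norm (V w))\<^sup>2 / (4 * s))) \<partial>M)
     = (\<integral>\<^sup>+x. ennreal (mvn_density 0 S x) * ennreal (exp ((norm x)\<^sup>2 / (4 * s))) \<partial>lborel)"
    by (subst distributed_nn_integral[OF V]) auto
  also have "\<dots> \<le> (\<integral>\<^sup>+x. ennreal (mvn_density 0 S (?r *\<^sub>R x)) \<partial>lborel)"
    using le by (intro nn_integral_mono) (simp add: ennreal_mult''[symmetric] ennreal_leI)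
  also have "\<dots> = ennreal (sqrt 2 ^ CARD('k)) * (ennreal (\<bar>?r\<bar> ^ DIM(real^'k)) * (\<integral>\<^sup>+x. ennreal (mvn_density 0 S (0 + ?r *\<^sub>R x)) \<partial>lborel))"
    by (simp add: mult.assoc[symmetric] ennreal_mult'[symmetric] power_mult_distrib[symmetric])
  also have "\<dots> = ennreal (sqrt 2 ^ CARD('k)) * (\<integral>\<^sup>+x. ennreal (mvn_density 0 S x) \<partial>lborel)"
    by (subst nn_integral_lborel_affine[symmetric]) auto
  also have "\<dots> = ennreal (sqrt 2 ^ CARD('k))" by (simp add: distributed_total_mass[OF V])
  finally have nn: "(\<integral>\<^sup>+w. ennreal (exp ((norm (V w))\<^sup>2 / (4 * s))) \<partial>M) \<le> ennreal (sqrt 2 ^ CARD('k))" .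
  show "integrable M (\<lambda>w. exp ((norm (V w))\<^sup>2 / (4 * s)))"
    by (rule integrableI_bounded) (auto intro: le_less_trans[OF nn])
  show "expectation (\<lambda>w. exp ((norm (V w))\<^sup>2 / (4 * s))) \<le> sqrt 2 ^ CARD('k)"
    by (subst integral_eq_nn_integral) (auto intro!: enn2real_leI nn)
qed

text \<open>For a fixed sum \<open>u = v + e\<close>, the joint density of \<open>(v, e)\<close> is symmetric in \<open>e\<close> about the
  conditional mean \<open>K u\<close> of \<open>e\<close>.\<close>

definition reflect_error :: "real^'k^'k \<Rightarrow> (real^'k) \<times> (real^'k) \<Rightarrow> (real^'k) \<times> (real^'k)" where
  "reflect_error K p = (fst p + snd p - (2 *\<^sub>R (K *v (fst p + snd p)) - snd p),
     2 *\<^sub>R (K *v (fst p + snd p)) - snd p)"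

lemma borel_measurable_reflect_error [measurable]:
  "reflect_error K \<in> (borel \<Otimes>\<^sub>M borel) \<rightarrow>\<^sub>M (borel \<Otimes>\<^sub>M borel)"
  unfolding reflect_error_def[abs_def] by measurable

text \<open>In the coordinates u = v + e and e the map fixes u and sends e to 2Ku - e. Shears and
  reflections preserve Lebesgue measure, so translations and Fubini's theorem suffice and no
  Jacobian determinant appears.\<close>

lemma distr_reflect_error_lborel:
  "distr (lborel \<Otimes>\<^sub>M lborel) (lborel \<Otimes>\<^sub>M lborel) (reflect_error (K :: real^'k^'k)) = lborel \<Otimes>\<^sub>M lborel"
proof (rule measure_eqI)
  have [measurable]: "reflect_error K \<in> (lborel \<Otimes>\<^sub>M lborel) \<rightarrow>\<^sub>M (lborel \<Otimes>\<^sub>M lborel)"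
    using borel_measurable_reflect_error[of K]
    by (simp add: measurable_def space_pair_measure sets_pair_measure_cong[of lborel borel lborel borel])
  fix A assume "A \<in> sets (distr (lborel \<Otimes>\<^sub>M lborel) (lborel \<Otimes>\<^sub>M lborel) (reflect_error K))"
  then have A [measurable]: "A \<in> sets (borel \<Otimes>\<^sub>M borel)"
    by (simp add: sets_pair_measure_cong[of lborel borel lborel borel])
  define h :: "(real^'k) \<times> (real^'k) \<Rightarrow> ennreal" where "h = indicator A"
  have [measurable]: "h \<in> borel_measurable (borel \<Otimes>\<^sub>M borel)" unfolding h_def by measurable
  have h' [measurable]: "h \<in> borel_measurable (lborel \<Otimes>\<^sub>M lborel)"
    by (simp add: measurable_cong_sets[OF sets_pair_measure_cong[of lborel borel lborel borel] refl])
  have shift: "(\<integral>\<^sup>+v. f (v + e) \<partial>lborel) = (\<integral>\<^sup>+v. f v \<partial>lborel)"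
    if [measurable]: "f \<in> borel_measurable borel" for f :: "real^'k \<Rightarrow> ennreal" and e
    using nn_integral_lborel_affine[of f 1 e] by (simp add: add.commute)
  have flip: "(\<integral>\<^sup>+e. f (c - e) \<partial>lborel) = (\<integral>\<^sup>+e. f e \<partial>lborel)"
    if [measurable]: "f \<in> borel_measurable borel" for f :: "real^'k \<Rightarrow> ennreal" and c
    using nn_integral_lborel_affine[of f "-1" c] by simp
  have swap: "(\<integral>\<^sup>+e. \<integral>\<^sup>+v. f (v, e) \<partial>lborel \<partial>lborel) = (\<integral>\<^sup>+v. \<integral>\<^sup>+e. f (v, e) \<partial>lborel \<partial>lborel)"
    if [measurable]: "f \<in> borel_measurable (borel \<Otimes>\<^sub>M borel)" for f :: "(real^'k) \<times> (real^'k) \<Rightarrow> ennreal"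
  proof -
    have "f \<in> borel_measurable (lborel \<Otimes>\<^sub>M lborel)"
      by (simp add: measurable_cong_sets[OF sets_pair_measure_cong[of lborel borel lborel borel] refl])
    then show ?thesis
      using lborel_pair.Fubini'[of "\<lambda>v e. f (v, e)"] by simp
  qed
  have "(\<integral>\<^sup>+p. h (reflect_error K p) \<partial>(lborel \<Otimes>\<^sub>M lborel)) = (\<integral>\<^sup>+v. \<integral>\<^sup>+e. h (reflect_error K (v, e)) \<partial>lborel \<partial>lborel)"
    by (subst lborel.nn_integral_fst[symmetric]) auto
  also have "\<dots> = (\<integral>\<^sup>+e. \<integral>\<^sup>+v. h (reflect_error K (v, e)) \<partial>lborel \<partial>lborel)"
    by (rule swap[symmetric]) measurable
  also have "\<dots> = (\<integral>\<^sup>+e. \<integral>\<^sup>+u. h (u - (2 *\<^sub>R (K *v u) - e), 2 *\<^sub>R (K *v u) - e) \<partial>lborel \<partial>lborel)"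
    unfolding reflect_error_def fst_conv snd_conv
    by (intro nn_integral_cong shift) measurable
  also have "\<dots> = (\<integral>\<^sup>+u. \<integral>\<^sup>+e. h (u - (2 *\<^sub>R (K *v u) - e), 2 *\<^sub>R (K *v u) - e) \<partial>lborel \<partial>lborel)"
    using swap[of "\<lambda>(u, e). h (u - (2 *\<^sub>R (K *v u) - e), 2 *\<^sub>R (K *v u) - e)"] by simp
  also have "\<dots> = (\<integral>\<^sup>+u. \<integral>\<^sup>+e. h (u - e, e) \<partial>lborel \<partial>lborel)"
    by (intro nn_integral_cong flip[of "\<lambda>e. h (u - e, e)" for u]) measurable
  also have "\<dots> = (\<integral>\<^sup>+e. \<integral>\<^sup>+u. h (u - e, e) \<partial>lborel \<partial>lborel)"
    using swap[of "\<lambda>(u, e). h (u - e, e)"] by simp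
  also have "\<dots> = (\<integral>\<^sup>+e. \<integral>\<^sup>+v. h (v, e) \<partial>lborel \<partial>lborel)"
  proof (rule nn_integral_cong)
    fix e :: "real^'k"
    show "(\<integral>\<^sup>+u. h (u - e, e) \<partial>lborel) = (\<integral>\<^sup>+v. h (v, e) \<partial>lborel)"
      using shift[of "\<lambda>v. h (v, e)" "- e"] by simp
  qed
  also have "\<dots> = (\<integral>\<^sup>+v. \<integral>\<^sup>+e. h (v, e) \<partial>lborel \<partial>lborel)" using swap[of h] by simp
  also have "\<dots> = (\<integral>\<^sup>+p. h p \<partial>(lborel \<Otimes>\<^sub>M lborel))"
    by (rule lborel.nn_integral_fst[OF h'])
  finally have eq: "(\<integral>\<^sup>+p. h (reflect_error K p) \<partial>(lborel \<Otimes>\<^sub>M lborel)) = (\<integral>\<^sup>+p. h p \<partial>(lborel \<Otimes>\<^sub>M lborel))" .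
  have A': "A \<in> sets (lborel \<Otimes>\<^sub>M lborel)" using A by (simp add: sets_pair_measure_cong[of lborel borel lborel borel])
  have "emeasure (distr (lborel \<Otimes>\<^sub>M lborel) (lborel \<Otimes>\<^sub>M lborel) (reflect_error K)) A
     = (\<integral>\<^sup>+p. h p \<partial>distr (lborel \<Otimes>\<^sub>M lborel) (lborel \<Otimes>\<^sub>M lborel) (reflect_error K))"
    unfolding h_def using A' by simp
  also have "\<dots> = (\<integral>\<^sup>+p. h (reflect_error K p) \<partial>(lborel \<Otimes>\<^sub>M lborel))"
    by (rule nn_integral_distr) auto
  also have "\<dots> = emeasure (lborel \<Otimes>\<^sub>M lborel) A"
    unfolding eq using A' by (simp add: h_def)
  finally show "emeasure (distr (lborel \<Otimes>\<^sub>M lborel) (lborel \<Otimes>\<^sub>M lborel) (reflect_error K)) A = emeasure (lborel \<Otimes>\<^sub>M lborel) A" .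
qed simp

text \<open>For fixed u the exponent is quadratic in e, and its derivative vanishes at c = Ku; such
  a function is even about c.\<close>

lemma mvn_density_reflect_error:
  fixes P D :: "real^'k^'k"
  assumes P: "pos_def P" and D: "pos_def D" and PD: "invertible (P + D)"
  defines "K \<equiv> D ** matrix_inv (P + D)"
  shows "mvn_density 0 P (fst (reflect_error K p)) * mvn_density 0 D (snd (reflect_error K p)) =
     mvn_density 0 P (fst p) * mvn_density 0 D (snd p)"
proof -
  obtain v e where p: "p = (v, e)" by fastforce
  define u where "u = v + e"
  let ?P = "matrix_inv P" and ?D = "matrix_inv D"
  have inv: "invertible P" "invertible D" using P D pos_def_invertible by auto
  have sy: "transpose P = P" "transpose D = D" using P D by (auto simp: pos_def_def)
  have sym: "transpose ?P = ?P" "transpose ?D = ?D" by (simp_all add: transpose_matrix_inv inv sy)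
  define c where "c = K *v u"
  have Dc: "?D *v c = matrix_inv (P + D) *v u"
    by (simp add: c_def K_def matrix_vector_mul_assoc[symmetric] matrix_inv_vector inv)
  have uc: "u = (P + D) *v (matrix_inv (P + D) *v u)" by (simp add: matrix_inv_vector PD)
  have "u - c = P *v (matrix_inv (P + D) *v u)"
    by (subst uc) (simp add: c_def K_def matrix_vector_mul_assoc[symmetric] mv.add_left)
  then have "?P *v (u - c) = matrix_inv (P + D) *v u" by (simp add: matrix_inv_vector inv)
  \<comment> \<open>Stationarity of the exponent at c: both sides equal (P + D)^-1 u.\<close>
  with Dc have key: "?P *v (u - c) = ?D *v c" by simp
  define q where "q x = (u - x) \<bullet> (?P *v (u - x)) + x \<bullet> (?D *v x)" for x
  have cross: "x \<bullet> (?P *v y) = y \<bullet> (?P *v x)" "x \<bullet> (?D *v y) = y \<bullet> (?D *v x)" for x y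
    by (subst inner_matrix_vector, simp add: sym inner_commute)+
  have qc: "q (c + x) = q c + x \<bullet> (?P *v x) + x \<bullet> (?D *v x)" for x
  proof -
    have "u - (c + x) = (u - c) - x" by simp
    then have "q (c + x) = q c - 2 * (x \<bullet> (?P *v (u - c))) + 2 * (x \<bullet> (?D *v c)) + x \<bullet> (?P *v x) + x \<bullet> (?D *v x)"
      unfolding q_def using cross(1)[of "u - c" x] cross(2)[of c x]
      by (simp only: inner_add_left inner_add_right inner_diff_left[of "u - c"] inner_diff_right mv.add_right mv.diff_right[of _ "u - c"])
    then show ?thesis by (simp add: key)
  qed
  have "q (2 *\<^sub>R c - e) = q e"
    using qc[of "c - e"] qc[of "e - c"]
    by (simp add: scaleR_2 mv.diff_right inner_diff_left inner_diff_right algebra_simps)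
  then have qq: "(u - (2 *\<^sub>R c - e)) \<bullet> (?P *v (u - (2 *\<^sub>R c - e))) + (2 *\<^sub>R c - e) \<bullet> (?D *v (2 *\<^sub>R c - e))
      = v \<bullet> (?P *v v) + e \<bullet> (?D *v e)"
    unfolding q_def by (simp add: u_def)
  have dens: "mvn_density 0 P x * mvn_density 0 D y = exp (- (x \<bullet> (?P *v x) + y \<bullet> (?D *v y)) / 2) /
     (sqrt ((2 * pi) ^ CARD('k) * det P) * sqrt ((2 * pi) ^ CARD('k) * det D))" for x y
    unfolding mvn_density_def by (simp add: exp_add[symmetric] add_divide_distrib)
  show ?thesis
    unfolding p reflect_error_def fst_conv snd_conv dens u_def[symmetric] c_def[symmetric] qq ..
qed

text \<open>The reflection preserves the reference measure and the joint density, hence the joint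
  law.\<close>

lemma (in prob_space) distr_reflect_error:
  fixes V E :: "'a \<Rightarrow> real^'k"
  assumes P: "pos_def P" and D: "pos_def D" and PD: "invertible (P + D)"
    and V: "distributed M lborel V (\<lambda>x. ennreal (mvn_density 0 P x))"
    and E: "distributed M lborel E (\<lambda>x. ennreal (mvn_density 0 D x))"
    and ind: "indep_var borel V borel E"
  defines "K \<equiv> D ** matrix_inv (P + D)"
  shows "distr M (borel \<Otimes>\<^sub>M borel) (\<lambda>w. reflect_error K (V w, E w)) = distr M (borel \<Otimes>\<^sub>M borel) (\<lambda>w. (V w, E w))"
proof -
  let ?L = "lborel \<Otimes>\<^sub>M lborel :: ((real^'k) \<times> (real^'k)) measure"
  have [measurable]: "V \<in> borel_measurable M" "E \<in> borel_measurable M"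
    using distributed_measurable[OF V] distributed_measurable[OF E] by auto
  have sets: "sets ?L = sets (borel \<Otimes>\<^sub>M borel)" by (rule sets_pair_measure_cong) auto
  have rm [measurable]: "reflect_error K \<in> ?L \<rightarrow>\<^sub>M ?L"
    using borel_measurable_reflect_error[of K] by (simp add: measurable_cong_sets[OF sets sets])
  define f where "f = (\<lambda>p. ennreal (mvn_density 0 P (fst p)) * ennreal (mvn_density 0 D (snd p)))"
  have [measurable]: "f \<in> borel_measurable (borel \<Otimes>\<^sub>M borel)" unfolding f_def by measurable
  then have fm [measurable]: "f \<in> borel_measurable ?L" by (simp add: measurable_cong_sets[OF sets refl])
  have ind': "indep_var lborel V lborel E"
    using ind unfolding indep_var_eq by simp
  have "distributed M ?L (\<lambda>x. (V x, E x)) (\<lambda>(x, y). ennreal (mvn_density 0 P x) * ennreal (mvn_density 0 D y))"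
    by (rule distributed_joint_indep[OF _ _ V E ind']) (simp_all add: sigma_finite_lborel)
  then have J: "distr M ?L (\<lambda>w. (V w, E w)) = density ?L f"
    unfolding distributed_def f_def by (simp add: case_prod_beta')
  have fr: "f (reflect_error K p) = f p" for p
  proof -
    have pos: "mvn_density 0 D x \<ge> 0" for x
      using mvn_normalizer_pos[OF E] unfolding mvn_density_def by (intro divide_nonneg_nonneg) auto
    show ?thesis
      using mvn_density_reflect_error[OF P D PD, of p]
      by (simp add: f_def ennreal_mult''[symmetric] pos K_def)
  qed
  have "distr M ?L (\<lambda>w. reflect_error K (V w, E w)) = distr (distr M ?L (\<lambda>w. (V w, E w))) ?L (reflect_error K)"
    by (subst distr_distr) (auto simp: comp_def measurable_cong_sets[OF refl sets])
  also have "\<dots> = distr (density ?L (\<lambda>p. f (reflect_error K p))) ?L (reflect_error K)"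
    unfolding J fr ..
  also have "\<dots> = density (distr ?L ?L (reflect_error K)) f"
    by (rule density_distr[symmetric]) measurable
  also have "\<dots> = distr M ?L (\<lambda>w. (V w, E w))" unfolding distr_reflect_error_lborel J ..
  finally have eq: "distr M ?L (\<lambda>w. reflect_error K (V w, E w)) = distr M ?L (\<lambda>w. (V w, E w))" .
  have "distr M ?L h = distr M (borel \<Otimes>\<^sub>M borel) h" for h
    by (rule distr_cong[OF refl sets refl])
  with eq show ?thesis by simp
qed

text \<open>Replacing (V, E) by its reflection keeps V + E, and with it the arguments of g, but
  changes the sign of the error. The joint law with Z is unchanged, so the expectation equals its
  own negative.\<close>

lemma (in prob_space) conditional_error_orthogonal:
  fixes V E :: "'a \<Rightarrow> real^'k" and Z :: "'a \<Rightarrow> 'z" and g :: "real^'k \<Rightarrow> 'z \<Rightarrow> real"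
  assumes P: "pos_def P" and D: "pos_def D" and PD: "invertible (P + D)"
    and V: "distributed M lborel V (\<lambda>x. ennreal (mvn_density 0 P x))"
    and E: "distributed M lborel E (\<lambda>x. ennreal (mvn_density 0 D x))"
    and ind: "indep_var borel V borel E"
    and Z [measurable]: "Z \<in> M \<rightarrow>\<^sub>M N"
    and indZ: "distr M (borel \<Otimes>\<^sub>M borel) (\<lambda>w. (V w, E w)) \<Otimes>\<^sub>M distr M N Z
       = distr M ((borel \<Otimes>\<^sub>M borel) \<Otimes>\<^sub>M N) (\<lambda>w. ((V w, E w), Z w))"
    and g [measurable]: "case_prod g \<in> borel_measurable (borel \<Otimes>\<^sub>M N)"
  defines "K \<equiv> D ** matrix_inv (P + D)"
  shows "expectation (\<lambda>w. (E w - K *v (V w + E w)) $ j * g (V w + E w) (Z w)) = 0"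
proof -
  let ?B = "borel \<Otimes>\<^sub>M borel :: ((real^'k) \<times> (real^'k)) measure"
  have [measurable]: "V \<in> borel_measurable M" "E \<in> borel_measurable M"
    using distributed_measurable[OF V] distributed_measurable[OF E] by auto
  define F where "F p = (snd (fst p) - K *v (fst (fst p) + snd (fst p))) $ j * g (fst (fst p) + snd (fst p)) (snd p)" for p
  have gm: "(\<lambda>p. g (fst (fst p) + snd (fst p)) (snd p)) \<in> borel_measurable (?B \<Otimes>\<^sub>M N)"
    using measurable_compose[OF _ g, of "\<lambda>p. (fst (fst p) + snd (fst p), snd p)" "?B \<Otimes>\<^sub>M N"] by simp
  have [measurable]: "F \<in> borel_measurable (?B \<Otimes>\<^sub>M N)"
    unfolding F_def[abs_def] using gm by measurable
  let ?P = "distr M ?B (\<lambda>w. (V w, E w))" and ?Q = "distr M N Z"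
  interpret Q: prob_space ?Q by (rule prob_space_distr) measurable
  have PK: "distr ?P ?B (reflect_error K) = ?P"
    using distr_reflect_error[OF P D PD V E ind] by (simp add: distr_distr comp_def K_def)
  have Q: "distr ?Q N (\<lambda>z. z) = ?Q" by (simp add: distr_distr comp_def)
  have "distr M (?B \<Otimes>\<^sub>M N) (\<lambda>w. (reflect_error K (V w, E w), Z w))
      = distr (?P \<Otimes>\<^sub>M ?Q) (?B \<Otimes>\<^sub>M N) (\<lambda>(p, z). (reflect_error K p, z))"
    unfolding indZ by (simp add: distr_distr comp_def)
  also have "\<dots> = distr ?P ?B (reflect_error K) \<Otimes>\<^sub>M distr ?Q N (\<lambda>z. z)"
    by (rule pair_measure_distr[symmetric]) (auto simp: Q Q.sigma_finite_measure_axioms)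
  finally have eq: "distr M (?B \<Otimes>\<^sub>M N) (\<lambda>w. (reflect_error K (V w, E w), Z w)) = distr M (?B \<Otimes>\<^sub>M N) (\<lambda>w. ((V w, E w), Z w))"
    unfolding PK Q indZ .
  \<comment> \<open>\<open>integral_distr\<close> asks only for measurability; if F is not
    integrable, both sides are 0 by convention.\<close>
  have "expectation (\<lambda>w. F ((V w, E w), Z w)) = expectation (\<lambda>w. F (reflect_error K (V w, E w), Z w))"
    using integral_distr[of "\<lambda>w. ((V w, E w), Z w)" M "?B \<Otimes>\<^sub>M N" F]
      integral_distr[of "\<lambda>w. (reflect_error K (V w, E w), Z w)" M "?B \<Otimes>\<^sub>M N" F] eq by simp
  also have "\<dots> = expectation (\<lambda>w. - F ((V w, E w), Z w))"
  proof (intro Bochner_Integration.integral_cong refl)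
    fix w
    have s: "fst (reflect_error K p) + snd (reflect_error K p) = fst p + snd p"
      "snd (reflect_error K p) - K *v (fst p + snd p) = - (snd p - K *v (fst p + snd p))" for p
      by (simp_all add: reflect_error_def scaleR_2)
    show "F (reflect_error K (V w, E w), Z w) = - F ((V w, E w), Z w)"
      unfolding F_def fst_conv(1)[of "reflect_error K (V w, E w)"] snd_conv[of "reflect_error K (V w, E w)"] s
        vector_uminus_component by (simp add: left_diff_distrib)
  qed
  finally have "expectation (\<lambda>w. F ((V w, E w), Z w)) = 0" by simp
  then show ?thesis by (simp add: F_def)
qed

section \<open>The regression design\<close>

lemma sum_stack_rows: "(\<Sum>p\<in>stack_rows m. f p) = (\<Sum>i<m. \<Sum>r\<in>UNIV. f (i, r))"
  unfolding stack_rows_def by (simp add: sum.cartesian_product)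

lemma XtX_sum: "XtX X m = (\<Sum>i<m. transpose (X i) ** X i)"
  by (simp add: XtX_def sum_stack_rows vec_eq_iff stack_mat_def matrix_matrix_mult_def transpose_def)

lemma Xty_sum: "Xty X m y = (\<Sum>i<m. transpose (X i) *v y i)"
  by (simp add: Xty_def sum_stack_rows vec_eq_iff stack_mat_def stack_vec_def matrix_vector_mult_def transpose_def)

text \<open>On the index set C = C(AB) = (CA)B = B, and outside it both are zero by the convention
  of \<open>inv_on\<close>.\<close>

lemma inv_on_eqI:
  assumes fin: "finite I"
    and out: "\<And>p q. p \<notin> I \<or> q \<notin> I \<Longrightarrow> B p q = 0"
    and AB: "\<And>p q. p \<in> I \<Longrightarrow> q \<in> I \<Longrightarrow> (\<Sum>r\<in>I. A p r * B r q) = (if p = q then 1 else 0)"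
    and BA: "\<And>p q. p \<in> I \<Longrightarrow> q \<in> I \<Longrightarrow> (\<Sum>r\<in>I. B p r * A r q) = (if p = q then 1 else 0)"
  shows "inv_on I A = B"
  unfolding inv_on_def
proof (rule the_equality)
  fix C assume C: "(\<forall>p q. p \<notin> I \<or> q \<notin> I \<longrightarrow> C p q = 0) \<and>
    (\<forall>p\<in>I. \<forall>q\<in>I. (\<Sum>r\<in>I. A p r * C r q) = (if p = q then 1 else 0)) \<and>
    (\<forall>p\<in>I. \<forall>q\<in>I. (\<Sum>r\<in>I. C p r * A r q) = (if p = q then 1 else 0))"
  show "C = B"
  proof (intro ext)
    fix p q
    show "C p q = B p q"
    proof (cases "p \<in> I \<and> q \<in> I")
      case True
      have "C p q = (\<Sum>r\<in>I. C p r * (if r = q then 1 else 0))" using True fin by (simp add: if_distrib cong: if_cong)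
      also have "\<dots> = (\<Sum>r\<in>I. C p r * (\<Sum>t\<in>I. A r t * B t q))"
        using AB True by (intro sum.cong) auto
      also have "\<dots> = (\<Sum>r\<in>I. \<Sum>t\<in>I. C p r * A r t * B t q)"
        by (simp add: sum_distrib_left mult.assoc)
      also have "\<dots> = (\<Sum>t\<in>I. \<Sum>r\<in>I. C p r * A r t * B t q)" by (rule sum.swap)
      also have "\<dots> = (\<Sum>t\<in>I. (\<Sum>r\<in>I. C p r * A r t) * B t q)" by (simp add: sum_distrib_right)
      also have "\<dots> = (\<Sum>t\<in>I. (if p = t then 1 else 0) * B t q)" using C True by (intro sum.cong) auto
      also have "\<dots> = B p q" using True fin by (simp add: if_distribR if_distrib cong: if_cong)
      finally show ?thesis .
    qed (use C out in auto)
  qed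
qed (use assms in auto)

text \<open>The inverse of a block diagonal matrix is the block diagonal matrix of the inverses. B
  is that matrix, set to zero beyond the first m areas as \<open>inv_on\<close> prescribes.\<close>

lemma XtVinvX_sum:
  fixes X :: "nat \<Rightarrow> real^'s^'k" and Psi :: "real^'k^'k"
  assumes inv: "\<And>i. invertible (Psi + D i)"
  shows "XtVinvX X D m Psi = (\<Sum>i<m. transpose (X i) ** matrix_inv (Psi + D i) ** X i)"
proof -
  let ?A = "\<lambda>p q. kron_id Psi p q + block_diag D p q"
  let ?I = "stack_rows m :: (nat \<times> 'k) set"
  define B where "B p q = (if fst p = fst q \<and> fst p < m then matrix_inv (Psi + D (fst p)) $ snd p $ snd q else 0)"
    for p q :: "nat \<times> 'k"
  have A: "?A (i, r) (j, q) = (if i = j then (Psi + D i) $ r $ q else 0)" for i j r q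
    by (simp add: kron_id_def block_diag_def)
  have "inv_on ?I ?A = B"
  proof (rule inv_on_eqI)
    show "finite ?I" by (simp add: stack_rows_def)
    show "B p q = 0" if "p \<notin> ?I \<or> q \<notin> ?I" for p q
      using that by (auto simp: B_def stack_rows_def mem_Times_iff)
    fix p q assume pq: "p \<in> ?I" "q \<in> ?I"
    obtain i r where p: "p = (i, r)" "i < m" using pq by (auto simp: stack_rows_def)
    obtain j t where q: "q = (j, t)" "j < m" using pq by (auto simp: stack_rows_def)
    have "(\<Sum>s\<in>?I. ?A p s * B s q) = (\<Sum>l<m. if l = i then (if i = j then \<Sum>s\<in>UNIV. (Psi + D i) $ r $ s * matrix_inv (Psi + D i) $ s $ t else 0) else 0)"
      unfolding sum_stack_rows p q A by (intro sum.cong refl) (auto simp: B_def q)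
    also have "\<dots> = (if i = j then ((Psi + D i) ** matrix_inv (Psi + D i)) $ r $ t else 0)"
      using p by (simp add: matrix_matrix_mult_def)
    also have "\<dots> = (if p = q then 1 else 0)" by (simp add: matrix_inv_mult inv mat_def p q)
    finally show "(\<Sum>s\<in>?I. ?A p s * B s q) = (if p = q then 1 else 0)" .
    have "(\<Sum>s\<in>?I. B p s * ?A s q) = (\<Sum>l<m. if l = i then (if i = j then \<Sum>s\<in>UNIV. matrix_inv (Psi + D i) $ r $ s * (Psi + D i) $ s $ t else 0) else 0)"
      unfolding sum_stack_rows p q A by (intro sum.cong refl) (auto simp: B_def p)
    also have "\<dots> = (if i = j then (matrix_inv (Psi + D i) ** (Psi + D i)) $ r $ t else 0)"
      using p by (simp add: matrix_matrix_mult_def)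
    also have "\<dots> = (if p = q then 1 else 0)" by (simp add: matrix_inv_mult inv mat_def p q)
    finally show "(\<Sum>s\<in>?I. B p s * ?A s q) = (if p = q then 1 else 0)" .
  qed
  then have "XtVinvX X D m Psi $ c $ d = (\<Sum>i<m. \<Sum>r\<in>UNIV. \<Sum>j<m. \<Sum>q\<in>UNIV. X i $ r $ c * B (i, r) (j, q) * X j $ q $ d)" for c d
    by (simp add: XtVinvX_def sum_stack_rows stack_mat_def)
  also have "\<dots> c d = (\<Sum>i<m. \<Sum>r\<in>UNIV. \<Sum>j<m. if j = i then \<Sum>q\<in>UNIV. X i $ r $ c * matrix_inv (Psi + D i) $ r $ q * X i $ q $ d else 0)" for c d
    by (intro sum.cong refl) (auto simp: B_def)
  also have "\<dots> c d = (\<Sum>i<m. \<Sum>r\<in>UNIV. \<Sum>q\<in>UNIV. X i $ r $ c * matrix_inv (Psi + D i) $ r $ q * X i $ q $ d)" for c d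
    by (intro sum.cong refl) simp
  also have "\<dots> c d = (\<Sum>i<m. \<Sum>q\<in>UNIV. \<Sum>r\<in>UNIV. X i $ r $ c * matrix_inv (Psi + D i) $ r $ q * X i $ q $ d)" for c d
    by (intro sum.cong refl sum.swap)
  also have "\<dots> c d = (\<Sum>i<m. transpose (X i) ** matrix_inv (Psi + D i) ** X i) $ c $ d" for c d
    by (simp add: matrix_matrix_mult_def transpose_def sum_distrib_right)
  finally show ?thesis by (simp add: vec_eq_iff)
qed

section \<open>The nonrandom part of the model and its bounds for large m\<close>

locale fay_herriot_design =
  fixes X :: "nat \<Rightarrow> real^'s^'k" and D :: "nat \<Rightarrow> real^'k^'k" and Psi :: "real^'k^'k"
    and dlo dhi :: real and Q :: "real^'s^'s"
  assumes Psi_pos: "pos_def Psi"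
    and D_psd: "\<And>i. psd (D i)"
    and d_pos: "0 < dlo" "0 < dhi"
    and D_ge: "\<And>i x. dlo * (x \<bullet> x) \<le> x \<bullet> (D i *v x)"
    and D_le: "\<And>i x. x \<bullet> (D i *v x) \<le> dhi * (x \<bullet> x)"
    and XtX_lim: "(\<lambda>m. (1 / real m) *\<^sub>R XtX X m) \<longlonglongrightarrow> Q" and Q_pos: "pos_def Q"
begin

definition sig :: "nat \<Rightarrow> real^'k^'k" where "sig i = Psi + D i"

definition isig :: "nat \<Rightarrow> real^'k^'k" where "isig i = matrix_inv (sig i)"

definition S :: "nat \<Rightarrow> real^'k^'k \<Rightarrow> real^'s^'s" where
  "S m B = (\<Sum>i<m. transpose (X i) ** matrix_inv (B + D i) ** X i)"

lemma D_sym: "transpose (D i) = D i"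
  using D_psd by (simp add: psd_def)

lemma D_pos_def: "pos_def (D i)"
  by (rule coercive_pos_def[OF D_sym d_pos(1) D_ge])

lemma norm_D: "norm (D i) \<le> CARD('k) * dhi"
  by (rule norm_psd_le[OF D_psd D_le])

lemma Psi_psd: "psd Psi" and Psi_sym: "transpose Psi = Psi"
  using Psi_pos by (auto simp: pos_def_imp_psd pos_def_def)

lemma plus_D_ge:
  assumes "psd B"
  shows "dlo * (x \<bullet> x) \<le> x \<bullet> ((B + D i) *v x)"
  using assms D_ge[of x i] by (simp add: mv.add_left inner_add_right psd_def add_increasing)

lemma plus_D_le: "x \<bullet> ((B + D i) *v x) \<le> (norm B + dhi) * (x \<bullet> x)"
  using D_le[of x i] inner_matrix_le_norm[of x B] by (simp add: mv.add_left inner_add_right distrib_right)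

lemma plus_D:
  assumes "psd B"
  shows "pos_def (B + D i)" "invertible (B + D i)" "transpose (B + D i) = B + D i"
    "transpose (matrix_inv (B + D i)) = matrix_inv (B + D i)"
    "norm (matrix_inv (B + D i)) \<le> CARD('k) / dlo"
proof -
  show sym: "transpose (B + D i) = B + D i" using assms D_sym by (simp add: transpose_add psd_def)
  show "pos_def (B + D i)" by (rule coercive_pos_def[OF sym d_pos(1) plus_D_ge[OF assms]])
  show inv: "invertible (B + D i)" "norm (matrix_inv (B + D i)) \<le> CARD('k) / dlo"
    using coercive_inverse[OF d_pos(1) plus_D_ge[OF assms]] by auto
  show "transpose (matrix_inv (B + D i)) = matrix_inv (B + D i)" by (rule transpose_matrix_inv[OF inv(1) sym])
qed

lemmas sig_facts = plus_D[OF Psi_psd, folded sig_def, folded isig_def]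

lemma sig_isig: "sig i ** isig i = mat 1" "isig i ** sig i = mat 1"
  unfolding isig_def by (simp_all add: matrix_inv_mult sig_facts)

lemma norm_sig: "norm (sig i) \<le> norm Psi + CARD('k) * dhi"
  unfolding sig_def using norm_triangle_ineq[of Psi "D i"] norm_D[of i] by linarith

lemma XtX_form: "x \<bullet> (XtX X m *v x) = (\<Sum>i<m. (X i *v x) \<bullet> (X i *v x))"
  by (simp add: XtX_sum mv.sum_left inner_sum_right matrix_vector_mul_assoc[symmetric] inner_matrix_vector)

text \<open>For large m the matrix X^T X / m differs from its limit by less than half the coercivity
  constant of the limit.\<close>

lemma XtX_coercive:
  obtains q where "q > 0" "\<forall>\<^sub>F m in sequentially. \<forall>x. q * real m * (x \<bullet> x) \<le> x \<bullet> (XtX X m *v x)"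
proof -
  obtain q where q: "q > 0" "\<And>x. q * (x \<bullet> x) \<le> x \<bullet> (Q *v x)"
    by (rule pos_def_coercive[OF Q_pos]) blast
  have "\<forall>\<^sub>F m in sequentially. dist ((1 / real m) *\<^sub>R XtX X m) Q < q / 2"
    using tendstoD[OF XtX_lim, of "q/2"] q by simp
  then have "\<forall>\<^sub>F m in sequentially. \<forall>x. q / 2 * real m * (x \<bullet> x) \<le> x \<bullet> (XtX X m *v x)"
    using eventually_gt_at_top[of 0]
  proof eventually_elim
    case (elim m)
    show ?case
    proof
      fix x :: "real^'s"
      let ?E = "(1 / real m) *\<^sub>R XtX X m - Q"
      have "norm ?E * (x \<bullet> x) \<le> q / 2 * (x \<bullet> x)"
        using elim by (intro mult_right_mono) (auto simp: dist_norm)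
      then have "- (q / 2 * (x \<bullet> x)) \<le> x \<bullet> (?E *v x)" using inner_matrix_ge_norm[of ?E x] by linarith
      also have "x \<bullet> (?E *v x) = (1 / real m) * (x \<bullet> (XtX X m *v x)) - x \<bullet> (Q *v x)"
        by (simp add: mv.diff_left mv.scaleR_left inner_diff_right)
      finally have "q / 2 * (x \<bullet> x) \<le> (1 / real m) * (x \<bullet> (XtX X m *v x))" using q(2)[of x] by linarith
      then show "q / 2 * real m * (x \<bullet> x) \<le> x \<bullet> (XtX X m *v x)" using elim by (simp add: field_simps)
    qed
  qed
  then show ?thesis using that[of "q / 2"] q by simp
qed

text \<open>The squares of the entries of the X_i add up to the trace of X^T X. No bound on the
  individual X_i is assumed, so the later estimates over all areas rest on this average.\<close>

lemma X_square_sum: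
  obtains C where "C > 0" "\<forall>\<^sub>F m in sequentially. (\<Sum>i<m. (norm (X i))\<^sup>2) \<le> C * real m"
proof -
  have "\<forall>\<^sub>F m in sequentially. dist ((1 / real m) *\<^sub>R XtX X m) Q < 1"
    using tendstoD[OF XtX_lim, of 1] by simp
  then have "\<forall>\<^sub>F m in sequentially. (\<Sum>i<m. (norm (X i))\<^sup>2) \<le> (CARD('s) * (norm Q + 1)) * real m"
    using eventually_gt_at_top[of 0]
  proof eventually_elim
    case (elim m)
    have "norm ((1 / real m) *\<^sub>R XtX X m) \<le> norm Q + 1"
      using elim norm_triangle_ineq2[of "(1 / real m) *\<^sub>R XtX X m" Q] by (simp add: dist_norm)
    then have n: "norm (XtX X m) \<le> (norm Q + 1) * real m" using elim by (simp add: field_simps)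
    have "(norm (X i))\<^sup>2 = (\<Sum>c\<in>UNIV. (transpose (X i) ** X i) $ c $ c)" for i
      unfolding power2_norm_eq_inner inner_vec_def matrix_matrix_mult_def transpose_def
      by simp (rule sum.swap)
    then have "(\<Sum>i<m. (norm (X i))\<^sup>2) = (\<Sum>c\<in>UNIV. XtX X m $ c $ c)"
      by (simp add: XtX_sum) (rule sum.swap)
    also have "\<dots> \<le> (\<Sum>c\<in>(UNIV::'s set). norm (XtX X m))"
    proof (rule sum_mono)
      fix c
      have "XtX X m $ c $ c \<le> norm (XtX X m $ c)" using component_le_norm_cart[of "XtX X m $ c" c] by linarith
      also have "\<dots> \<le> norm (XtX X m)" by (rule Finite_Cartesian_Product.norm_nth_le)
      finally show "XtX X m $ c $ c \<le> norm (XtX X m)" .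
    qed
    also have "\<dots> \<le> CARD('s) * ((norm Q + 1) * real m)" using n by simp
    finally show ?case by simp
  qed
  moreover have "0 < CARD('s) * (norm Q + 1)" by (intro mult_pos_pos add_nonneg_pos) auto
  ultimately show ?thesis using that by blast
qed

text \<open>The constants below are uniform in \<open>m\<close>; the second bound is only linear in the plugged-in
  matrix \<open>B\<close>, so all moments of the estimated weights stay under control.\<close>

lemma inverse_bounds:
  obtains C where "C > 0"
    "\<forall>\<^sub>F m in sequentially. invertible (XtX X m) \<and> norm (matrix_inv (XtX X m)) \<le> C / real m"
    "\<forall>\<^sub>F m in sequentially. \<forall>B. psd B \<longrightarrow> invertible (S m B) \<and> norm (matrix_inv (S m B)) \<le> C * (norm B + dhi) / real m"
proof -
  obtain q where q: "q > 0" "\<forall>\<^sub>F m in sequentially. \<forall>x. q * real m * (x \<bullet> x) \<le> x \<bullet> (XtX X m *v x)"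
    by (rule XtX_coercive)
  let ?C = "CARD('s) / q"
  show ?thesis
  proof (rule that[of ?C])
    show "?C > 0" using q by simp
    show "\<forall>\<^sub>F m in sequentially. invertible (XtX X m) \<and> norm (matrix_inv (XtX X m)) \<le> ?C / real m"
      using q(2) eventually_gt_at_top[of 0]
    proof eventually_elim
      case (elim m)
      have "q * real m > 0" using q elim by simp
      from coercive_inverse[OF this, of "XtX X m"] elim show ?case by simp
    qed
    show "\<forall>\<^sub>F m in sequentially. \<forall>B. psd B \<longrightarrow> invertible (S m B) \<and> norm (matrix_inv (S m B)) \<le> ?C * (norm B + dhi) / real m"
      using q(2) eventually_gt_at_top[of 0]
    proof eventually_elim
      case (elim m)
      show ?case
      proof (intro allI impI)
        fix B :: "real^'k^'k" assume B: "psd B"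
        let ?t = "norm B + dhi"
        have t: "?t > 0" using d_pos by (simp add: add_nonneg_pos)
        have co: "q * real m / ?t * (x \<bullet> x) \<le> x \<bullet> (S m B *v x)" for x
        proof -
          have "q * real m * (x \<bullet> x) \<le> (\<Sum>i<m. (X i *v x) \<bullet> (X i *v x))" using elim XtX_form by simp
          \<comment> \<open>B + D_i is at most t, so its inverse is at least 1/t; this compares S
            with X^T X.\<close>
          also have "\<dots> \<le> (\<Sum>i<m. ?t * ((X i *v x) \<bullet> (matrix_inv (B + D i) *v (X i *v x))))"
            by (intro sum_mono psd_matrix_inv_ge pos_def_imp_psd plus_D B plus_D_le)
          also have "\<dots> = ?t * (x \<bullet> (S m B *v x))"
            by (simp add: S_def mv.sum_left inner_sum_right matrix_vector_mul_assoc[symmetric]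
                inner_matrix_vector[of x "transpose (X _)"] sum_distrib_left)
          finally show ?thesis using t by (simp add: field_simps)
        qed
        have "q * real m / ?t > 0" using q t elim by simp
        from coercive_inverse[OF this co]
        show "invertible (S m B) \<and> norm (matrix_inv (S m B)) \<le> ?C * (norm B + dhi) / real m" by simp
      qed
    qed
  qed
qed

lemma S_sym: "psd B \<Longrightarrow> transpose (S m B) = S m B"
  by (simp add: S_def transpose_sum matrix_transpose_mul plus_D(4) matrix_mul_assoc)

lemma G1_eq: "G1 D a Psi = Psi ** isig a ** D a"
proof -
  have inv: "invertible Psi" "invertible (D a)" using Psi_pos D_pos_def pos_def_invertible by auto
  have 1: "matrix_inv Psi ** (Psi ** isig a ** D a) = isig a ** D a"
    by (simp add: matrix_mul_assoc matrix_inv_mult inv)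
  have 2: "matrix_inv (D a) ** (D a ** isig a ** D a) = isig a ** D a"
    by (simp add: matrix_mul_assoc matrix_inv_mult inv)
  \<comment> \<open>By \<open>2\<close> the first summand is made to begin with the inverse of D_a,
    like the second; the sum D_a + Psi = \<open>sig a\<close> then cancels against
    \<open>isig a\<close>.\<close>
  have "(matrix_inv Psi + matrix_inv (D a)) ** (Psi ** isig a ** D a)
    = matrix_inv (D a) ** (D a ** isig a ** D a) + matrix_inv (D a) ** (Psi ** isig a ** D a)"
    unfolding mm.add_left 1 2 ..
  also have "\<dots> = matrix_inv (D a) ** (sig a ** isig a ** D a)"
    by (simp add: mm.add_left mm.add_right sig_def add.commute)
  also have "\<dots> = mat 1" by (simp add: sig_isig matrix_inv_mult inv)
  finally show ?thesis unfolding G1_def by (rule matrix_inv_unique(1))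
qed

lemma XtVinvX_S: "XtVinvX X D m Psi = S m Psi"
  unfolding S_def by (rule XtVinvX_sum) (rule plus_D(2)[OF Psi_psd])

section \<open>The bias correction\<close>

lemma norm_plus_D: "norm (B + D i) \<le> norm B + CARD('k) * dhi"
  using norm_triangle_ineq[of B "D i"] norm_D[of i] by linarith

text \<open>Each inverse of X^T X is O(1/m) and each sum of |X_i|^2 is O(m). The first term of the
  bias has two inverses and two such sums, the others one of each, so only the prefactor 1/m
  remains; this also explains the constant c^2 d^2 + 2cd. Linear growth in B matters because a
  random matrix will be inserted.\<close>

lemma Bias0_bound:
  obtains C where "C \<ge> 0" "\<forall>\<^sub>F m in sequentially. \<forall>B. norm (Bias0 X D m B) \<le> C * (1 / real m) * (norm B + CARD('k) * dhi)"
proof -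
  obtain c where c: "c > 0" "\<forall>\<^sub>F m in sequentially. (\<Sum>i<m. (norm (X i))\<^sup>2) \<le> c * real m"
    by (rule X_square_sum) blast
  obtain d where d: "d > 0"
    "\<forall>\<^sub>F m in sequentially. invertible (XtX X m) \<and> norm (matrix_inv (XtX X m)) \<le> d / real m"
    by (rule inverse_bounds) blast
  have "\<forall>\<^sub>F m in sequentially. \<forall>B. norm (Bias0 X D m B) \<le> (c\<^sup>2 * d\<^sup>2 + 2 * c * d) * (1 / real m) * (norm B + CARD('k) * dhi)"
    using c(2) d(2) eventually_gt_at_top[of 0]
  proof eventually_elim
    case (elim m)
    show ?case
    proof
      fix B :: "real^'k^'k"
      let ?G = "matrix_inv (XtX X m)" and ?t = "norm B + CARD('k) * dhi" and ?g = "d / real m"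
      have t: "?t \<ge> 0" and g: "?g \<ge> 0" and G: "norm ?G \<le> ?g" using d elim d_pos by auto
      have sq: "(\<Sum>i<m. norm (X i) * norm (X i)) \<le> c * real m" using elim by (simp add: power2_eq_square)
      let ?J = "\<Sum>j<m. transpose (X j) ** (B + D j) ** X j"
      have "norm ?J \<le> (\<Sum>j<m. norm (X j) * ?t * norm (X j))"
        by (intro order_trans[OF norm_sum] sum_mono norm_matrix_mult_mono norm_plus_D) (auto simp: norm_transpose)
      also have "\<dots> = ?t * (\<Sum>j<m. norm (X j) * norm (X j))" by (simp add: sum_distrib_left mult_ac)
      also have "\<dots> \<le> ?t * (c * real m)" using sq t by (intro mult_left_mono)
      finally have J: "norm ?J \<le> ?t * (c * real m)" .
      have "norm (\<Sum>i<m. X i ** ?G ** ?J ** ?G ** transpose (X i))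
          \<le> (\<Sum>i<m. norm (X i) * ?g * (?t * (c * real m)) * ?g * norm (X i))"
        by (intro order_trans[OF norm_sum] sum_mono norm_matrix_mult_mono J G) (auto simp: norm_transpose)
      also have "\<dots> = ?g * (?t * (c * real m)) * ?g * (\<Sum>i<m. norm (X i) * norm (X i))"
        by (simp only: sum_distrib_left) (simp only: mult_ac)
      also have "\<dots> \<le> ?g * (?t * (c * real m)) * ?g * (c * real m)"
        using sq t g c by (intro mult_left_mono mult_nonneg_nonneg) auto
      also have "\<dots> = c\<^sup>2 * d\<^sup>2 * ?t" using elim by (simp add: power2_eq_square)
      finally have 1: "norm (\<Sum>i<m. X i ** ?G ** ?J ** ?G ** transpose (X i)) \<le> c\<^sup>2 * d\<^sup>2 * ?t" .
      have "norm (\<Sum>i<m. (B + D i) ** X i ** ?G ** transpose (X i)) \<le> (\<Sum>i<m. ?t * norm (X i) * ?g * norm (X i))"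
        by (intro order_trans[OF norm_sum] sum_mono norm_matrix_mult_mono G norm_plus_D) (auto simp: norm_transpose)
      also have "\<dots> = ?t * ?g * (\<Sum>i<m. norm (X i) * norm (X i))"
        by (simp only: sum_distrib_left) (simp only: mult_ac)
      also have "\<dots> \<le> ?t * ?g * (c * real m)" using sq t g by (intro mult_left_mono mult_nonneg_nonneg) auto
      also have "\<dots> = c * d * ?t" using elim by simp
      finally have 2: "norm (\<Sum>i<m. (B + D i) ** X i ** ?G ** transpose (X i)) \<le> c * d * ?t" .
      have "norm (\<Sum>i<m. X i ** ?G ** transpose (X i) ** (B + D i)) \<le> (\<Sum>i<m. norm (X i) * ?g * norm (X i) * ?t)"
        by (intro order_trans[OF norm_sum] sum_mono norm_matrix_mult_mono G norm_plus_D) (auto simp: norm_transpose)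
      also have "\<dots> = ?t * ?g * (\<Sum>i<m. norm (X i) * norm (X i))"
        by (simp only: sum_distrib_left) (simp only: mult_ac)
      also have "\<dots> \<le> ?t * ?g * (c * real m)" using sq t g by (intro mult_left_mono mult_nonneg_nonneg) auto
      also have "\<dots> = c * d * ?t" using elim by simp
      finally have 3: "norm (\<Sum>i<m. X i ** ?G ** transpose (X i) ** (B + D i)) \<le> c * d * ?t" .
      have tri: "norm (r *\<^sub>R x - r *\<^sub>R y - r *\<^sub>R z) \<le> r * (norm x + norm y + norm z)" if "r \<ge> 0" for r and x y z :: "real^'k^'k"
      proof -
        have "norm (r *\<^sub>R x - r *\<^sub>R y - r *\<^sub>R z) = r * norm (x - y - z)"
          using that by (simp add: scaleR_diff_right[symmetric])
        also have "\<dots> \<le> r * (norm x + norm y + norm z)"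
          using that norm_triangle_ineq4[of "x - y" z] norm_triangle_ineq4[of x y] by (intro mult_left_mono) auto
        finally show ?thesis .
      qed
      have eq: "r * (x * t + z * t + z * t) = (x + 2 * z) * r * t" for r x z t :: real
        by (simp add: algebra_simps)
      have "norm (Bias0 X D m B) \<le> 1 / real m * (c\<^sup>2 * d\<^sup>2 * ?t + c * d * ?t + c * d * ?t)"
        unfolding Bias0_def using 1 2 3 by (intro order_trans[OF tri] mult_left_mono add_mono) auto
      then show "norm (Bias0 X D m B) \<le> (c\<^sup>2 * d\<^sup>2 + 2 * c * d) * (1 / real m) * ?t"
        unfolding eq by (simp only: mult.assoc)
    qed
  qed
  moreover have "c\<^sup>2 * d\<^sup>2 + 2 * c * d \<ge> 0" using c d by auto
  ultimately show ?thesis using that by blast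
qed

lemma XtX_sym: "transpose (XtX X m) = XtX X m"
  by (simp add: XtX_sum transpose_sum matrix_transpose_mul)

lemma Bias0_sym:
  assumes B: "transpose B = B" and inv: "invertible (XtX X m)"
  shows "transpose (Bias0 X D m B) = Bias0 X D m B"
proof -
  have G: "transpose (matrix_inv (XtX X m)) = matrix_inv (XtX X m)"
    by (rule transpose_matrix_inv[OF inv XtX_sym])
  have BD: "transpose (B + D i) = B + D i" for i using B D_sym by (simp add: transpose_add)
  show ?thesis
    unfolding Bias0_def
    by (simp add: transpose_diff transpose_scalar transpose_sum matrix_transpose_mul G BD matrix_mul_assoc)
qed

lemma Psi0_sym: "transpose (Psi0_hat X D m y) = Psi0_hat X D m y"
  by (simp add: Psi0_hat_def transpose_scalar transpose_sum transpose_diff transpose_outer D_sym)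

lemma Psi1_sym: "invertible (XtX X m) \<Longrightarrow> transpose (Psi1_hat X D m y) = Psi1_hat X D m y"
  unfolding Psi1_hat_def transpose_diff by (simp add: Psi0_sym Bias0_sym)

end

section \<open>The random model\<close>

locale fay_herriot_model = prob_space M + fay_herriot_design X D Psi dlo dhi Q
  for M :: "'a measure" and X :: "nat \<Rightarrow> real^'s^'k" and D Psi dlo dhi Q +
  fixes \<beta> :: "real^'s" and v \<epsilon> :: "nat \<Rightarrow> 'a \<Rightarrow> real^'k" and a :: nat
  assumes indep: "indep_vars (\<lambda>_. borel) (\<lambda>j. case j of Inl i \<Rightarrow> v i | Inr i \<Rightarrow> \<epsilon> i) (UNIV :: (nat + nat) set)"
    and v_normal: "\<And>i. distributed M lborel (v i) (\<lambda>x. ennreal (mvn_density 0 Psi x))"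
    and eps_normal: "\<And>i. distributed M lborel (\<epsilon> i) (\<lambda>x. ennreal (mvn_density 0 (D i) x))"
begin

definition u :: "nat \<Rightarrow> 'a \<Rightarrow> real^'k" where "u i w = v i w + \<epsilon> i w"

definition y :: "nat \<Rightarrow> 'a \<Rightarrow> real^'k" where "y i w = X i *v \<beta> + u i w"

lemma v_measurable [measurable]: "v i \<in> borel_measurable M"
  using distributed_measurable[OF v_normal[of i]] by simp

lemma eps_measurable [measurable]: "\<epsilon> i \<in> borel_measurable M"
  using distributed_measurable[OF eps_normal[of i]] by simp

lemma u_measurable [measurable]: "u i \<in> borel_measurable M"
  unfolding u_def[abs_def] by measurable

lemma y_measurable [measurable]: "y i \<in> borel_measurable M"
  unfolding y_def[abs_def] by measurable

lemma indep_u: "indep_vars (\<lambda>_. borel) u UNIV"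
proof -
  have "indep_vars (\<lambda>i. PiM {Inl i, Inr i} (\<lambda>_. borel))
      (\<lambda>i w. restrict (\<lambda>j. (case j of Inl i \<Rightarrow> v i | Inr i \<Rightarrow> \<epsilon> i) w) {Inl i, Inr i}) (UNIV :: nat set)"
    by (rule indep_vars_restrict[OF indep]) (auto simp: disjoint_family_on_def)
  from indep_vars_compose2[OF this, where Y="\<lambda>i f. f (Inl i) + f (Inr i)" and N="\<lambda>_. borel"]
  have "indep_vars (\<lambda>_. borel) (\<lambda>i w. v i w + \<epsilon> i w) UNIV"
    by simp
  then show ?thesis by (simp add: u_def[abs_def])
qed

lemma indep_v_eps: "indep_var borel (v i) borel (\<epsilon> i)"
proof -
  let ?F = "\<lambda>A w. restrict (\<lambda>j. (case j of Inl i \<Rightarrow> v i | Inr i \<Rightarrow> \<epsilon> i) w) A"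
  have "indep_var (PiM {Inl i} (\<lambda>_. borel)) (?F {Inl i}) (PiM {Inr i} (\<lambda>_. borel)) (?F {Inr i})"
    by (rule indep_var_restrict[OF indep]) auto
  from indep_var_compose[OF this, of "\<lambda>f. f (Inl i)" borel "\<lambda>f. f (Inr i)" borel]
  show ?thesis by (simp add: comp_def)
qed

lemma v_centred_normal: "centred_normal M (v i) Psi"
  by (rule mvn_density_centred_normal[OF Psi_pos v_normal])

lemma eps_centred_normal: "centred_normal M (\<epsilon> i) (D i)"
  by (rule mvn_density_centred_normal[OF D_pos_def eps_normal])

lemma u_centred_normal: "centred_normal M (u i) (sig i)"
  unfolding u_def[abs_def] sig_def
  by (rule centred_normal_add[OF indep_v_eps v_centred_normal eps_centred_normal])

lemma u_momO: "momO M 0 (\<lambda>m. u i)"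
  by (rule centred_normal_momO_0[OF u_centred_normal])

definition csig :: real where "csig = norm Psi + CARD('k) * dhi"

lemma csig: "norm (sig i) \<le> csig" "csig \<ge> 0"
  using norm_sig d_pos by (auto simp: csig_def)

text \<open>The densities are given for v_i and \<epsilon>_i separately, so the two bounds are
  multiplied by independence. The inequality |v + \<epsilon>|^2 \<le> 2|v|^2 + 2|\<epsilon>|^2 is
  why 4s becomes 8s. The constants do not depend on i.\<close>

lemma u_exp_square:
  obtains c K where "c > 0" "\<And>i. integrable M (\<lambda>w. exp (c * (norm (u i w))\<^sup>2))"
    "\<And>i. expectation (\<lambda>w. exp (c * (norm (u i w))\<^sup>2)) \<le> K"
proof -
  define s where "s = norm Psi + dhi"
  have s: "s > 0" using d_pos by (simp add: s_def add_nonneg_pos)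
  have Psi_le: "x \<bullet> (Psi *v x) \<le> s * (x \<bullet> x)" and D_le': "x \<bullet> (D i *v x) \<le> s * (x \<bullet> x)" for x i
    using inner_matrix_le_norm[of x Psi] D_le[of x i] d_pos
    by (auto simp: s_def distrib_right add_increasing add_increasing2)
  note vv = mvn_density_exp_square[OF Psi_pos v_normal s Psi_le]
    and ee = mvn_density_exp_square[OF D_pos_def eps_normal s D_le']
  show ?thesis
  proof (rule that[of "1 / (8 * s)" "sqrt 2 ^ CARD('k) * sqrt 2 ^ CARD('k)"])
    fix i
    let ?f = "\<lambda>w. exp ((norm (v i w))\<^sup>2 / (4 * s))" and ?g = "\<lambda>w. exp ((norm (\<epsilon> i w))\<^sup>2 / (4 * s))"
    have ind: "indep_var borel ?f borel ?g"
      using indep_var_compose[OF indep_v_eps, of "\<lambda>x. exp ((norm x)\<^sup>2 / (4 * s))" borel "\<lambda>x. exp ((norm x)\<^sup>2 / (4 * s))" borel]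
      by (simp add: comp_def)
    have int: "integrable M (\<lambda>w. ?f w * ?g w)"
      by (rule indep_var_integrable[OF ind vv(1) ee(1)])
    have le: "exp (1 / (8 * s) * (norm (u i w))\<^sup>2) \<le> ?f w * ?g w" for w
    proof -
      have "(norm (u i w))\<^sup>2 \<le> (norm (v i w) + norm (\<epsilon> i w))\<^sup>2"
        unfolding u_def by (intro power_mono norm_triangle_ineq) auto
      also have "\<dots> \<le> 2 * (norm (v i w))\<^sup>2 + 2 * (norm (\<epsilon> i w))\<^sup>2"         using zero_le_power2[of "norm (v i w) - norm (\<epsilon> i w)"] by (simp add: power2_eq_square algebra_simps)
      finally show ?thesis using s by (simp add: exp_add[symmetric] field_simps)
    qed
    show int': "integrable M (\<lambda>w. exp (1 / (8 * s) * (norm (u i w))\<^sup>2))"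
      by (rule Bochner_Integration.integrable_bound[OF int]) (simp, intro AE_I2, use le in simp)
    have "expectation (\<lambda>w. exp (1 / (8 * s) * (norm (u i w))\<^sup>2)) \<le> expectation (\<lambda>w. ?f w * ?g w)"
      by (rule integral_mono[OF int' int le])
    also have "\<dots> = expectation ?f * expectation ?g" by (rule indep_var_lebesgue_integral[OF ind vv(1) ee(1)])
    also have "\<dots> \<le> sqrt 2 ^ CARD('k) * sqrt 2 ^ CARD('k)" by (intro mult_mono vv ee) auto
    finally show "expectation (\<lambda>w. exp (1 / (8 * s) * (norm (u i w))\<^sup>2)) \<le> sqrt 2 ^ CARD('k) * sqrt 2 ^ CARD('k)" .
  qed (use s in simp)
qed

text \<open>Convexity of exp: the exponential of an average is at most the average of the
  exponentials, whose expectations are uniformly bounded.\<close>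

lemma mean_square_momO: "momO M 0 (\<lambda>m w. (\<Sum>i<m. (norm (u i w))\<^sup>2) / real m)"
proof -
  obtain c K where c: "c > 0" "\<And>i. integrable M (\<lambda>w. exp (c * (norm (u i w))\<^sup>2))"
    "\<And>i. expectation (\<lambda>w. exp (c * (norm (u i w))\<^sup>2)) \<le> K"
    by (rule u_exp_square) blast
  show ?thesis
  proof (rule momO_from_exp[OF c(1), where K=K])
    show "\<forall>\<^sub>F m in sequentially. integrable M (\<lambda>w. exp (c * sqrt (real m) ^ 0 * \<bar>(\<Sum>i<m. (norm (u i w))\<^sup>2) / real m\<bar>)) \<and>
       expectation (\<lambda>w. exp (c * sqrt (real m) ^ 0 * \<bar>(\<Sum>i<m. (norm (u i w))\<^sup>2) / real m\<bar>)) \<le> K"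
      using eventually_gt_at_top[of 0]
    proof eventually_elim
      case (elim m)
      let ?f = "\<lambda>w. exp (c * ((\<Sum>i<m. (norm (u i w))\<^sup>2) / real m))"
      let ?g = "\<lambda>w. \<Sum>i<m. (1 / real m) * exp (c * (norm (u i w))\<^sup>2)"
      have eq: "exp (c * sqrt (real m) ^ 0 * \<bar>(\<Sum>i<m. (norm (u i w))\<^sup>2) / real m\<bar>) = ?f w" for w
        by (simp add: sum_nonneg)
      have le: "?f w \<le> ?g w" for w
      proof -
        have "exp (\<Sum>i<m. (1 / real m) *\<^sub>R (c * (norm (u i w))\<^sup>2)) \<le> ?g w"
          by (rule convex_on_sum[OF _ _ exp_convex]) (use elim in auto)
        then show ?thesis by (simp add: sum_divide_distrib sum_distrib_left)
      qed
      have int: "integrable M ?g" using c by auto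
      have int': "integrable M ?f"
        by (rule Bochner_Integration.integrable_bound[OF int]) (simp, intro AE_I2, use le in \<open>simp add: sum_nonneg\<close>)
      have "expectation ?f \<le> expectation ?g" by (rule integral_mono[OF int' int le])
      also have "\<dots> = (\<Sum>i<m. (1 / real m) * expectation (\<lambda>w. exp (c * (norm (u i w))\<^sup>2)))" using c by simp
      also have "\<dots> \<le> (\<Sum>i<m. (1 / real m) * K)" using c by (intro sum_mono mult_left_mono) auto
      also have "\<dots> = K" using elim by simp
      finally show ?case using int' unfolding eq by blast
    qed
  qed simp
qed

text \<open>The divisor is m although area a is missing, so the full average differs from this one
  by a single term of order 1/m.\<close>

definition Dev :: "nat \<Rightarrow> 'a \<Rightarrow> real^'k^'k" where
  "Dev m w = (1 / real m) *\<^sub>R (\<Sum>i\<in>{..<m} - {a}. outer (u i w) (u i w) - sig i)"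

text \<open>An entry of u u^T is bounded by |u|^2, so the centred entry inherits exponential moments
  from |u|^2, and the bound for centred independent sums applies entrywise.\<close>

lemma Dev_momO: "momO M 1 Dev"
proof (intro momO_vec)
  fix p q :: 'k
  obtain c K where c: "c > 0" "\<And>i. integrable M (\<lambda>w. exp (c * (norm (u i w))\<^sup>2))"
    "\<And>i. expectation (\<lambda>w. exp (c * (norm (u i w))\<^sup>2)) \<le> K"
    by (rule u_exp_square) blast
  define Y where "Y i w = u i w $ p * u i w $ q - sig i $ p $ q" for i w
  have ind: "indep_vars (\<lambda>_. borel) Y UNIV"
    unfolding Y_def[abs_def] by (rule indep_vars_compose2[OF indep_u]) measurable
  have [measurable]: "Y i \<in> borel_measurable M" for i unfolding Y_def[abs_def] by measurable
  have le: "exp (c * \<bar>Y i w\<bar>) \<le> exp (c * csig) * exp (c * (norm (u i w))\<^sup>2)" for i w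
  proof -
    have "\<bar>sig i $ p $ q\<bar> \<le> csig"
      using component_le_norm_cart[of "sig i $ p" q] Finite_Cartesian_Product.norm_nth_le[of "sig i" p] csig(1)[of i]
      by linarith
    moreover have "\<bar>u i w $ p\<bar> * \<bar>u i w $ q\<bar> \<le> norm (u i w) * norm (u i w)"
      by (intro mult_mono component_le_norm_cart) auto
    ultimately have "\<bar>Y i w\<bar> \<le> csig + (norm (u i w))\<^sup>2"
      using abs_triangle_ineq4[of "u i w $ p * u i w $ q" "sig i $ p $ q"]
      by (simp add: Y_def abs_mult power2_eq_square)
    then have "c * \<bar>Y i w\<bar> \<le> c * (csig + (norm (u i w))\<^sup>2)" using c(1) by (intro mult_left_mono) auto
    then show ?thesis by (simp add: exp_add[symmetric] distrib_left)
  qed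
  have int0: "integrable M (\<lambda>w. exp (c * csig) * exp (c * (norm (u i w))\<^sup>2))" for i using c by auto
  have int: "integrable M (\<lambda>w. exp (c * \<bar>Y i w\<bar>))" for i
    by (rule Bochner_Integration.integrable_bound[OF int0[of i]]) (simp, intro AE_I2, use le in simp)
  have "expectation (\<lambda>w. exp (c * \<bar>Y i w\<bar>)) \<le> exp (c * csig) * K" for i
  proof -
    have "expectation (\<lambda>w. exp (c * \<bar>Y i w\<bar>)) \<le> expectation (\<lambda>w. exp (c * csig) * exp (c * (norm (u i w))\<^sup>2))"
      by (rule integral_mono[OF int int0 le])
    also have "\<dots> \<le> exp (c * csig) * K" using c by simp
    finally show ?thesis .
  qed
  moreover have "expectation (Y i) = 0" for i
  proof -
    have "integrable M (\<lambda>w. u i w $ p * u i w $ q)"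
      using momO_mult[OF momO_nth[OF u_momO] momO_nth[OF u_momO]] by (rule momO_integrable)
    then show ?thesis unfolding Y_def[abs_def]
      by (simp add: centred_normal_nth[OF u_centred_normal] prob_space)
  qed
  ultimately have "momO M 1 (\<lambda>m w. (\<Sum>i\<in>{..<m} - {a}. Y i w) / real m)"
    by (intro momO_centered_sum[OF ind c(1) int])
  then show "momO M 1 (\<lambda>m w. Dev m w $ p $ q)"
    by (simp add: Dev_def Y_def divide_inverse mult.commute)
qed

lemma linear_normal:
  assumes "finite J"
  shows "centred_normal M (\<lambda>w. \<Sum>i\<in>J. A i *v u i w) (\<Sum>i\<in>J. A i ** sig i ** transpose (A i))"
proof (rule centred_normal_sum)
  show "indep_vars (\<lambda>_. borel) (\<lambda>i w. A i *v u i w) J"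
    by (rule indep_vars_compose2[OF indep_vars_subset[OF indep_u]]) auto
qed (auto intro: assms centred_normal_linear u_centred_normal)

text \<open>A linear combination of the normal u_i is normal, so its order is decided by its
  covariance, which is at most \<open>csig\<close> times the sum of the squared coefficients. The
  sets J allow area a to be omitted.\<close>

lemma linear_momO:
  fixes A :: "nat \<Rightarrow> nat \<Rightarrow> real^'k^'n"
  assumes A: "\<forall>\<^sub>F m in sequentially. (\<Sum>i<m. (norm (A m i))\<^sup>2) \<le> C / real m"
    and J: "\<And>m. J m \<subseteq> {..<m}"
  shows "momO M 1 (\<lambda>m w. \<Sum>i\<in>J m. A m i *v u i w)"
proof (rule centred_normal_momO)
  have fin: "finite (J m)" for m using J finite_subset by blast
  show "\<forall>\<^sub>F m in sequentially. centred_normal M (\<lambda>w. \<Sum>i\<in>J m. A m i *v u i w) (\<Sum>i\<in>J m. A m i ** sig i ** transpose (A m i))"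
    by (intro always_eventually allI linear_normal fin)
  show "\<forall>\<^sub>F m in sequentially. norm (\<Sum>i\<in>J m. A m i ** sig i ** transpose (A m i)) \<le> (csig * C) * (1 / sqrt (real m)) ^ (2 * 1)"
    using A
  proof eventually_elim
    case (elim m)
    have "norm (\<Sum>i\<in>J m. A m i ** sig i ** transpose (A m i)) \<le> (\<Sum>i\<in>J m. norm (A m i) * csig * norm (A m i))"
      by (intro order_trans[OF norm_sum] sum_mono norm_matrix_mult_mono csig) (auto simp: norm_transpose)
    also have "\<dots> \<le> (\<Sum>i<m. norm (A m i) * csig * norm (A m i))"
      using J csig by (intro sum_mono2) auto
    also have "\<dots> = csig * (\<Sum>i<m. (norm (A m i))\<^sup>2)" by (simp add: sum_distrib_left power2_eq_square mult_ac)
    also have "\<dots> \<le> csig * (C / real m)" using elim csig by (intro mult_left_mono) auto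
    finally show ?case by (simp add: power_divide)
  qed
qed

section \<open>Expansion of the covariance estimators\<close>

definition ols_err :: "nat \<Rightarrow> 'a \<Rightarrow> real^'s" where
  "ols_err m w = (\<Sum>i<m. (matrix_inv (XtX X m) ** transpose (X i)) *v u i w)"

lemma ols_eq:
  assumes "invertible (XtX X m)"
  shows "ols X m (\<lambda>i. y i w) = \<beta> + ols_err m w"
proof -
  have "Xty X m (\<lambda>i. y i w) = XtX X m *v \<beta> + (\<Sum>i<m. transpose (X i) *v u i w)"
    by (simp add: Xty_sum XtX_sum y_def mv.add_right sum.distrib mv.sum_left matrix_vector_mul_assoc)
  then show ?thesis
    by (simp add: ols_def ols_err_def mv.add_right matrix_inv_mult assms mv.sum_right matrix_vector_mul_assoc)
qed

lemma ols_err_momO: "momO M 1 ols_err"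
proof -
  obtain c where c: "c > 0" "\<forall>\<^sub>F m in sequentially. (\<Sum>i<m. (norm (X i))\<^sup>2) \<le> c * real m"
    by (rule X_square_sum) blast
  obtain d where d: "d > 0"
    "\<forall>\<^sub>F m in sequentially. invertible (XtX X m) \<and> norm (matrix_inv (XtX X m)) \<le> d / real m"
    by (rule inverse_bounds) blast
  show ?thesis unfolding ols_err_def[abs_def]
  proof (rule linear_momO[where C="d\<^sup>2 * c"])
    show "\<forall>\<^sub>F m in sequentially. (\<Sum>i<m. (norm (matrix_inv (XtX X m) ** transpose (X i)))\<^sup>2) \<le> d\<^sup>2 * c / real m"
      using c(2) d(2) eventually_gt_at_top[of 0]
    proof eventually_elim
      case (elim m)
      have "(\<Sum>i<m. (norm (matrix_inv (XtX X m) ** transpose (X i)))\<^sup>2) \<le> (\<Sum>i<m. (d / real m * norm (X i))\<^sup>2)"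
        using elim by (intro sum_mono power_mono norm_matrix_mult_mono) (auto simp: norm_transpose)
      also have "\<dots> = (d / real m)\<^sup>2 * (\<Sum>i<m. (norm (X i))\<^sup>2)" by (simp only: power_mult_distrib sum_distrib_left)
      also have "\<dots> \<le> (d / real m)\<^sup>2 * (c * real m)" using elim by (intro mult_left_mono) auto
      also have "\<dots> = d\<^sup>2 * c / real m" using elim by (simp add: power2_eq_square)
      finally show ?case .
    qed
  qed auto
qed

text \<open>The coordinates of the least squares error are common to all summands and are taken out
  of the sum. What is left is a linear statistic of order m^(-1/2), and the error contributes
  another m^(-1/2); taking norms inside the sum would keep only one of them.\<close>

lemma cross_momO: "momO M 2 (\<lambda>m w. (1 / real m) *\<^sub>R (\<Sum>i<m. outer (X i *v ols_err m w) (u i w)))"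
proof (intro momO_vec)
  fix p q :: 'k
  \<comment> \<open>Scalar coefficients appear as multiples of \<open>mat 1\<close> to fit
    \<open>linear_momO\<close>.\<close>
  define V where "V c m w = (\<Sum>i<m. ((X i $ p $ c / real m) *\<^sub>R (mat 1 :: real^'k^'k)) *v u i w)" for c m w
  obtain C where C: "C > 0" "\<forall>\<^sub>F m in sequentially. (\<Sum>i<m. (norm (X i))\<^sup>2) \<le> C * real m"
    by (rule X_square_sum) blast
  have "momO M 1 (V c)" for c
    unfolding V_def[abs_def]
  proof (rule linear_momO[where C="(norm (mat 1 :: real^'k^'k))\<^sup>2 * C"])
    show "\<forall>\<^sub>F m in sequentially. (\<Sum>i<m. (norm ((X i $ p $ c / real m) *\<^sub>R (mat 1 :: real^'k^'k)))\<^sup>2) \<le> (norm (mat 1 :: real^'k^'k))\<^sup>2 * C / real m"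
      using C(2) eventually_gt_at_top[of 0]
    proof eventually_elim
      case (elim m)
      have "(\<Sum>i<m. (norm ((X i $ p $ c / real m) *\<^sub>R (mat 1 :: real^'k^'k)))\<^sup>2)
         = (norm (mat 1 :: real^'k^'k))\<^sup>2 / (real m)\<^sup>2 * (\<Sum>i<m. (X i $ p $ c)\<^sup>2)"
        by (simp add: power_mult_distrib power_divide sum_distrib_left sum_divide_distrib mult_ac)
      also have "\<dots> \<le> (norm (mat 1 :: real^'k^'k))\<^sup>2 / (real m)\<^sup>2 * (\<Sum>i<m. (norm (X i))\<^sup>2)"
      proof (intro mult_left_mono sum_mono)
        fix i
        have "\<bar>X i $ p $ c\<bar> \<le> norm (X i)"
          using component_le_norm_cart[of "X i $ p" c] Finite_Cartesian_Product.norm_nth_le[of "X i" p] by linarith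
        then show "(X i $ p $ c)\<^sup>2 \<le> (norm (X i))\<^sup>2" using power_mono[of "\<bar>X i $ p $ c\<bar>" _ 2] by simp
      qed simp
      also have "\<dots> \<le> (norm (mat 1 :: real^'k^'k))\<^sup>2 / (real m)\<^sup>2 * (C * real m)"
        using elim by (intro mult_left_mono) auto
      also have "\<dots> = (norm (mat 1 :: real^'k^'k))\<^sup>2 * C / real m" using elim by (simp add: power2_eq_square)
      finally show ?case .
    qed
  qed auto
  then have "momO M (1 + 1) (\<lambda>m w. \<Sum>c\<in>UNIV. ols_err m w $ c * V c m w $ q)"
    by (intro momO_sum momO_mult momO_nth ols_err_momO)
  moreover have "((1 / real m) *\<^sub>R (\<Sum>i<m. outer (X i *v ols_err m w) (u i w))) $ p $ q = (\<Sum>c\<in>UNIV. ols_err m w $ c * V c m w $ q)" for m w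
  proof -
    have V: "V c m w $ q = (\<Sum>i<m. X i $ p $ c / real m * u i w $ q)" for c
      by (simp add: V_def mv.scaleR_left)
    have "((1 / real m) *\<^sub>R (\<Sum>i<m. outer (X i *v ols_err m w) (u i w))) $ p $ q
       = (\<Sum>i<m. \<Sum>c\<in>UNIV. ols_err m w $ c * (X i $ p $ c / real m * u i w $ q))"
      by (simp add: matrix_vector_mult_def sum_distrib_left sum_distrib_right sum_divide_distrib mult_ac)
    also have "\<dots> = (\<Sum>c\<in>UNIV. \<Sum>i<m. ols_err m w $ c * (X i $ p $ c / real m * u i w $ q))" by (rule sum.swap)
    also have "\<dots> = (\<Sum>c\<in>UNIV. ols_err m w $ c * V c m w $ q)" by (simp add: V sum_distrib_left)
    finally show ?thesis .
  qed
  ultimately show "momO M 2 (\<lambda>m w. ((1 / real m) *\<^sub>R (\<Sum>i<m. outer (X i *v ols_err m w) (u i w))) $ p $ q)"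
    by (simp add: numeral_2_eq_2)
qed

text \<open>The sum is quadratic in the least squares error already, so norms may be taken inside it
  without loss of order.\<close>

lemma fitted_momO: "momO M 2 (\<lambda>m w. (1 / real m) *\<^sub>R (\<Sum>i<m. outer (X i *v ols_err m w) (X i *v ols_err m w)))"
proof -
  obtain C where C: "C > 0" "\<forall>\<^sub>F m in sequentially. (\<Sum>i<m. (norm (X i))\<^sup>2) \<le> C * real m"
    by (rule X_square_sum) blast
  have [measurable]: "ols_err m \<in> borel_measurable M" for m unfolding ols_err_def[abs_def] by measurable
  have sq: "momO M 2 (\<lambda>m w. norm (ols_err m w) * norm (ols_err m w))"
    using momO_mult_norm[OF ols_err_momO ols_err_momO] by (simp add: numeral_2_eq_2)
  show ?thesis
  proof (rule momO_scale_bound[OF sq, where c=C])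
    show "\<forall>\<^sub>F m in sequentially. \<forall>w\<in>space M. norm ((1 / real m) *\<^sub>R (\<Sum>i<m. outer (X i *v ols_err m w) (X i *v ols_err m w)))
       \<le> C * norm (norm (ols_err m w) * norm (ols_err m w))"
      using C(2) eventually_gt_at_top[of 0]
    proof eventually_elim
      case (elim m)
      show ?case
      proof
        fix w
        let ?b = "norm (ols_err m w)"
        have "norm (\<Sum>i<m. outer (X i *v ols_err m w) (X i *v ols_err m w)) \<le> (\<Sum>i<m. (norm (X i) * ?b) * (norm (X i) * ?b))"
          by (intro order_trans[OF norm_sum] sum_mono) (auto simp: norm_outer intro!: mult_mono norm_matrix_vector_le)
        also have "\<dots> = (\<Sum>i<m. (norm (X i))\<^sup>2) * (?b * ?b)" by (simp only: sum_distrib_right) (simp only: power2_eq_square mult_ac)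
        also have "\<dots> \<le> C * real m * (?b * ?b)" using elim by (intro mult_right_mono) auto
        finally show "norm ((1 / real m) *\<^sub>R (\<Sum>i<m. outer (X i *v ols_err m w) (X i *v ols_err m w))) \<le> C * norm (?b * ?b)"
          using elim by (simp add: field_simps)
      qed
    qed
  qed simp
qed

text \<open>The residuals are u_i - X_i b with b the least squares error. Expanding their squares
  gives Psi and \<open>Dev\<close>, and apart from these the single term of area a, two cross terms
  and one fitted term, each O(1/m).\<close>

lemma Psi0_expansion: "momO M 2 (\<lambda>m w. Psi0_hat X D m (\<lambda>i. y i w) - Psi - Dev m w)"
proof -
  obtain d where d: "d > 0"
    "\<forall>\<^sub>F m in sequentially. invertible (XtX X m) \<and> norm (matrix_inv (XtX X m)) \<le> d / real m"
    by (rule inverse_bounds) blast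
  let ?C1 = "\<lambda>m w. (1 / real m) *\<^sub>R (\<Sum>i<m. outer (X i *v ols_err m w) (u i w))"
  let ?E = "\<lambda>m w. (1 / real m) *\<^sub>R (\<Sum>i<m. outer (X i *v ols_err m w) (X i *v ols_err m w))"
  let ?U = "\<lambda>m w. (1 / real m) *\<^sub>R (outer (u a w) (u a w) - sig a)"
  have "momO M 0 (\<lambda>m w. outer (u a w) (u a w) - sig a)"
    using momO_outer[OF u_momO u_momO, of a a] by (intro momO_diff momO_const_0) simp
  from momO_cmult_inverse_nat[OF this] have U: "momO M 2 ?U" by simp
  have "momO M 2 (\<lambda>m w. ?U m w - ?C1 m w - transpose (?C1 m w) + ?E m w)"
    by (intro momO_add momO_diff U cross_momO fitted_momO momO_linear[OF _ bounded_linear_transpose])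
  then show ?thesis
  proof (rule momO_cong)
    show "\<forall>\<^sub>F m in sequentially. \<forall>w\<in>space M. ?U m w - ?C1 m w - transpose (?C1 m w) + ?E m w
        = Psi0_hat X D m (\<lambda>i. y i w) - Psi - Dev m w"
      using d(2) eventually_gt_at_top[of a]
    proof eventually_elim
      case (elim m)
      show ?case
      proof
        fix w
        let ?b = "ols_err m w"
        have res: "y i w - X i *v ols X m (\<lambda>i. y i w) = u i w - X i *v ?b" for i
          by (subst ols_eq) (use elim in \<open>auto simp: y_def mv.add_right\<close>)
        define T where "T i = outer (u i w) (u i w) - sig i" for i
        have sa: "(\<Sum>i<m. T i) = T a + (\<Sum>i\<in>{..<m} - {a}. T i)"
          using elim by (intro sum.remove) auto
        have "(\<Sum>i<m. outer (u i w - X i *v ?b) (u i w - X i *v ?b) - D i)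
          = (\<Sum>i<m. T i - outer (X i *v ?b) (u i w) - transpose (outer (X i *v ?b) (u i w))
             + outer (X i *v ?b) (X i *v ?b) + Psi)"
          by (intro sum.cong refl) (simp add: outer.diff_left outer.diff_right transpose_outer sig_def T_def)
        also have "\<dots> = T a + (\<Sum>i\<in>{..<m} - {a}. T i)
            - (\<Sum>i<m. outer (X i *v ?b) (u i w)) - transpose (\<Sum>i<m. outer (X i *v ?b) (u i w))
            + (\<Sum>i<m. outer (X i *v ?b) (X i *v ?b)) + real m *\<^sub>R Psi"
          unfolding sum.distrib sum_subtractf sa transpose_sum by (simp only: sum_constant_scaleR card_lessThan)
        finally have "Psi0_hat X D m (\<lambda>i. y i w) = ?U m w + Dev m w - ?C1 m w - transpose (?C1 m w) + ?E m w + Psi"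
          unfolding Psi0_hat_def res Dev_def T_def[symmetric] using elim
          by (simp add: scaleR_add_right scaleR_diff_right transpose_scalar)
        then show "?U m w - ?C1 m w - transpose (?C1 m w) + ?E m w = Psi0_hat X D m (\<lambda>i. y i w) - Psi - Dev m w"
          by simp
      qed
    qed
  qed
qed

lemma expansion_momO_0:
  assumes "momO M 2 (\<lambda>m w. P m w - Psi - Dev m w)"
  shows "momO M 1 (\<lambda>m w. P m w - Psi)" "momO M 0 P"
proof -
  have "momO M 1 (\<lambda>m w. (P m w - Psi - Dev m w) + Dev m w)"
    by (intro momO_add momO_mono[OF assms] Dev_momO) simp
  then show 1: "momO M 1 (\<lambda>m w. P m w - Psi)" by simp
  have "momO M 0 (\<lambda>m w. (P m w - Psi) + Psi)"
    by (intro momO_add momO_mono[OF 1] momO_const_0) simp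
  then show "momO M 0 P" by simp
qed

text \<open>Stated for an arbitrary measure N, because the estimators are also evaluated on the
  product space that separates u_a from the other areas.\<close>

lemma Psi_hat_measurable:
  assumes [measurable]: "\<And>i. Y i \<in> borel_measurable N"
  shows "(\<lambda>w. Psi0_hat X D m (\<lambda>i. Y i w)) \<in> borel_measurable N"
    "(\<lambda>w. Psi1_hat X D m (\<lambda>i. Y i w)) \<in> borel_measurable N"
proof -
  show [measurable]: "(\<lambda>w. Psi0_hat X D m (\<lambda>i. Y i w)) \<in> borel_measurable N"
    unfolding Psi0_hat_def ols_def Xty_sum by measurable
  show "(\<lambda>w. Psi1_hat X D m (\<lambda>i. Y i w)) \<in> borel_measurable N"
    unfolding Psi1_hat_def Bias0_def by measurable
qed

text \<open>The bias correction is at most 1/m times a linear function of the norm of the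
  preliminary estimator, all of whose moments are bounded. It disappears in the remainder, so one
  approximation serves both estimators.\<close>

lemma Psi1_expansion: "momO M 2 (\<lambda>m w. Psi1_hat X D m (\<lambda>i. y i w) - Psi - Dev m w)"
proof -
  let ?P = "\<lambda>m w. Psi0_hat X D m (\<lambda>i. y i w)"
  obtain C where C: "C \<ge> 0" "\<forall>\<^sub>F m in sequentially. \<forall>B. norm (Bias0 X D m B) \<le> C * (1 / real m) * (norm B + CARD('k) * dhi)"
    by (rule Bias0_bound)
  have [measurable]: "?P m \<in> borel_measurable M" for m by (rule Psi_hat_measurable) measurable
  have "momO M 0 (\<lambda>m w. norm (?P m w) + CARD('k) * dhi)"
    by (intro momO_add momO_norm expansion_momO_0(2)[OF Psi0_expansion] momO_const_0)
  then have "momO M 2 (\<lambda>m w. (1 / real m) *\<^sub>R (norm (?P m w) + CARD('k) * dhi))"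
    using momO_cmult_inverse_nat by fastforce
  then have "momO M 2 (\<lambda>m w. Bias0 X D m (?P m w))"
  proof (rule momO_scale_bound[where c=C])
    show "\<forall>\<^sub>F m in sequentially. (\<lambda>w. Bias0 X D m (?P m w)) \<in> borel_measurable M"
      unfolding Bias0_def by (intro always_eventually allI) measurable
    show "\<forall>\<^sub>F m in sequentially. \<forall>w\<in>space M. norm (Bias0 X D m (?P m w)) \<le> C * norm ((1 / real m) *\<^sub>R (norm (?P m w) + CARD('k) * dhi))"
      using C(2)
    proof eventually_elim
      case (elim m)
      have "0 \<le> norm (?P m w) + CARD('k) * dhi" for w using d_pos by simp
      then show ?case using elim by (simp add: mult.assoc)
    qed
  qed
  from momO_diff[OF Psi0_expansion this] show ?thesis
    by (simp add: Psi1_hat_def algebra_simps)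
qed

text \<open>The modification costs a multiple of |P - Psi|^2, a product of two factors of order
  m^(-1/2).\<close>

lemma psd_part_expansion:
  assumes P: "momO M 2 (\<lambda>m w. P m w - Psi - Dev m w)"
    and sym: "\<forall>\<^sub>F m in sequentially. \<forall>w\<in>space M. transpose (P m w) = P m w"
  shows "momO M 2 (\<lambda>m w. psd_part (P m w) - Psi - Dev m w)"
proof -
  obtain c where c: "c > 0" "\<And>x. c * (x \<bullet> x) \<le> x \<bullet> (Psi *v x)"
    by (rule pos_def_coercive[OF Psi_pos]) blast
  have sq: "momO M 2 (\<lambda>m w. norm (P m w - Psi) * norm (P m w - Psi))"
    using momO_mult_norm[OF expansion_momO_0(1)[OF P] expansion_momO_0(1)[OF P]] by (simp add: numeral_2_eq_2)
  have "momO M 2 (\<lambda>m w. psd_part (P m w) - P m w)"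
  proof (rule momO_scale_bound[OF sq, where c="2/c"])
    show "\<forall>\<^sub>F m in sequentially. (\<lambda>w. psd_part (P m w) - P m w) \<in> borel_measurable M"
      using momO_measurable[OF expansion_momO_0(2)[OF P]] by eventually_elim measurable
    show "\<forall>\<^sub>F m in sequentially. \<forall>w\<in>space M. norm (psd_part (P m w) - P m w) \<le> 2 / c * norm (norm (P m w - Psi) * norm (P m w - Psi))"
      using sym
    proof eventually_elim
      case (elim m)
      show ?case
      proof
        fix w assume "w \<in> space M"
        then show "norm (psd_part (P m w) - P m w) \<le> 2 / c * norm (norm (P m w - Psi) * norm (P m w - Psi))"
          using psd_part_second_order[OF _ Psi_psd c, of "P m w"] elim by (simp add: power2_eq_square)
      qed
    qed
  qed
  from momO_add[OF this P] show ?thesis by (simp add: algebra_simps)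
qed

lemma estimator_expansion:
  assumes est: "Psi_hat = Psi0_hat X D \<or> Psi_hat = Psi1_hat X D"
  shows "momO M 2 (\<lambda>m w. psd_part (Psi_hat m (\<lambda>i. y i w)) - Psi - Dev m w)"
    "\<forall>\<^sub>F m in sequentially. \<forall>w. psd (psd_part (Psi_hat m (\<lambda>i. y i w)))"
proof -
  obtain d where d: "d > 0"
    "\<forall>\<^sub>F m in sequentially. invertible (XtX X m) \<and> norm (matrix_inv (XtX X m)) \<le> d / real m"
    by (rule inverse_bounds) blast
  have sym: "\<forall>\<^sub>F m in sequentially. \<forall>w. transpose (Psi_hat m (\<lambda>i. y i w)) = Psi_hat m (\<lambda>i. y i w)"
    using d(2) by eventually_elim (use est Psi0_sym Psi1_sym in auto)
  have P: "momO M 2 (\<lambda>m w. Psi_hat m (\<lambda>i. y i w) - Psi - Dev m w)"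
    using est Psi0_expansion Psi1_expansion by auto
  show "momO M 2 (\<lambda>m w. psd_part (Psi_hat m (\<lambda>i. y i w)) - Psi - Dev m w)"
    by (rule psd_part_expansion[OF P]) (use sym in \<open>eventually_elim, simp\<close>)
  show "\<forall>\<^sub>F m in sequentially. \<forall>w. psd (psd_part (Psi_hat m (\<lambda>i. y i w)))"
    using sym by eventually_elim (simp add: psd_psd_part)
qed

section \<open>Expansion of the generalized least squares error\<close>

definition gls_err :: "nat \<Rightarrow> real^'k^'k \<Rightarrow> 'a \<Rightarrow> real^'s" where
  "gls_err m B w = matrix_inv (S m B) *v (\<Sum>i<m. transpose (X i) *v (matrix_inv (B + D i) *v u i w))"

definition weight :: "nat \<Rightarrow> nat \<Rightarrow> real^'k^'s" where
  "weight m i = matrix_inv (S m Psi) ** transpose (X i) ** isig i"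

definition gls_lead :: "nat \<Rightarrow> 'a \<Rightarrow> real^'s" where
  "gls_lead m w = (\<Sum>i\<in>{..<m} - {a}. weight m i *v u i w)"

lemma gls_eq:
  assumes "invertible (S m B)"
  shows "gls X D m B (\<lambda>i. y i w) = \<beta> + gls_err m B w"
proof -
  have "(\<Sum>i<m. (transpose (X i) ** matrix_inv (B + D i)) *v y i w)
     = S m B *v \<beta> + (\<Sum>i<m. transpose (X i) *v (matrix_inv (B + D i) *v u i w))"
    by (simp add: S_def y_def mv.add_right sum.distrib mv.sum_left matrix_vector_mul_assoc)
  then show ?thesis
    by (simp add: gls_def S_def[symmetric] gls_err_def mv.add_right matrix_vector_mul_assoc matrix_inv_mult assms)
qed

lemma gls_err_Psi: "gls_err m Psi w = (\<Sum>i<m. weight m i *v u i w)"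
  by (simp add: gls_err_def mv.sum_right matrix_vector_mul_assoc matrix_mul_assoc weight_def isig_def sig_def)

lemma gls_weight_bound:
  obtains C where "C > 0" "\<forall>\<^sub>F m in sequentially. \<forall>i. norm (weight m i) \<le> C / real m * norm (X i)"
    "\<forall>\<^sub>F m in sequentially. (\<Sum>i<m. (norm (weight m i))\<^sup>2) \<le> C / real m"
proof -
  obtain c where c: "c > 0" "\<forall>\<^sub>F m in sequentially. (\<Sum>i<m. (norm (X i))\<^sup>2) \<le> c * real m"
    by (rule X_square_sum) blast
  obtain d where d: "d > 0"
    "\<forall>\<^sub>F m in sequentially. \<forall>B. psd B \<longrightarrow> invertible (S m B) \<and> norm (matrix_inv (S m B)) \<le> d * (norm B + dhi) / real m"
    by (rule inverse_bounds) blast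
  define e where "e = d * (norm Psi + dhi) * (CARD('k) / dlo)"
  have e: "e > 0" unfolding e_def using d d_pos by (intro mult_pos_pos add_nonneg_pos) auto
  have 1: "\<forall>\<^sub>F m in sequentially. \<forall>i. norm (weight m i) \<le> e / real m * norm (X i)"
    using d(2)
  proof eventually_elim
    case (elim m)
    show ?case
    proof
      fix i
      have "norm (weight m i) \<le> d * (norm Psi + dhi) / real m * norm (X i) * (CARD('k) / dlo)"
        using elim Psi_psd unfolding weight_def by (intro norm_matrix_mult_mono sig_facts) (auto simp: norm_transpose)
      then show "norm (weight m i) \<le> e / real m * norm (X i)"
        by (simp add: e_def mult_ac)
    qed
  qed
  have 2: "\<forall>\<^sub>F m in sequentially. (\<Sum>i<m. (norm (weight m i))\<^sup>2) \<le> e\<^sup>2 * c / real m"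
    using 1 c(2) eventually_gt_at_top[of 0]
  proof eventually_elim
    case (elim m)
    have "(\<Sum>i<m. (norm (weight m i))\<^sup>2) \<le> (\<Sum>i<m. (e / real m * norm (X i))\<^sup>2)"
      using elim by (intro sum_mono power_mono) auto
    also have "\<dots> = (e / real m)\<^sup>2 * (\<Sum>i<m. (norm (X i))\<^sup>2)" by (simp only: power_mult_distrib sum_distrib_left)
    also have "\<dots> \<le> (e / real m)\<^sup>2 * (c * real m)" using elim by (intro mult_left_mono) auto
    also have "\<dots> = e\<^sup>2 * c / real m" using elim by (simp add: power2_eq_square)
    finally show ?case .
  qed
  show ?thesis
  proof (rule that[of "max e (e\<^sup>2 * c)"])
    show "\<forall>\<^sub>F m in sequentially. \<forall>i. norm (weight m i) \<le> max e (e\<^sup>2 * c) / real m * norm (X i)"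
      using 1
    proof eventually_elim
      case (elim m)
      have "e / real m * norm (X i) \<le> max e (e\<^sup>2 * c) / real m * norm (X i)" for i
        by (intro mult_right_mono divide_right_mono) auto
      then show ?case using elim order_trans by blast
    qed
    show "\<forall>\<^sub>F m in sequentially. (\<Sum>i<m. (norm (weight m i))\<^sup>2) \<le> max e (e\<^sup>2 * c) / real m"
      using 2
    proof eventually_elim
      case (elim m)
      have "e\<^sup>2 * c / real m \<le> max e (e\<^sup>2 * c) / real m" by (intro divide_right_mono) auto
      then show ?case using elim by linarith
    qed
  qed (use e in simp)
qed

lemma gls_err_Psi_momO: "momO M 1 (\<lambda>m. gls_err m Psi)"
  and gls_lead_momO: "momO M 1 gls_lead"
proof -
  obtain C where C: "\<forall>\<^sub>F m in sequentially. (\<Sum>i<m. (norm (weight m i))\<^sup>2) \<le> C / real m"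
    by (rule gls_weight_bound)
  show "momO M 1 (\<lambda>m. gls_err m Psi)" unfolding gls_err_Psi[abs_def] by (rule linear_momO[OF C]) auto
  show "momO M 1 gls_lead" unfolding gls_lead_def[abs_def] by (rule linear_momO[OF C]) auto
qed

text \<open>The difference is the single summand of area a, whose weight is O(1/m) because X_a is
  fixed.\<close>

lemma gls_err_Psi_lead: "momO M 2 (\<lambda>m w. gls_err m Psi w - gls_lead m w)"
proof -
  obtain C where C: "C > 0" "\<forall>\<^sub>F m in sequentially. \<forall>i. norm (weight m i) \<le> C / real m * norm (X i)"
    by (rule gls_weight_bound)
  have c: "momO M 2 (\<lambda>m w. weight m a)"
  proof (rule momO_const[where C="C * norm (X a)"])
    show "\<forall>\<^sub>F m in sequentially. norm (weight m a) \<le> C * norm (X a) * (1 / sqrt (real m)) ^ 2"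
      using C(2) by eventually_elim (simp add: power_divide mult_ac)
  qed
  have "momO M 2 (\<lambda>m w. weight m a *v u a w)"
    using momO_mv[OF c u_momO] by simp
  then show ?thesis
  proof (rule momO_cong)
    show "\<forall>\<^sub>F m in sequentially. \<forall>w\<in>space M. weight m a *v u a w = gls_err m Psi w - gls_lead m w"
      using eventually_gt_at_top[of a]
    proof eventually_elim
      case (elim m)
      then show ?case unfolding gls_err_Psi gls_lead_def by (subst sum.remove[of "{..<m}" a]) auto
    qed
  qed
qed

text \<open>The resolvent identity, once and iterated. In the second form the random inverse occurs
  only in the term quadratic in B - Psi; the linear term involves the fixed \<open>isig i\<close>,
  which makes it accessible as a linear statistic of the u_i.\<close>

lemma resolvent:
  assumes "psd B"
  shows "matrix_inv (B + D i) = isig i - matrix_inv (B + D i) ** (B - Psi) ** isig i"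
    "matrix_inv (B + D i) = isig i - isig i ** (B - Psi) ** isig i
       + matrix_inv (B + D i) ** (B - Psi) ** isig i ** (B - Psi) ** isig i"
proof -
  let ?H = "matrix_inv (B + D i)"
  have "?H ** (B - Psi) ** isig i = ?H ** ((B + D i) - sig i) ** isig i" by (simp add: sig_def)
  also have "\<dots> = ?H ** (B + D i) ** isig i - ?H ** (sig i ** isig i)"
    by (simp only: mm.diff_left mm.diff_right matrix_mul_assoc)
  also have "\<dots> = isig i - ?H" by (simp add: sig_isig matrix_inv_mult plus_D assms)
  finally show 1: "?H = isig i - ?H ** (B - Psi) ** isig i" by simp
  have "?H ** (B - Psi) ** isig i = (isig i - ?H ** (B - Psi) ** isig i) ** (B - Psi) ** isig i"
    using 1 by simp
  also have "\<dots> = isig i ** (B - Psi) ** isig i - ?H ** (B - Psi) ** isig i ** (B - Psi) ** isig i"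
    by (simp only: mm.diff_left)
  finally have "isig i - ?H ** (B - Psi) ** isig i
    = isig i - (isig i ** (B - Psi) ** isig i - ?H ** (B - Psi) ** isig i ** (B - Psi) ** isig i)"
    by (rule arg_cong)
  also have "\<dots> = isig i - isig i ** (B - Psi) ** isig i + ?H ** (B - Psi) ** isig i ** (B - Psi) ** isig i"
    by simp
  finally show "?H = isig i - isig i ** (B - Psi) ** isig i + ?H ** (B - Psi) ** isig i ** (B - Psi) ** isig i"
    by (rule trans[OF 1])
qed

text \<open>Subtracting b turns the data into residuals u_i - X_i b, to which the expansion of the
  weights is applied. The three terms left are of different kinds: the first needs cancellation
  among the u_i, the second is small through both E and b, the third is quadratic in E.\<close>

lemma gls_err_diff:
  fixes w :: 'a
  assumes B: "psd B" and inv: "invertible (S m B)" "invertible (S m Psi)"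
  defines "H \<equiv> \<lambda>i. matrix_inv (B + D i)" and "E \<equiv> B - Psi" and "b \<equiv> gls_err m Psi w"
  shows "gls_err m B w - b = matrix_inv (S m B) *v
    (- (\<Sum>i<m. (transpose (X i) ** isig i ** E ** isig i) *v u i w)
     + (\<Sum>i<m. (transpose (X i) ** isig i ** E ** isig i ** X i) *v b)
     + (\<Sum>i<m. (transpose (X i) ** H i ** E ** isig i ** E ** isig i) *v (u i w - X i *v b)))"
proof -
  have "S m Psi *v b = (\<Sum>i<m. transpose (X i) *v (isig i *v u i w))"
    by (simp add: b_def gls_err_def matrix_inv_vector inv isig_def sig_def)
  \<comment> \<open>The normal equations for b at the true Psi; they remove the term of order zero
    in E.\<close>
  then have z: "(\<Sum>i<m. (transpose (X i) ** isig i) *v (u i w - X i *v b)) = 0"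
    by (simp add: S_def mv.diff_right sum_subtractf mv.sum_left matrix_vector_mul_assoc isig_def sig_def)
  have "gls_err m B w - b = matrix_inv (S m B) *v ((\<Sum>i<m. (transpose (X i) ** H i) *v u i w) - S m B *v b)"
    by (simp add: gls_err_def H_def mv.diff_right matrix_inv_mult inv matrix_vector_mul_assoc)
  also have "(\<Sum>i<m. (transpose (X i) ** H i) *v u i w) - S m B *v b = (\<Sum>i<m. (transpose (X i) ** H i) *v (u i w - X i *v b))"
    by (simp add: S_def H_def mv.diff_right sum_subtractf mv.sum_left matrix_vector_mul_assoc)
  also have "\<dots> = (\<Sum>i<m. (transpose (X i) ** isig i) *v (u i w - X i *v b)
      - (transpose (X i) ** isig i ** E ** isig i) *v u i w
      + (transpose (X i) ** isig i ** E ** isig i ** X i) *v b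
      + (transpose (X i) ** H i ** E ** isig i ** E ** isig i) *v (u i w - X i *v b))"
  proof (intro sum.cong refl)
    fix i
    have H: "H i = isig i - isig i ** E ** isig i + H i ** E ** isig i ** E ** isig i"
      unfolding H_def E_def by (rule resolvent(2)[OF B])
    have "transpose (X i) ** H i = transpose (X i) ** isig i - transpose (X i) ** isig i ** E ** isig i
       + transpose (X i) ** H i ** E ** isig i ** E ** isig i"
      by (subst H) (simp only: mm.add_right mm.diff_right matrix_mul_assoc)
    then have "(transpose (X i) ** H i) *v z = (transpose (X i) ** isig i - transpose (X i) ** isig i ** E ** isig i
       + transpose (X i) ** H i ** E ** isig i ** E ** isig i) *v z" for z
      by (rule arg_cong)
    also have "\<dots> z = (transpose (X i) ** isig i) *v z - (transpose (X i) ** isig i ** E ** isig i) *v z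
       + (transpose (X i) ** H i ** E ** isig i ** E ** isig i) *v z" for z
      by (simp only: mv.add_left mv.diff_left)
    finally have 1: "(transpose (X i) ** H i) *v z = (transpose (X i) ** isig i) *v z - (transpose (X i) ** isig i ** E ** isig i) *v z
       + (transpose (X i) ** H i ** E ** isig i ** E ** isig i) *v z" for z .
    have 2: "(transpose (X i) ** isig i ** E ** isig i) *v (u i w - X i *v b)
       = (transpose (X i) ** isig i ** E ** isig i) *v u i w - (transpose (X i) ** isig i ** E ** isig i ** X i) *v b"
      by (simp only: mv.diff_right matrix_vector_mul_assoc)
    show "(transpose (X i) ** H i) *v (u i w - X i *v b) = (transpose (X i) ** isig i) *v (u i w - X i *v b)
      - (transpose (X i) ** isig i ** E ** isig i) *v u i w
      + (transpose (X i) ** isig i ** E ** isig i ** X i) *v b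
      + (transpose (X i) ** H i ** E ** isig i ** E ** isig i) *v (u i w - X i *v b)"
      using 1[of "u i w - X i *v b"] unfolding 2 by simp
  qed
  finally show ?thesis by (simp add: sum.distrib sum_subtractf z)
qed

definition unit_mat :: "'k \<Rightarrow> 'k \<Rightarrow> real^'k^'k" where "unit_mat p q = outer (axis p 1) (axis q 1)"

lemma matrix_unit_expansion: "B = (\<Sum>p\<in>UNIV. \<Sum>q\<in>UNIV. B $ p $ q *\<^sub>R unit_mat p q)"
proof -
  have "B $ p $ q * unit_mat p q $ i $ j = (if p = i then if q = j then B $ p $ q else 0 else 0)" for p q i j
    by (simp add: unit_mat_def axis_def)
  then have "(\<Sum>p\<in>UNIV. \<Sum>q\<in>UNIV. B $ p $ q *\<^sub>R unit_mat p q) $ i $ j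
      = (\<Sum>p\<in>UNIV. \<Sum>q\<in>UNIV. if p = i then if q = j then B $ p $ q else 0 else 0)" for i j
    by simp
  also have "\<dots> i j = (\<Sum>p\<in>UNIV. if p = i then \<Sum>q\<in>UNIV. if q = j then B $ p $ q else 0 else 0)" for i j
    by (intro sum.cong refl) auto
  finally show ?thesis by (simp add: vec_eq_iff)
qed

text \<open>Expanding the random matrix in matrix units separates it from the linear statistic, which is
  then small by itself. This is what a crude norm bound would lose.\<close>

definition unit_score :: "'k \<Rightarrow> 'k \<Rightarrow> nat \<Rightarrow> 'a \<Rightarrow> real^'s" where
  "unit_score p q m w = (\<Sum>i<m. ((1 / real m) *\<^sub>R (transpose (X i) ** isig i ** unit_mat p q ** isig i)) *v u i w)"

lemma unit_score_momO: "momO M 1 (unit_score p q)"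
proof -
  obtain c where c: "c > 0" "\<forall>\<^sub>F m in sequentially. (\<Sum>i<m. (norm (X i))\<^sup>2) \<le> c * real m"
    by (rule X_square_sum) blast
  define e where "e = (CARD('k) / dlo) * norm (unit_mat p q) * (CARD('k) / dlo)"
  show ?thesis unfolding unit_score_def[abs_def]
  proof (rule linear_momO[where C="e\<^sup>2 * c"])
    show "\<forall>\<^sub>F m in sequentially. (\<Sum>i<m. (norm ((1 / real m) *\<^sub>R (transpose (X i) ** isig i ** unit_mat p q ** isig i)))\<^sup>2) \<le> e\<^sup>2 * c / real m"
      using c(2) eventually_gt_at_top[of 0]
    proof eventually_elim
      case (elim m)
      have "norm ((1 / real m) *\<^sub>R (transpose (X i) ** isig i ** unit_mat p q ** isig i)) \<le> e / real m * norm (X i)" for i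
      proof -
        have "norm (transpose (X i) ** isig i ** unit_mat p q ** isig i)
          \<le> norm (X i) * (CARD('k) / dlo) * norm (unit_mat p q) * (CARD('k) / dlo)"
          by (intro norm_matrix_mult_mono sig_facts) (auto simp: norm_transpose)
        then have "norm (transpose (X i) ** isig i ** unit_mat p q ** isig i) \<le> e * norm (X i)"
          by (simp add: e_def mult_ac)
        then show ?thesis by (simp add: divide_right_mono)
      qed
      then have "(\<Sum>i<m. (norm ((1 / real m) *\<^sub>R (transpose (X i) ** isig i ** unit_mat p q ** isig i)))\<^sup>2) \<le> (\<Sum>i<m. (e / real m * norm (X i))\<^sup>2)"
        by (intro sum_mono power_mono) auto
      also have "\<dots> = (e / real m)\<^sup>2 * (\<Sum>i<m. (norm (X i))\<^sup>2)" by (simp only: power_mult_distrib sum_distrib_left)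
      also have "\<dots> \<le> (e / real m)\<^sup>2 * (c * real m)" using elim by (intro mult_left_mono) auto
      also have "\<dots> = e\<^sup>2 * c / real m" using elim by (simp add: power2_eq_square)
      finally show ?case .
    qed
  qed auto
qed

lemma score_expansion:
  assumes "m > 0"
  shows "(\<Sum>i<m. (transpose (X i) ** isig i ** E ** isig i) *v u i w)
    = real m *\<^sub>R (\<Sum>p\<in>UNIV. \<Sum>q\<in>UNIV. E $ p $ q *\<^sub>R unit_score p q m w)"
proof -
  let ?L = "\<lambda>F. \<Sum>i<m. (transpose (X i) ** isig i ** F ** isig i) *v u i w"
  have lin: "?L (\<Sum>p\<in>UNIV. \<Sum>q\<in>UNIV. E $ p $ q *\<^sub>R unit_mat p q) = (\<Sum>p\<in>UNIV. \<Sum>q\<in>UNIV. E $ p $ q *\<^sub>R ?L (unit_mat p q))"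
  proof -
    have "?L (\<Sum>p\<in>UNIV. \<Sum>q\<in>UNIV. E $ p $ q *\<^sub>R unit_mat p q)
       = (\<Sum>i<m. \<Sum>p\<in>UNIV. \<Sum>q\<in>UNIV. E $ p $ q *\<^sub>R ((transpose (X i) ** isig i ** unit_mat p q ** isig i) *v u i w))"
      by (simp add: mm.sum_right mm.sum_left mv.sum_left mm.scaleR_right mm.scaleR_left mv.scaleR_left)
    also have "\<dots> = (\<Sum>p\<in>UNIV. \<Sum>i<m. \<Sum>q\<in>UNIV. E $ p $ q *\<^sub>R ((transpose (X i) ** isig i ** unit_mat p q ** isig i) *v u i w))"
      by (rule sum.swap)
    also have "\<dots> = (\<Sum>p\<in>UNIV. \<Sum>q\<in>UNIV. \<Sum>i<m. E $ p $ q *\<^sub>R ((transpose (X i) ** isig i ** unit_mat p q ** isig i) *v u i w))"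
      by (intro sum.cong refl sum.swap)
    finally show ?thesis by (simp add: scaleR_sum_right)
  qed
  have "?L (unit_mat p q) = real m *\<^sub>R unit_score p q m w" for p q
    using assms by (simp add: unit_score_def mv.scaleR_left scaleR_sum_right)
  then show ?thesis
    using lin matrix_unit_expansion[of E, symmetric] by (simp add: scaleR_sum_right mult.commute)
qed

text \<open>What the expansion of the predictor uses about the modified estimator, whichever of the
  two it is. Semidefiniteness makes the bounds on the inverses available.\<close>

definition near :: "(nat \<Rightarrow> 'a \<Rightarrow> real^'k^'k) \<Rightarrow> bool" where
  "near P \<longleftrightarrow> momO M 2 (\<lambda>m w. P m w - Psi - Dev m w) \<and> (\<forall>\<^sub>F m in sequentially. \<forall>w. psd (P m w))"

text \<open>\<open>f2\<close>, \<open>f3\<close> and \<open>f4\<close> bound the three terms of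
  \<open>gls_err_diff\<close> divided by m, up to constants. The inverse of \<open>S m B\<close>
  supplies the 1/m together with the factor |B| + \<open>dhi\<close>. Each of them is a product of
  two factors of order m^(-1/2), apart from factors with bounded moments.\<close>

lemma gls_err_near:
  assumes P: "near P"
  shows "momO M 2 (\<lambda>m w. gls_err m (P m w) w - gls_err m Psi w)"
proof -
  have P2: "momO M 2 (\<lambda>m w. P m w - Psi - Dev m w)" and psd: "\<forall>\<^sub>F m in sequentially. \<forall>w. psd (P m w)"
    using P by (auto simp: near_def)
  have E: "momO M 1 (\<lambda>m w. P m w - Psi)" and P0: "momO M 0 P" by (rule expansion_momO_0[OF P2])+
  obtain c where c: "c > 0" "\<forall>\<^sub>F m in sequentially. (\<Sum>i<m. (norm (X i))\<^sup>2) \<le> c * real m"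
    by (rule X_square_sum) blast
  obtain d where d: "d > 0"
    "\<forall>\<^sub>F m in sequentially. \<forall>B. psd B \<longrightarrow> invertible (S m B) \<and> norm (matrix_inv (S m B)) \<le> d * (norm B + dhi) / real m"
    by (rule inverse_bounds) blast
  define k where "k = CARD('k) / dlo"
  have k: "k > 0" using d_pos by (simp add: k_def)
  define f2 where "f2 m w = (\<Sum>p\<in>UNIV. \<Sum>q\<in>UNIV. norm ((P m w - Psi) $ p $ q) * norm (unit_score p q m w))" for m w
  define f3 where "f3 m w = norm (P m w - Psi) * norm (gls_err m Psi w)" for m w
  define f4 where "f4 m w = norm (P m w - Psi) * norm (P m w - Psi) * (c + (\<Sum>i<m. (norm (u i w))\<^sup>2) / real m + c * norm (gls_err m Psi w))" for m w
  define F where "F m w = (norm (P m w) + dhi) * (f2 m w + k\<^sup>2 * c * f3 m w + k ^ 3 * f4 m w)" for m w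
  have two: "(2::nat) = 1 + 1" "(2::nat) = 2 + 0" "(2::nat) = 0 + 2" by simp_all
  have f2: "momO M 2 f2" unfolding f2_def[abs_def] two(1)
    by (intro momO_sum momO_mult_norm momO_nth E unit_score_momO)
  have f3: "momO M 2 f3" unfolding f3_def[abs_def] two(1)
    by (intro momO_mult_norm E gls_err_Psi_momO)
  have f4: "momO M (2 + 0) f4" unfolding f4_def[abs_def]
    using momO_mult_norm[OF E E] momO_mono[OF gls_err_Psi_momO, of 0]
    by (intro momO_mult momO_add momO_const_0 mean_square_momO momO_cmult momO_norm) (simp_all add: numeral_2_eq_2)
  have "momO M (0 + 2) F" unfolding F_def[abs_def]
    using f4 by (intro momO_mult momO_add momO_norm P0 momO_const_0 f2 f3 momO_cmult) simp
  then have F: "momO M 2 F" by (simp add: numeral_2_eq_2)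
  show ?thesis
  proof (rule momO_scale_bound[OF F, where c=d])
    show "\<forall>\<^sub>F m in sequentially. (\<lambda>w. gls_err m (P m w) w - gls_err m Psi w) \<in> borel_measurable M"
      using momO_measurable[OF P0]
    proof eventually_elim
      case (elim m)
      then have [measurable]: "P m \<in> borel_measurable M" .
      show ?case unfolding gls_err_def S_def by measurable
    qed
    show "\<forall>\<^sub>F m in sequentially. \<forall>w\<in>space M. norm (gls_err m (P m w) w - gls_err m Psi w) \<le> d * norm (F m w)"
      using psd c(2) d(2) eventually_gt_at_top[of 0]
    proof eventually_elim
      case (elim m)
      show ?case
      proof
        fix w
        let ?B = "P m w" and ?b = "gls_err m Psi w"
        let ?E = "?B - Psi"
        let ?H = "\<lambda>i. matrix_inv (?B + D i)"
        have B: "psd ?B" using elim by blast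
        have H: "norm (?H i) \<le> k" for i unfolding k_def by (rule plus_D[OF B])
        have I: "norm (isig i) \<le> k" for i unfolding k_def by (rule sig_facts)
        have m: "real m > 0" using elim by simp
        let ?N1 = "\<Sum>i<m. (transpose (X i) ** isig i ** ?E ** isig i) *v u i w"
        let ?N2 = "\<Sum>i<m. (transpose (X i) ** isig i ** ?E ** isig i ** X i) *v ?b"
        let ?N3 = "\<Sum>i<m. (transpose (X i) ** ?H i ** ?E ** isig i ** ?E ** isig i) *v (u i w - X i *v ?b)"
        have "norm ?N1 = real m * norm (\<Sum>p\<in>UNIV. \<Sum>q\<in>UNIV. ?E $ p $ q *\<^sub>R unit_score p q m w)"
          using elim by (simp add: score_expansion)
        also have "\<dots> \<le> real m * f2 m w"
          unfolding f2_def by (intro mult_left_mono order_trans[OF norm_sum] sum_mono) auto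
        finally have N1: "norm ?N1 \<le> real m * f2 m w" .
        have "norm ?N2 \<le> (\<Sum>i<m. norm (X i) * k * norm ?E * k * norm (X i) * norm ?b)"
          by (intro order_trans[OF norm_sum] sum_mono norm_matrix_vector_mono norm_matrix_mult_mono I) (auto simp: norm_transpose)
        also have "\<dots> = (k\<^sup>2 * f3 m w) * (\<Sum>i<m. (norm (X i))\<^sup>2)"
          unfolding f3_def sum_distrib_left by (simp only: power2_eq_square mult_ac)
        also have "\<dots> \<le> (k\<^sup>2 * f3 m w) * (c * real m)"
          using elim unfolding f3_def by (intro mult_left_mono) auto
        finally have N2: "norm ?N2 \<le> real m * (k\<^sup>2 * c * f3 m w)" by (simp add: mult_ac)
        have uX: "norm (u i w - X i *v ?b) \<le> norm (u i w) + norm (X i) * norm ?b" for i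
          using norm_triangle_ineq4[of "u i w" "X i *v ?b"] norm_matrix_vector_le[of "X i" ?b] by linarith
        have "norm ?N3 \<le> (\<Sum>i<m. norm (X i) * k * norm ?E * k * norm ?E * k * (norm (u i w) + norm (X i) * norm ?b))"
          by (intro order_trans[OF norm_sum] sum_mono norm_matrix_vector_mono norm_matrix_mult_mono I H uX)
            (auto simp: norm_transpose)
        also have "\<dots> = (k ^ 3 * (norm ?E * norm ?E)) * (\<Sum>i<m. norm (X i) * (norm (u i w) + norm (X i) * norm ?b))"
          unfolding sum_distrib_left by (simp only: power3_eq_cube mult_ac)
        also have "\<dots> \<le> (k ^ 3 * (norm ?E * norm ?E)) * (\<Sum>i<m. (norm (X i))\<^sup>2 + (norm (u i w))\<^sup>2 + (norm (X i))\<^sup>2 * norm ?b)"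
        proof (intro mult_left_mono sum_mono)
          fix i
          \<comment> \<open>Only averages of |X_i|^2 and |u_i|^2 are controlled, so the mixed
            product is split into squares.\<close>
          have "0 \<le> (norm (X i) - norm (u i w))\<^sup>2" by simp
          then have "2 * (norm (X i) * norm (u i w)) \<le> (norm (X i))\<^sup>2 + (norm (u i w))\<^sup>2"
            by (simp add: power2_diff)
          moreover have "0 \<le> norm (X i) * norm (u i w)" by simp
          ultimately have "norm (X i) * norm (u i w) \<le> (norm (X i))\<^sup>2 + (norm (u i w))\<^sup>2" by linarith
          then show "norm (X i) * (norm (u i w) + norm (X i) * norm ?b) \<le> (norm (X i))\<^sup>2 + (norm (u i w))\<^sup>2 + (norm (X i))\<^sup>2 * norm ?b"
            by (simp add: distrib_left power2_eq_square mult.assoc)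
        qed (use k in auto)
        also have "\<dots> \<le> (k ^ 3 * (norm ?E * norm ?E)) * (c * real m + (\<Sum>i<m. (norm (u i w))\<^sup>2) + c * real m * norm ?b)"
          unfolding sum.distrib sum_distrib_right[symmetric] using elim k
          by (intro mult_left_mono add_mono mult_right_mono) auto
        also have "\<dots> = real m * (k ^ 3 * f4 m w)"
          using m by (simp add: f4_def field_simps)
        finally have N3: "norm ?N3 \<le> real m * (k ^ 3 * f4 m w)" .
        have inv: "invertible (S m ?B)" "norm (matrix_inv (S m ?B)) \<le> d * (norm ?B + dhi) / real m" "invertible (S m Psi)"
          using elim B Psi_psd by auto
        have "norm (gls_err m ?B w - ?b) \<le> d * (norm ?B + dhi) / real m * (real m * f2 m w + real m * (k\<^sup>2 * c * f3 m w) + real m * (k ^ 3 * f4 m w))"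
          unfolding gls_err_diff[OF B inv(1,3)]
        proof (rule norm_matrix_vector_mono[OF inv(2)])
          have "norm (- ?N1 + ?N2 + ?N3) \<le> norm ?N1 + norm ?N2 + norm ?N3"
            using norm_triangle_ineq[of "- ?N1 + ?N2" ?N3] norm_triangle_ineq[of "- ?N1" ?N2] by simp
          then show "norm (- ?N1 + ?N2 + ?N3) \<le> real m * f2 m w + real m * (k\<^sup>2 * c * f3 m w) + real m * (k ^ 3 * f4 m w)"
            using N1 N2 N3 by linarith
        qed
        also have "\<dots> = d * F m w" using m by (simp add: F_def field_simps)
        also have "\<dots> \<le> d * norm (F m w)" using d by (intro mult_left_mono) auto
        finally show "norm (gls_err m ?B w - ?b) \<le> d * norm (F m w)" .
      qed
    qed
  qed
qed

section \<open>Expansion of the predictor\<close>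

definition K :: "real^'k^'k" where "K = D a ** isig a"

lemma K_transpose: "transpose K = isig a ** D a"
  by (simp add: K_def matrix_transpose_mul sig_facts D_sym)

text \<open>The predictor minus the Bayes predictor X_a \<beta> + u_a - K u_a, written as a function
  of B and the family u. This form is what the orthogonality to the Bayes error requires.\<close>

definition pred_shift :: "nat \<Rightarrow> real^'k^'k \<Rightarrow> (nat \<Rightarrow> real^'k) \<Rightarrow> real^'k" where
  "pred_shift m B U = theta_hat X D a m B (\<lambda>i. X i *v \<beta> + U i) - (X a *v \<beta> + U a) + K *v U a"

definition lead :: "nat \<Rightarrow> 'a \<Rightarrow> real^'k" where
  "lead m w = K *v (Dev m w *v (isig a *v u a w) + X a *v gls_lead m w)"

lemma lead_momO: "momO M 1 lead"
proof -
  have 1: "momO M (1 + (0 + 0)) (\<lambda>m w. Dev m w *v (isig a *v u a w))"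
    by (intro momO_mv Dev_momO momO_const_0 u_momO)
  have 2: "momO M (0 + 1) (\<lambda>m w. X a *v gls_lead m w)"
    by (intro momO_mv momO_const_0 gls_lead_momO)
  have "momO M (0 + 1) lead"
    unfolding lead_def[abs_def] by (intro momO_mv momO_const_0 momO_add) (use 1 2 in simp_all)
  then show ?thesis by simp
qed

text \<open>The inverse at P is expanded to second order where it meets u_a, which is of order one,
  but only to first order where it meets the least squares error, which is itself of order m^(-1/2).
  The remainders \<open>t1\<close> to \<open>t4\<close> come from the expansion of the estimator,
  from the second-order term, from the least squares error, and from the product of both
  errors.\<close>

lemma pred_shift_expansion:
  assumes P: "near P"
  shows "momO M 2 (\<lambda>m w. pred_shift m (P m w) (\<lambda>i. u i w) - lead m w)"
proof -
  have P2: "momO M 2 (\<lambda>m w. P m w - Psi - Dev m w)" and psd: "\<forall>\<^sub>F m in sequentially. \<forall>w. psd (P m w)"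
    using P by (auto simp: near_def)
  have E: "momO M 1 (\<lambda>m w. P m w - Psi)" and P0: "momO M 0 P" by (rule expansion_momO_0[OF P2])+
  obtain d where d: "d > 0"
    "\<forall>\<^sub>F m in sequentially. \<forall>B. psd B \<longrightarrow> invertible (S m B) \<and> norm (matrix_inv (S m B)) \<le> d * (norm B + dhi) / real m"
    by (rule inverse_bounds) blast
  let ?H = "\<lambda>m w. matrix_inv (P m w + D a)"
  have H: "momO M 0 ?H"
  proof (rule momO_dominated[OF momO_const_0])
    show "\<forall>\<^sub>F m in sequentially. ?H m \<in> borel_measurable M"
      using momO_measurable[OF P0] by eventually_elim measurable
    show "\<forall>\<^sub>F m in sequentially. \<forall>w\<in>space M. norm (?H m w) \<le> norm (CARD('k) / dlo)"
      using psd
    proof eventually_elim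
      case (elim m)
      have "norm (CARD('k) / dlo) = CARD('k) / dlo" using d_pos by simp
      then show ?case using elim plus_D(5) by auto
    qed
  qed
  have "momO M 2 (\<lambda>m w. (gls_err m (P m w) w - gls_err m Psi w) + (gls_err m Psi w - gls_lead m w))"
    by (intro momO_add gls_err_near[OF P] gls_err_Psi_lead)
  then have g: "momO M 2 (\<lambda>m w. gls_err m (P m w) w - gls_lead m w)" by simp
  have t1: "momO M (0 + (2 + (0 + 0))) (\<lambda>m w. K *v ((P m w - Psi - Dev m w) *v (isig a *v u a w)))"
    by (intro momO_mv momO_const_0 P2 u_momO)
  have t2: "momO M (0 + (0 + (1 + (0 + (1 + (0 + 0)))))) (\<lambda>m w. D a *v (?H m w *v ((P m w - Psi) *v (isig a *v ((P m w - Psi) *v (isig a *v u a w))))))"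
    by (intro momO_mv momO_const_0 H E u_momO)
  have t3: "momO M (0 + (0 + (0 + 2))) (\<lambda>m w. D a *v (?H m w *v (X a *v (gls_err m (P m w) w - gls_lead m w))))"
    by (intro momO_mv momO_const_0 H g)
  have t4: "momO M (0 + (0 + (1 + (0 + (0 + 1))))) (\<lambda>m w. D a *v (?H m w *v ((P m w - Psi) *v (isig a *v (X a *v gls_lead m w)))))"
    by (intro momO_mv momO_const_0 H E gls_lead_momO)
  have "momO M 2 (\<lambda>m w. K *v ((P m w - Psi - Dev m w) *v (isig a *v u a w))
     - D a *v (?H m w *v ((P m w - Psi) *v (isig a *v ((P m w - Psi) *v (isig a *v u a w)))))
     + D a *v (?H m w *v (X a *v (gls_err m (P m w) w - gls_lead m w)))
     - D a *v (?H m w *v ((P m w - Psi) *v (isig a *v (X a *v gls_lead m w)))))"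
    using t1 t2 t3 t4 by (intro momO_add momO_diff) (simp_all add: numeral_2_eq_2)
  then show ?thesis
  proof (rule momO_cong)
    show "\<forall>\<^sub>F m in sequentially. \<forall>w\<in>space M. K *v ((P m w - Psi - Dev m w) *v (isig a *v u a w))
     - D a *v (?H m w *v ((P m w - Psi) *v (isig a *v ((P m w - Psi) *v (isig a *v u a w)))))
     + D a *v (?H m w *v (X a *v (gls_err m (P m w) w - gls_lead m w)))
     - D a *v (?H m w *v ((P m w - Psi) *v (isig a *v (X a *v gls_lead m w))))
     = pred_shift m (P m w) (\<lambda>i. u i w) - lead m w"
      using psd d(2)
    proof eventually_elim
      case (elim m)
      show ?case
      proof
        fix w
        let ?B = "P m w" and ?g = "gls_err m (P m w) w" and ?l = "gls_lead m w"
        let ?Hw = "matrix_inv (?B + D a)" and ?E = "?B - Psi"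
        have B: "psd ?B" and inv: "invertible (S m ?B)" using elim by auto
        have th: "theta_hat X D a m ?B (\<lambda>i. X i *v \<beta> + u i w) = X a *v \<beta> + u a w - D a *v (?Hw *v (u a w - X a *v ?g))"
          using gls_eq[OF inv, of w]
          by (simp add: theta_hat_def y_def mv.add_right matrix_vector_mul_assoc)
        have r1: "?Hw *v z = isig a *v z - ?Hw *v (?E *v (isig a *v z))" for z
        proof -
          have "?Hw *v z = (isig a - ?Hw ** ?E ** isig a) *v z" using resolvent(1)[OF B, of a] by simp
          then show ?thesis by (simp add: mv.diff_left matrix_vector_mul_assoc matrix_mul_assoc)
        qed
        have "pred_shift m ?B (\<lambda>i. u i w) = D a *v (isig a *v u a w) - D a *v (?Hw *v u a w) + D a *v (?Hw *v (X a *v ?g))"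
          unfolding pred_shift_def th K_def by (simp add: mv.diff_right matrix_vector_mul_assoc[symmetric])
        also have "D a *v (isig a *v u a w) - D a *v (?Hw *v u a w) = D a *v (?Hw *v (?E *v (isig a *v u a w)))"
          using r1[of "u a w"] by (simp add: mv.diff_right)
        also have "\<dots> = D a *v (isig a *v (?E *v (isig a *v u a w))) - D a *v (?Hw *v (?E *v (isig a *v (?E *v (isig a *v u a w)))))"
          using r1[of "?E *v (isig a *v u a w)"] by (simp add: mv.diff_right)
        also have "D a *v (?Hw *v (X a *v ?g)) = D a *v (?Hw *v (X a *v (?g - ?l))) + D a *v (?Hw *v (X a *v ?l))"
          by (simp add: mv.diff_right)
        also have "D a *v (?Hw *v (X a *v ?l)) = D a *v (isig a *v (X a *v ?l)) - D a *v (?Hw *v (?E *v (isig a *v (X a *v ?l))))"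
          using r1[of "X a *v ?l"] by (simp add: mv.diff_right)
        finally show "K *v ((?E - Dev m w) *v (isig a *v u a w))
     - D a *v (?Hw *v (?E *v (isig a *v (?E *v (isig a *v u a w)))))
     + D a *v (?Hw *v (X a *v (?g - ?l)))
     - D a *v (?Hw *v (?E *v (isig a *v (X a *v ?l))))
     = pred_shift m ?B (\<lambda>i. u i w) - lead m w"
          by (simp add: lead_def K_def mv.diff_left[of ?E] mv.diff_right mv.add_right matrix_vector_mul_assoc[symmetric])
      qed
    qed
  qed
qed

section \<open>The Bayes error\<close>

definition bayes_err :: "'a \<Rightarrow> real^'k" where "bayes_err w = \<epsilon> a w - K *v u a w"

text \<open>The Bayes error is -K v_a + (I - K) \<epsilon>_a with independent summands. With T =
  \<open>isig a\<close> one has I - K = Psi T, and D_a T Psi = Psi T D_a since both equal Psi - Psi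
  T Psi; the two covariances then add up to Psi T (Psi + D_a) T D_a.\<close>

lemma bayes_err_normal: "centred_normal M bayes_err (G1 D a Psi)"
proof -
  let ?T = "isig a" and ?I = "mat 1 - K"
  have "indep_var borel ((\<lambda>x. (- K) *v x) \<circ> v a) borel ((\<lambda>x. ?I *v x) \<circ> \<epsilon> a)"
    by (rule indep_var_compose[OF indep_v_eps]) auto
  then have ind: "indep_var borel (\<lambda>w. (- K) *v v a w) borel (\<lambda>w. ?I *v \<epsilon> a w)" by (simp add: comp_def)
  have 1: "?I = Psi ** ?T"
  proof -
    have "?I = sig a ** ?T - D a ** ?T" by (simp add: sig_isig K_def)
    then show ?thesis by (simp add: mm.diff_left[symmetric] sig_def)
  qed
  have 2: "transpose ?I = ?T ** Psi" unfolding 1 by (simp add: matrix_transpose_mul sig_facts Psi_sym)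
  have DTP: "D a ** ?T ** Psi = Psi ** ?T ** D a"
  proof -
    have "D a ** ?T ** Psi = (sig a - Psi) ** ?T ** Psi" by (simp add: sig_def)
    also have "\<dots> = Psi - Psi ** ?T ** Psi" by (simp add: mm.diff_left sig_isig)
    also have "\<dots> = Psi ** ?T ** (sig a - Psi)"
      by (simp add: mm.diff_right matrix_mul_assoc[symmetric] sig_isig)
    finally show ?thesis by (simp add: sig_def)
  qed
  have "K ** Psi ** transpose K + ?I ** D a ** transpose ?I
     = (D a ** ?T ** Psi) ** ?T ** D a + Psi ** ?T ** (D a ** ?T ** Psi)"
    unfolding 2 unfolding 1 K_transpose by (simp add: K_def matrix_mul_assoc)
  also have "\<dots> = Psi ** ?T ** sig a ** ?T ** D a"
    unfolding DTP by (simp add: sig_def mm.add_left mm.add_right matrix_mul_assoc add.commute)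
  also have "\<dots> = Psi ** ?T ** (sig a ** ?T) ** D a" by (simp only: matrix_mul_assoc)
  also have "\<dots> = G1 D a Psi" by (simp add: sig_isig G1_eq)
  finally have cov: "K ** Psi ** transpose K + ?I ** D a ** transpose ?I = G1 D a Psi" .
  have neg: "(- K) ** Psi ** transpose (- K) = K ** Psi ** transpose K"
    using transpose_diff[of 0 K] by (simp add: mm.minus_left mm.minus_right transpose_def vec_eq_iff)
      (simp add: matrix_matrix_mult_def sum_negf)
  have "centred_normal M (\<lambda>w. (- K) *v v a w + ?I *v \<epsilon> a w) ((- K) ** Psi ** transpose (- K) + ?I ** D a ** transpose ?I)"
    by (intro centred_normal_add[OF ind] centred_normal_linear v_centred_normal eps_centred_normal)
  moreover have "(- K) *v v a w + ?I *v \<epsilon> a w = bayes_err w" for w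
    by (simp add: bayes_err_def u_def mv.add_right mv.diff_left mv.minus_left)
  ultimately show ?thesis by (simp add: neg cov)
qed

text \<open>G takes the whole sequence, while the proof has to split u_a from the other coordinates;
  measurability is therefore demanded along every measurable family on such a product space. The
  remaining coordinates play the part of Z in \<open>conditional_error_orthogonal\<close>.\<close>

lemma bayes_err_orthogonal:
  fixes G :: "(nat \<Rightarrow> real^'k) \<Rightarrow> real"
  assumes G: "\<And>(N :: ((real^'k) \<times> (nat + nat \<Rightarrow> real^'k)) measure) Y.
     (\<And>i. Y i \<in> borel_measurable N) \<Longrightarrow> (\<lambda>z. G (\<lambda>i. Y i z)) \<in> borel_measurable N"
  shows "expectation (\<lambda>w. bayes_err w $ p * G (\<lambda>i. u i w)) = 0"
proof -
  define A :: "(nat + nat) set" where "A = {Inl a, Inr a}"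
  define f where "f j = (case j of Inl i \<Rightarrow> v i | Inr i \<Rightarrow> \<epsilon> i)" for j :: "nat + nat"
  define R where "R C w = restrict (\<lambda>j. f j w) C" for C and w :: 'a
  let ?N = "PiM (- A) (\<lambda>_. borel :: (real^'k) measure)" and ?A = "PiM A (\<lambda>_. borel :: (real^'k) measure)"
  let ?B = "borel \<Otimes>\<^sub>M borel :: ((real^'k) \<times> (real^'k)) measure"
  have fm [measurable]: "f j \<in> borel_measurable M" for j by (cases j) (auto simp: f_def)
  have Rm [measurable]: "R C \<in> M \<rightarrow>\<^sub>M PiM C (\<lambda>_. borel)" for C
    unfolding R_def[abs_def] by measurable
  have "indep_var ?A (R A) ?N (R (- A))"
    using indep_var_restrict[OF indep, of A "- A"] by (simp add: R_def[abs_def] f_def[symmetric])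
  then have J: "distr M ?A (R A) \<Otimes>\<^sub>M distr M ?N (R (- A)) = distr M (?A \<Otimes>\<^sub>M ?N) (\<lambda>w. (R A w, R (- A) w))"
    by (simp add: indep_var_distribution_eq)
  let ?\<phi> = "\<lambda>h :: nat + nat \<Rightarrow> real^'k. (h (Inl a), h (Inr a))"
  have [measurable]: "(\<lambda>h. h (Inl a)) \<in> ?A \<rightarrow>\<^sub>M borel" "(\<lambda>h. h (Inr a)) \<in> ?A \<rightarrow>\<^sub>M borel"
    by (rule measurable_component_singleton, simp add: A_def)+
  have \<phi>R: "?\<phi> (R A w) = (v a w, \<epsilon> a w)" for w by (simp add: R_def A_def f_def)
  interpret Q: prob_space "distr M ?N (R (- A))" by (rule prob_space_distr) measurable
  have dQ: "distr (distr M ?N (R (- A))) ?N (\<lambda>z. z) = distr M ?N (R (- A))"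
    by (simp add: distr_distr comp_def)
  have dV: "distr (distr M ?A (R A)) ?B ?\<phi> = distr M ?B (\<lambda>w. (v a w, \<epsilon> a w))"
    by (subst distr_distr) (simp_all add: comp_def \<phi>R)
  have "distr M ?B (\<lambda>w. (v a w, \<epsilon> a w)) \<Otimes>\<^sub>M distr M ?N (R (- A))
      = distr (distr M ?A (R A) \<Otimes>\<^sub>M distr M ?N (R (- A))) (?B \<Otimes>\<^sub>M ?N) (\<lambda>(h, z). (?\<phi> h, z))"
    unfolding dV[symmetric] by (subst (1) dQ[symmetric], rule pair_measure_distr) (auto simp: dQ Q.sigma_finite_measure_axioms)
  also have "\<dots> = distr M (?B \<Otimes>\<^sub>M ?N) (\<lambda>w. ((v a w, \<epsilon> a w), R (- A) w))"
    unfolding J by (subst distr_distr) (simp_all add: comp_def \<phi>R)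
  finally have indZ: "distr M ?B (\<lambda>w. (v a w, \<epsilon> a w)) \<Otimes>\<^sub>M distr M ?N (R (- A))
      = distr M (?B \<Otimes>\<^sub>M ?N) (\<lambda>w. ((v a w, \<epsilon> a w), R (- A) w))" .
  \<comment> \<open>Reassembles the family u from u_a and the coordinates of the other
    areas.\<close>
  define g where "g x z = G (\<lambda>i. if i = a then x else z (Inl i) + z (Inr i))" for x :: "real^'k" and z
  have "(\<lambda>p. G (\<lambda>i. if i = a then fst p else snd p (Inl i) + snd p (Inr i))) \<in> borel_measurable (borel \<Otimes>\<^sub>M ?N)"
  proof (rule G)
    fix i
    show "(\<lambda>p. if i = a then fst p else snd p (Inl i) + snd p (Inr i)) \<in> borel_measurable (borel \<Otimes>\<^sub>M ?N)"
    proof (cases "i = a")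
      case False
      have [measurable]: "(\<lambda>h. h (Inl i)) \<in> ?N \<rightarrow>\<^sub>M borel" "(\<lambda>h. h (Inr i)) \<in> ?N \<rightarrow>\<^sub>M borel"
        by (rule measurable_component_singleton, use False in \<open>simp add: A_def\<close>)+
      show ?thesis using False by simp
    qed simp
  qed
  then have gm: "case_prod g \<in> borel_measurable (borel \<Otimes>\<^sub>M ?N)"
    by (simp add: g_def case_prod_beta')
  have "expectation (\<lambda>w. (\<epsilon> a w - (D a ** matrix_inv (Psi + D a)) *v (v a w + \<epsilon> a w)) $ p * g (v a w + \<epsilon> a w) (R (- A) w)) = 0"
    by (rule conditional_error_orthogonal[OF Psi_pos D_pos_def plus_D(2)[OF Psi_psd] v_normal eps_normal indep_v_eps Rm indZ gm])
  moreover have "g (v a w + \<epsilon> a w) (R (- A) w) = G (\<lambda>i. u i w)" for w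
    unfolding g_def by (rule arg_cong[of _ _ G]) (auto simp: fun_eq_iff u_def R_def A_def f_def)
  ultimately show ?thesis by (simp add: bayes_err_def K_def isig_def sig_def u_def)
qed

section \<open>Second moments of the leading term\<close>

lemma u_pair_indep:
  assumes ij: "i \<noteq> j" and [measurable]: "h \<in> borel_measurable borel" "h' \<in> borel_measurable borel"
  shows "indep_var borel (\<lambda>w. h (u i w) :: real) borel (\<lambda>w. h' (u j w) :: real)"
proof -
  have ind: "indep_var (PiM {i} (\<lambda>_. borel)) (\<lambda>w. restrict (\<lambda>i. u i w) {i}) (PiM {j} (\<lambda>_. borel)) (\<lambda>w. restrict (\<lambda>i. u i w) {j})"
    by (rule indep_var_restrict[OF indep_u]) (use ij in auto)
  have "indep_var borel ((\<lambda>f. h (f i)) \<circ> (\<lambda>w. restrict (\<lambda>i. u i w) {i})) borel ((\<lambda>f. h' (f j)) \<circ> (\<lambda>w. restrict (\<lambda>i. u i w) {j}))"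
    by (rule indep_var_compose[OF ind]) auto
  then show ?thesis by (simp add: comp_def)
qed

lemma u_rest_integral:
  assumes [measurable]: "h \<in> borel_measurable borel" "h' \<in> borel_measurable (PiM (UNIV - {a}) (\<lambda>_. borel))"
    and int: "integrable M (\<lambda>w. h (u a w) :: real)" "integrable M (\<lambda>w. h' (restrict (\<lambda>i. u i w) (UNIV - {a})) :: real)"
  shows "expectation (\<lambda>w. h (u a w) * h' (restrict (\<lambda>i. u i w) (UNIV - {a})))
     = expectation (\<lambda>w. h (u a w)) * expectation (\<lambda>w. h' (restrict (\<lambda>i. u i w) (UNIV - {a})))"
proof -
  have ind: "indep_var (PiM {a} (\<lambda>_. borel)) (\<lambda>w. restrict (\<lambda>i. u i w) {a}) (PiM (UNIV - {a}) (\<lambda>_. borel)) (\<lambda>w. restrict (\<lambda>i. u i w) (UNIV - {a}))"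
    by (rule indep_var_restrict[OF indep_u]) auto
  have "indep_var borel ((\<lambda>f. h (f a)) \<circ> (\<lambda>w. restrict (\<lambda>i. u i w) {a})) borel (h' \<circ> (\<lambda>w. restrict (\<lambda>i. u i w) (UNIV - {a})))"
    by (rule indep_var_compose[OF ind]) auto
  then have "indep_var borel (\<lambda>w. h (u a w)) borel (\<lambda>w. h' (restrict (\<lambda>i. u i w) (UNIV - {a})))"
    by (simp add: comp_def)
  then show ?thesis by (rule indep_var_lebesgue_integral[OF _ int])
qed

definition dev_entry :: "nat \<Rightarrow> 'k \<Rightarrow> 'k \<Rightarrow> 'a \<Rightarrow> real" where
  "dev_entry i p q w = u i w $ p * u i w $ q - sig i $ p $ q"

lemma u_nth_mult_momO: "momO M 0 (\<lambda>m w. u i w $ p * u i w $ q)"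
  using momO_mult[OF momO_nth[OF u_momO] momO_nth[OF u_momO]] by simp

lemma dev_entry_momO: "momO M 0 (\<lambda>m. dev_entry i p q)"
  unfolding dev_entry_def[abs_def] by (intro momO_diff u_nth_mult_momO momO_const_0)

lemma dev_entry_mult_integrable: "integrable M (\<lambda>w. dev_entry i p q w * dev_entry j r l w)"
  using momO_mult[OF dev_entry_momO dev_entry_momO] by (rule momO_integrable)

lemma dev_entry_mean: "expectation (dev_entry i p q) = 0"
  unfolding dev_entry_def[abs_def] using momO_integrable[OF u_nth_mult_momO]
  by (simp add: centred_normal_nth[OF u_centred_normal] prob_space)

text \<open>Of the three pairings in the fourth moment, the one within each factor is the product of
  the means and is removed by centring. Different areas are independent.\<close>

lemma dev_entry_cov:
  "expectation (\<lambda>w. dev_entry i p r w * dev_entry j q l w)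
   = (if i = j then sig i $ p $ q * sig i $ r $ l + sig i $ p $ l * sig i $ r $ q else 0)"
proof (cases "i = j")
  case True
  have i1: "integrable M (\<lambda>w. u i w $ p * u i w $ r * (u i w $ q * u i w $ l))"
    using momO_mult[OF u_nth_mult_momO u_nth_mult_momO] by (rule momO_integrable)
  note i2 = momO_integrable[OF u_nth_mult_momO]
  have "dev_entry i p r w * dev_entry i q l w = u i w $ p * u i w $ r * (u i w $ q * u i w $ l)
      - sig i $ q $ l * (u i w $ p * u i w $ r) - sig i $ p $ r * (u i w $ q * u i w $ l) + sig i $ p $ r * sig i $ q $ l" for w
    by (simp add: dev_entry_def algebra_simps)
  then have "expectation (\<lambda>w. dev_entry i p r w * dev_entry i q l w) = expectation (\<lambda>w. u i w $ p * u i w $ r * (u i w $ q * u i w $ l)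
      - sig i $ q $ l * (u i w $ p * u i w $ r) - sig i $ p $ r * (u i w $ q * u i w $ l) + sig i $ p $ r * sig i $ q $ l)"
    by presburger
  also have "\<dots> = sig i $ p $ q * sig i $ r $ l + sig i $ p $ l * sig i $ r $ q"
    using i1 i2 by (simp add: centred_normal_nth[OF u_centred_normal] prob_space)
  finally show ?thesis using True by simp
next
  case False
  have "indep_var borel (dev_entry i p r) borel (dev_entry j q l)"
    unfolding dev_entry_def[abs_def]
    by (rule u_pair_indep[OF False, of "\<lambda>x. x $ p * x $ r - sig i $ p $ r" "\<lambda>x. x $ q * x $ l - sig j $ q $ l"]) measurable
  from indep_var_lebesgue_integral[OF this momO_integrable[OF dev_entry_momO] momO_integrable[OF dev_entry_momO]]
  show ?thesis using False by (simp add: dev_entry_mean)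
qed

lemma Dev_nth: "Dev m w $ p $ q = (1 / real m) * (\<Sum>i\<in>{..<m} - {a}. dev_entry i p q w)"
  by (simp add: Dev_def dev_entry_def)

lemma Dev_cov:
  "expectation (\<lambda>w. Dev m w $ p $ r * Dev m w $ q $ l)
   = 1 / (real m)\<^sup>2 * (\<Sum>i\<in>{..<m} - {a}. sig i $ p $ q * sig i $ r $ l + sig i $ p $ l * sig i $ r $ q)"
proof -
  let ?J = "{..<m} - {a}"
  have "Dev m w $ p $ r * Dev m w $ q $ l = 1 / (real m)\<^sup>2 * (\<Sum>i\<in>?J. \<Sum>j\<in>?J. dev_entry i p r w * dev_entry j q l w)" for w
    by (simp add: Dev_nth sum_product power2_eq_square)
  then have "expectation (\<lambda>w. Dev m w $ p $ r * Dev m w $ q $ l)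
     = 1 / (real m)\<^sup>2 * (\<Sum>i\<in>?J. \<Sum>j\<in>?J. expectation (\<lambda>w. dev_entry i p r w * dev_entry j q l w))"
    using dev_entry_mult_integrable by simp
  also have "\<dots> = 1 / (real m)\<^sup>2 * (\<Sum>i\<in>?J. sig i $ p $ q * sig i $ r $ l + sig i $ p $ l * sig i $ r $ q)"
    unfolding dev_entry_cov by (simp add: sum.delta)
  finally show ?thesis .
qed

definition score :: "'a \<Rightarrow> real^'k" where "score w = isig a *v u a w"

lemma score_normal: "centred_normal M score (isig a)"
proof -
  have "centred_normal M score (isig a ** sig a ** transpose (isig a))"
    unfolding score_def[abs_def] by (rule centred_normal_linear[OF u_centred_normal])
  then show ?thesis by (simp add: sig_isig sig_facts)
qed

text \<open>At fixed m the sequence is constant, and order 0 just says that all moments are finite;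
  this serves to provide integrability.\<close>

lemma Dev_fixed_momO: "momO M 0 (\<lambda>_::nat. Dev m)"
proof (intro momO_vec)
  fix p q
  show "momO M 0 (\<lambda>_ w. Dev m w $ p $ q)" unfolding Dev_nth
    by (intro momO_cmult momO_sum dev_entry_momO)
qed

lemma gls_lead_fixed_normal: "centred_normal M (gls_lead m)
   (\<Sum>i\<in>{..<m} - {a}. weight m i ** sig i ** transpose (weight m i))"
  unfolding gls_lead_def[abs_def] by (rule linear_normal) simp

text \<open>\<open>Dev\<close> and \<open>gls_lead\<close> as functions of the family without \<open>u\<^sub>a\<close>, which is independent of \<open>u\<^sub>a\<close>.\<close>

definition Dev_fun :: "nat \<Rightarrow> (nat \<Rightarrow> real^'k) \<Rightarrow> real^'k^'k" where
  "Dev_fun m f = (1 / real m) *\<^sub>R (\<Sum>i\<in>{..<m} - {a}. outer (f i) (f i) - sig i)"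

definition gls_lead_fun :: "nat \<Rightarrow> (nat \<Rightarrow> real^'k) \<Rightarrow> real^'s" where
  "gls_lead_fun m f = (\<Sum>i\<in>{..<m} - {a}. weight m i *v f i)"

lemma rest_fun:
  "Dev m w = Dev_fun m (restrict (\<lambda>i. u i w) (UNIV - {a}))"
  "gls_lead m w = gls_lead_fun m (restrict (\<lambda>i. u i w) (UNIV - {a}))"
  "Dev_fun m \<in> borel_measurable (PiM (UNIV - {a}) (\<lambda>_. borel))"
  "gls_lead_fun m \<in> borel_measurable (PiM (UNIV - {a}) (\<lambda>_. borel))"
proof -
  have m: "(\<lambda>f. f i) \<in> borel_measurable (PiM (UNIV - {a}) (\<lambda>_. borel :: (real^'k) measure))" if "i \<in> {..<m} - {a}" for i
    using that by (intro measurable_component_singleton) auto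
  show "Dev m w = Dev_fun m (restrict (\<lambda>i. u i w) (UNIV - {a}))"
    unfolding Dev_def Dev_fun_def by (auto intro!: arg_cong[of _ _ "scaleR _"] sum.cong)
  show "gls_lead m w = gls_lead_fun m (restrict (\<lambda>i. u i w) (UNIV - {a}))"
    unfolding gls_lead_def gls_lead_fun_def by (auto intro!: sum.cong)
  show "Dev_fun m \<in> borel_measurable (PiM (UNIV - {a}) (\<lambda>_. borel))"
    unfolding Dev_fun_def[abs_def]
    by (intro borel_measurable_scaleR borel_measurable_const borel_measurable_sum borel_measurable_diff borel_measurable_outer m)
  show "gls_lead_fun m \<in> borel_measurable (PiM (UNIV - {a}) (\<lambda>_. borel))"
    unfolding gls_lead_fun_def[abs_def]
    by (intro borel_measurable_sum borel_measurable_matrix_vector borel_measurable_const m)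
qed

lemma score_rest_integral:
  assumes h [measurable]: "h \<in> borel_measurable borel" and h' [measurable]: "case_prod h' \<in> borel_measurable (borel \<Otimes>\<^sub>M borel)"
    and int: "integrable M (\<lambda>w. h (score w) :: real)" "integrable M (\<lambda>w. h' (Dev m w) (gls_lead m w) :: real)"
  shows "expectation (\<lambda>w. h (score w) * h' (Dev m w) (gls_lead m w)) = expectation (\<lambda>w. h (score w)) * expectation (\<lambda>w. h' (Dev m w) (gls_lead m w))"
proof -
  note [measurable] = rest_fun(3,4)
  have m: "(\<lambda>f. h' (Dev_fun m f) (gls_lead_fun m f)) \<in> borel_measurable (PiM (UNIV - {a}) (\<lambda>_. borel))"
    using measurable_compose[OF measurable_Pair[OF rest_fun(3)[of m] rest_fun(4)[of m]] h'] by simp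
  have m1: "(\<lambda>x. h (isig a *v x)) \<in> borel_measurable borel" by measurable
  show ?thesis
    using u_rest_integral[OF m1 m] int by (simp add: rest_fun(1,2)[symmetric] score_def)
qed

text \<open>\<open>score\<close> has mean zero and is independent of the pair of \<open>Dev\<close>
  and \<open>gls_lead\<close>, so its expectation splits off as a zero factor.\<close>

lemma lead_cross:
  "expectation (\<lambda>w. (Dev m w *v score w) $ p * (X a *v gls_lead m w) $ q) = 0"
proof -

  let ?h = "\<lambda>r (A :: real^'k^'k) (b :: real^'s). A $ p $ r * (X a *v b) $ q"
  have hm: "case_prod (?h r) \<in> borel_measurable (borel \<Otimes>\<^sub>M borel)" for r
    by measurable
  have lm: "momO M 0 (\<lambda>_::nat. (\<lambda>w. (X a *v gls_lead m w) $ q))"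
    using momO_nth[OF momO_mv[OF momO_const_0 centred_normal_momO_0[OF gls_lead_fixed_normal]]] by simp
  have hi: "integrable M (\<lambda>w. ?h r (Dev m w) (gls_lead m w))" for r
    using momO_mult[OF momO_nth[OF momO_nth[OF Dev_fixed_momO]] lm] by (rule momO_integrable)
  have si: "integrable M (\<lambda>w. score w $ r)" for r
    using momO_nth[OF centred_normal_momO_0[OF score_normal]] by (rule momO_integrable)
  have pi: "integrable M (\<lambda>w. score w $ r * ?h r (Dev m w) (gls_lead m w))" for r
    using momO_mult[OF momO_nth[OF centred_normal_momO_0[OF score_normal]] momO_mult[OF momO_nth[OF momO_nth[OF Dev_fixed_momO]] lm]]
    by (rule momO_integrable)
  have "(Dev m w *v score w) $ p * (X a *v gls_lead m w) $ q = (\<Sum>r\<in>UNIV. score w $ r * ?h r (Dev m w) (gls_lead m w))" for w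
    by (subst (1) matrix_vector_mult_def) (simp add: sum_distrib_left sum_distrib_right mult_ac)
  then have "expectation (\<lambda>w. (Dev m w *v score w) $ p * (X a *v gls_lead m w) $ q)
     = (\<Sum>r\<in>UNIV. expectation (\<lambda>w. score w $ r * ?h r (Dev m w) (gls_lead m w)))"
    using pi by simp
  also have "\<dots> = (\<Sum>r\<in>UNIV. expectation (\<lambda>w. score w $ r) * expectation (\<lambda>w. ?h r (Dev m w) (gls_lead m w)))"
    by (intro sum.cong refl score_rest_integral[where h="\<lambda>x. x $ r" for r] hm si hi) measurable
  also have "\<dots> = 0" by (simp add: centred_normal_nth[OF score_normal])
  finally show ?thesis .
qed

definition G3_term :: "nat \<Rightarrow> real^'k^'k" where
  "G3_term i = sig i ** isig a ** sig i + trace (sig i ** isig a) *\<^sub>R sig i"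

text \<open>By independence the covariance \<open>isig a\<close> of \<open>score\<close> is
  contracted with the covariances of the entries of \<open>Dev\<close>. One pairing contracts to a
  trace times \<open>sig i\<close>, the other to \<open>sig i ** isig a ** sig i\<close>; this is
  the bracket in \<open>G3\<close>.\<close>

lemma lead_Dev_second:
  "expectation (\<lambda>w. (Dev m w *v score w) $ p * (Dev m w *v score w) $ q)
    = ((1 / (real m)\<^sup>2) *\<^sub>R (\<Sum>i\<in>{..<m} - {a}. G3_term i)) $ p $ q"
proof -
  let ?J = "{..<m} - {a}"
  let ?h = "\<lambda>r l (A :: real^'k^'k) (b :: real^'s). A $ p $ r * A $ q $ l"
  have hm: "case_prod (?h r l) \<in> borel_measurable (borel \<Otimes>\<^sub>M borel)" for r l
    by measurable
  have Dm: "momO M 0 (\<lambda>_ w. Dev m w $ p $ r * Dev m w $ q $ l)" for r l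
    using momO_mult[OF momO_nth[OF momO_nth[OF Dev_fixed_momO]] momO_nth[OF momO_nth[OF Dev_fixed_momO]]] by simp
  have sm: "momO M 0 (\<lambda>_ w. score w $ r * score w $ l)" for r l
    using momO_mult[OF momO_nth[OF centred_normal_momO_0[OF score_normal]] momO_nth[OF centred_normal_momO_0[OF score_normal]]] by simp
  have pi: "integrable M (\<lambda>w. (score w $ r * score w $ l) * ?h r l (Dev m w) (gls_lead m w))" for r l
    using momO_mult[OF sm Dm] by (rule momO_integrable)
  have "(Dev m w *v score w) $ p * (Dev m w *v score w) $ q
     = (\<Sum>r\<in>UNIV. \<Sum>l\<in>UNIV. (score w $ r * score w $ l) * ?h r l (Dev m w) (gls_lead m w))" for w
    by (simp add: matrix_vector_mult_def sum_product mult_ac)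
  then have "expectation (\<lambda>w. (Dev m w *v score w) $ p * (Dev m w *v score w) $ q)
     = (\<Sum>r\<in>UNIV. \<Sum>l\<in>UNIV. expectation (\<lambda>w. (score w $ r * score w $ l) * ?h r l (Dev m w) (gls_lead m w)))"
    using pi by simp
  also have "\<dots> = (\<Sum>r\<in>UNIV. \<Sum>l\<in>UNIV. isig a $ r $ l * (1 / (real m)\<^sup>2 * (\<Sum>i\<in>?J. sig i $ p $ q * sig i $ r $ l + sig i $ p $ l * sig i $ r $ q)))"
  proof (intro sum.cong refl)
    fix r l
    have "expectation (\<lambda>w. (score w $ r * score w $ l) * ?h r l (Dev m w) (gls_lead m w))
       = expectation (\<lambda>w. score w $ r * score w $ l) * expectation (\<lambda>w. ?h r l (Dev m w) (gls_lead m w))"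
      by (rule score_rest_integral[where h="\<lambda>x. x $ r * x $ l", OF _ hm momO_integrable[OF sm] momO_integrable[OF Dm]]) measurable
    then show "expectation (\<lambda>w. (score w $ r * score w $ l) * ?h r l (Dev m w) (gls_lead m w))
       = isig a $ r $ l * (1 / (real m)\<^sup>2 * (\<Sum>i\<in>?J. sig i $ p $ q * sig i $ r $ l + sig i $ p $ l * sig i $ r $ q))"
      by (simp add: centred_normal_nth[OF score_normal] Dev_cov)
  qed
  also have "\<dots> = (\<Sum>r\<in>UNIV. \<Sum>l\<in>UNIV. \<Sum>i\<in>?J. 1 / (real m)\<^sup>2 * (isig a $ r $ l * (sig i $ p $ q * sig i $ r $ l + sig i $ p $ l * sig i $ r $ q)))"
    by (simp add: sum_distrib_left mult_ac)
  also have "\<dots> = (\<Sum>r\<in>UNIV. \<Sum>i\<in>?J. \<Sum>l\<in>UNIV. 1 / (real m)\<^sup>2 * (isig a $ r $ l * (sig i $ p $ q * sig i $ r $ l + sig i $ p $ l * sig i $ r $ q)))"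
    by (intro sum.cong refl sum.swap)
  also have "\<dots> = (\<Sum>i\<in>?J. \<Sum>r\<in>UNIV. \<Sum>l\<in>UNIV. 1 / (real m)\<^sup>2 * (isig a $ r $ l * (sig i $ p $ q * sig i $ r $ l + sig i $ p $ l * sig i $ r $ q)))"
    by (rule sum.swap)
  also have "\<dots> = (\<Sum>i\<in>?J. 1 / (real m)\<^sup>2 * G3_term i $ p $ q)"
  proof (intro sum.cong refl)
    fix i
    have symI: "isig a $ s $ t = isig a $ t $ s" for s t
    proof -
      have "transpose (isig a) $ t $ s = isig a $ t $ s" by (simp only: sig_facts)
      then show ?thesis by (simp add: transpose_def)
    qed
    have tr: "trace (sig i ** isig a) = (\<Sum>r\<in>UNIV. \<Sum>l\<in>UNIV. sig i $ r $ l * isig a $ r $ l)"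
      unfolding trace_def matrix_matrix_mult_def by (simp add: symI)
    have mid: "(sig i ** isig a ** sig i) $ p $ q = (\<Sum>r\<in>UNIV. \<Sum>l\<in>UNIV. isig a $ r $ l * (sig i $ p $ l * sig i $ r $ q))"
      unfolding matrix_matrix_mult_def by (simp add: sum_distrib_right sum_distrib_left symI mult_ac)
    have "(\<Sum>r\<in>UNIV. \<Sum>l\<in>UNIV. 1 / (real m)\<^sup>2 * (isig a $ r $ l * (sig i $ p $ q * sig i $ r $ l + sig i $ p $ l * sig i $ r $ q)))
       = 1 / (real m)\<^sup>2 * ((\<Sum>r\<in>UNIV. \<Sum>l\<in>UNIV. isig a $ r $ l * (sig i $ p $ l * sig i $ r $ q))
          + (\<Sum>r\<in>UNIV. \<Sum>l\<in>UNIV. sig i $ r $ l * isig a $ r $ l) * sig i $ p $ q)"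
      unfolding sum_distrib_left sum_distrib_right sum.distrib[symmetric]
      by (intro sum.cong refl) (simp add: distrib_left mult_ac)
    then show "(\<Sum>r\<in>UNIV. \<Sum>l\<in>UNIV. 1 / (real m)\<^sup>2 * (isig a $ r $ l * (sig i $ p $ q * sig i $ r $ l + sig i $ p $ l * sig i $ r $ q)))
       = 1 / (real m)\<^sup>2 * G3_term i $ p $ q"
      by (simp add: G3_term_def tr mid)
  qed
  finally show ?thesis by (simp add: sum_distrib_left)
qed

text \<open>An identity at fixed m. With all areas included, the least squares part would have
  covariance S^-1 S S^-1 = S^-1, which gives \<open>G2\<close>, and the other part the full sum in
  \<open>G3\<close>. The subtracted term is what area a would have contributed.\<close>

lemma lead_second_moment:
  assumes inv: "invertible (S m Psi)" and am: "a < m"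
  shows "integrable M (\<lambda>w. outer (lead m w) (lead m w))"
    "expectation (\<lambda>w. outer (lead m w) (lead m w)) = G2 X D a m Psi + G3 D a m Psi
      - K ** ((1 / (real m)\<^sup>2) *\<^sub>R G3_term a + X a ** (weight m a ** sig a ** transpose (weight m a)) ** transpose (X a)) ** transpose K"
proof -
  let ?J = "{..<m} - {a}"
  let ?P = "\<lambda>w. Dev m w *v score w" and ?L = "\<lambda>w. X a *v gls_lead m w"
  have P0: "momO M 0 (\<lambda>_::nat. ?P)"
    using momO_mv[OF Dev_fixed_momO centred_normal_momO_0[OF score_normal]] by simp
  have L0: "momO M 0 (\<lambda>_::nat. ?L)"
    using momO_mv[OF momO_const_0 centred_normal_momO_0[OF gls_lead_fixed_normal]] by simp
  have int: "integrable M (\<lambda>w. outer (?P w) (?P w))" "integrable M (\<lambda>w. outer (?P w) (?L w))"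
    "integrable M (\<lambda>w. outer (?L w) (?P w))" "integrable M (\<lambda>w. outer (?L w) (?L w))"
    using momO_outer[OF P0 P0] momO_outer[OF P0 L0] momO_outer[OF L0 P0] momO_outer[OF L0 L0] momO_integrable by blast+
  have EPP: "expectation (\<lambda>w. outer (?P w) (?P w)) = (1 / (real m)\<^sup>2) *\<^sub>R (\<Sum>i\<in>?J. G3_term i)"
    unfolding vec_eq_iff integral_matrix_nth[OF int(1)] by (simp only: outer_nth lead_Dev_second) simp
  have EPL: "expectation (\<lambda>w. outer (?P w) (?L w)) = 0"
    unfolding vec_eq_iff integral_matrix_nth[OF int(2)] by (simp only: outer_nth lead_cross) simp
  have ELP: "expectation (\<lambda>w. outer (?L w) (?P w)) = 0"
    unfolding vec_eq_iff integral_matrix_nth[OF int(3)] by (simp only: outer_nth mult.commute[of "?L _ $ _"] lead_cross) simp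
  let ?Si = "matrix_inv (S m Psi)"
  have Sis: "transpose ?Si = ?Si" by (rule transpose_matrix_inv[OF inv S_sym[OF Psi_psd]])
  have W: "weight m i ** sig i ** transpose (weight m i) = ?Si ** (transpose (X i) ** isig i ** X i) ** ?Si" for i
  proof -
    have "weight m i ** sig i ** transpose (weight m i) = ?Si ** transpose (X i) ** (isig i ** sig i) ** isig i ** X i ** ?Si"
      by (simp only: weight_def matrix_transpose_mul sig_facts Sis transpose_transpose matrix_mul_assoc)
    also have "\<dots> = ?Si ** (transpose (X i) ** isig i ** X i) ** ?Si"
      unfolding sig_isig by (simp add: matrix_mul_assoc)
    finally show ?thesis .
  qed
  have "(\<Sum>i<m. weight m i ** sig i ** transpose (weight m i)) = ?Si ** S m Psi ** ?Si"
    unfolding W by (simp add: S_def mm.sum_left mm.sum_right isig_def sig_def)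
  also have "\<dots> = ?Si" by (simp add: matrix_inv_mult inv)
  finally have total: "(\<Sum>i<m. weight m i ** sig i ** transpose (weight m i)) = ?Si" .
  have "(\<Sum>i<m. weight m i ** sig i ** transpose (weight m i)) = weight m a ** sig a ** transpose (weight m a) + (\<Sum>i\<in>?J. weight m i ** sig i ** transpose (weight m i))"
    using am by (intro sum.remove) auto
  then have WJ: "(\<Sum>i\<in>?J. weight m i ** sig i ** transpose (weight m i)) = ?Si - weight m a ** sig a ** transpose (weight m a)"
    unfolding total by (simp add: algebra_simps)
  have ELL: "expectation (\<lambda>w. outer (?L w) (?L w)) = X a ** (?Si - weight m a ** sig a ** transpose (weight m a)) ** transpose (X a)"
    using centred_normal_outer(2)[OF centred_normal_linear[OF gls_lead_fixed_normal[of m], where A="X a"]]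
    unfolding WJ .
  have lin: "bounded_linear (\<lambda>A. K ** A ** transpose K)"
    by (intro bounded_linear_compose[OF mm.bounded_linear_left mm.bounded_linear_right])
  have lead: "outer (lead m w) (lead m w) = K ** (outer (?P w) (?P w) + outer (?P w) (?L w) + outer (?L w) (?P w) + outer (?L w) (?L w)) ** transpose K" for w
    unfolding lead_def score_def[symmetric] outer_mult[of K _ K] by (simp add: outer.add_left outer.add_right add_ac)
  have int': "integrable M (\<lambda>w. outer (?P w) (?P w) + outer (?P w) (?L w) + outer (?L w) (?P w) + outer (?L w) (?L w))"
    using int by simp
  show "integrable M (\<lambda>w. outer (lead m w) (lead m w))"
    unfolding lead by (rule integrable_bounded_linear[OF lin int'])
  have "expectation (\<lambda>w. outer (lead m w) (lead m w))
     = K ** ((1 / (real m)\<^sup>2) *\<^sub>R (\<Sum>i\<in>?J. G3_term i) + X a ** (?Si - weight m a ** sig a ** transpose (weight m a)) ** transpose (X a)) ** transpose K"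
    unfolding lead integral_bounded_linear[OF lin int'] using int by (simp add: EPP EPL ELP ELL)
  also have "(\<Sum>i\<in>?J. G3_term i) = (\<Sum>i<m. G3_term i) - G3_term a"
    using am sum.remove[of "{..<m}" a G3_term] by simp
  also have "K ** ((1 / (real m)\<^sup>2) *\<^sub>R ((\<Sum>i<m. G3_term i) - G3_term a) + X a ** (?Si - weight m a ** sig a ** transpose (weight m a)) ** transpose (X a)) ** transpose K
     = K ** X a ** ?Si ** transpose (X a) ** transpose K + K ** ((1 / (real m)\<^sup>2) *\<^sub>R (\<Sum>i<m. G3_term i)) ** transpose K
      - K ** ((1 / (real m)\<^sup>2) *\<^sub>R G3_term a + X a ** (weight m a ** sig a ** transpose (weight m a)) ** transpose (X a)) ** transpose K"
    by (simp add: mm.add_left mm.add_right mm.diff_left mm.diff_right mm.scaleR_left mm.scaleR_right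
        scaleR_diff_right matrix_mul_assoc)
  also have "K ** X a ** ?Si ** transpose (X a) ** transpose K = G2 X D a m Psi"
    unfolding K_transpose unfolding G2_def XtVinvX_S K_def isig_def sig_def by (simp add: matrix_mul_assoc)
  also have "K ** ((1 / (real m)\<^sup>2) *\<^sub>R (\<Sum>i<m. G3_term i)) ** transpose K = G3 D a m Psi"
    unfolding K_transpose unfolding G3_def K_def G3_term_def isig_def sig_def
    by (simp add: mm.scaleR_left mm.scaleR_right sum.distrib matrix_mul_assoc)
  finally show "expectation (\<lambda>w. outer (lead m w) (lead m w)) = G2 X D a m Psi + G3 D a m Psi
      - K ** ((1 / (real m)\<^sup>2) *\<^sub>R G3_term a + X a ** (weight m a ** sig a ** transpose (weight m a)) ** transpose (X a)) ** transpose K" .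
qed

text \<open>The contribution of area a carries 1/m^2 in \<open>G3\<close>; in \<open>G2\<close> its
  weight is O(1/m) and enters twice.\<close>

lemma lead_second_moment_order:
  obtains C where "\<forall>\<^sub>F m in sequentially. integrable M (\<lambda>w. outer (lead m w) (lead m w)) \<and>
    norm (expectation (\<lambda>w. outer (lead m w) (lead m w)) - (G2 X D a m Psi + G3 D a m Psi)) \<le> C * (1 / sqrt (real m)) ^ 4"
proof -
  obtain C where C: "C > 0" "\<forall>\<^sub>F m in sequentially. \<forall>i. norm (weight m i) \<le> C / real m * norm (X i)"
    by (rule gls_weight_bound)
  obtain d where d: "d > 0"
    "\<forall>\<^sub>F m in sequentially. \<forall>B. psd B \<longrightarrow> invertible (S m B) \<and> norm (matrix_inv (S m B)) \<le> d * (norm B + dhi) / real m"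
    by (rule inverse_bounds) blast
  let ?c = "norm K * (norm (G3_term a) + norm (X a) * (C * norm (X a) * csig * (C * norm (X a))) * norm (X a)) * norm K"
  have "\<forall>\<^sub>F m in sequentially. integrable M (\<lambda>w. outer (lead m w) (lead m w)) \<and>
    norm (expectation (\<lambda>w. outer (lead m w) (lead m w)) - (G2 X D a m Psi + G3 D a m Psi)) \<le> ?c * (1 / sqrt (real m)) ^ 4"
    using C(2) d(2) eventually_gt_at_top[of a]
  proof eventually_elim
    case (elim m)
    have inv: "invertible (S m Psi)" using elim Psi_psd by blast
    let ?B = "weight m a" and ?r = "1 / (real m)\<^sup>2"
    have B: "norm ?B \<le> C / real m * norm (X a)" using elim by blast
    have tB: "norm (transpose ?B) \<le> C / real m * norm (X a)" using B by (simp only: norm_transpose)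
    note lsm = lead_second_moment[OF inv elim(3)]
    have "norm (expectation (\<lambda>w. outer (lead m w) (lead m w)) - (G2 X D a m Psi + G3 D a m Psi))
       = norm (K ** (?r *\<^sub>R G3_term a + X a ** (?B ** sig a ** transpose ?B) ** transpose (X a)) ** transpose K)"
      unfolding lsm(2) by simp
    also have "\<dots> \<le> norm K * (?r * norm (G3_term a) + norm (X a) * (C / real m * norm (X a) * csig * (C / real m * norm (X a))) * norm (X a)) * norm K"
      by (intro norm_matrix_mult_mono order_trans[OF norm_triangle_ineq] add_mono B tB csig) (auto simp: norm_transpose)
    also have "\<dots> = ?c * ?r" by (simp add: power2_eq_square add_divide_distrib algebra_simps)
    also have "?r = (1 / sqrt (real m)) ^ 4" by (simp add: power_divide eval_nat_numeral)
    finally show ?case using lsm(1) by simp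
  qed
  then show ?thesis using that by blast
qed

section \<open>The mean squared error\<close>

lemma pred_shift_measurable:
  assumes [measurable]: "\<And>i. Y i \<in> borel_measurable N" "B \<in> borel_measurable N"
  shows "(\<lambda>w. pred_shift m (B w) (\<lambda>i. Y i w)) \<in> borel_measurable N"
  unfolding pred_shift_def theta_hat_def gls_def by measurable

lemma eb_error:
  "theta_hat X D a m B (\<lambda>i. y i w) - (X a *v \<beta> + v a w) = bayes_err w + pred_shift m B (\<lambda>i. u i w)"
  by (simp add: bayes_err_def pred_shift_def y_def u_def)

text \<open>The mixed terms of the Bayes error and \<open>pred_shift\<close> vanish exactly, not
  only asymptotically. Hence the mean squared error is \<open>G1\<close> plus the second moment of
  \<open>pred_shift\<close>, which is compared with that of \<open>lead\<close>.\<close>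

lemma MSEM_expansion:
  assumes est: "Psi_hat = Psi0_hat X D \<or> Psi_hat = Psi1_hat X D"
  shows "(\<lambda>m. norm (MSEM M (\<lambda>w. theta_hat X D a m (psd_part (Psi_hat m (\<lambda>i. y i w))) (\<lambda>i. y i w)) (\<lambda>w. X a *v \<beta> + v a w)
      - (G1 D a Psi + G2 X D a m Psi + G3 D a m Psi))) \<in> O(\<lambda>m. real m powr (-3/2))"
proof -
  let ?P = "\<lambda>m w. psd_part (Psi_hat m (\<lambda>i. y i w))"
  let ?W = "\<lambda>m w. pred_shift m (?P m w) (\<lambda>i. u i w)"
  have near: "near ?P" unfolding near_def using estimator_expansion[OF est] by simp
  note R = pred_shift_expansion[OF near]
  have W: "momO M 1 ?W"
    using momO_add[OF momO_mono[OF R, of 1] lead_momO] by simp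
  have e: "momO M 0 (\<lambda>_::nat. bayes_err)" by (rule centred_normal_momO_0[OF bayes_err_normal])
  \<comment> \<open>Estimator and predictor together depend on the u_i alone, as the orthogonality
    requires.\<close>
  have zero: "expectation (\<lambda>w. bayes_err w $ p * ?W m w $ q) = 0" for m p q
  proof -
    let ?G = "\<lambda>U. pred_shift m (psd_part (Psi_hat m (\<lambda>i. X i *v \<beta> + U i))) U $ q"
    have "expectation (\<lambda>w. bayes_err w $ p * ?G (\<lambda>i. u i w)) = 0"
    proof (rule bayes_err_orthogonal)
      fix N :: "((real^'k) \<times> (nat + nat \<Rightarrow> real^'k)) measure"
        and Y :: "nat \<Rightarrow> (real^'k) \<times> (nat + nat \<Rightarrow> real^'k) \<Rightarrow> real^'k"
      assume [measurable]: "\<And>i. Y i \<in> borel_measurable N"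
      have [measurable]: "(\<lambda>z. Psi_hat m (\<lambda>i. X i *v \<beta> + Y i z)) \<in> borel_measurable N"
        using est Psi_hat_measurable[of "\<lambda>i z. X i *v \<beta> + Y i z" N] by auto
      have [measurable]: "(\<lambda>z. pred_shift m (psd_part (Psi_hat m (\<lambda>i. X i *v \<beta> + Y i z))) (\<lambda>i. Y i z)) \<in> borel_measurable N"
        by (rule pred_shift_measurable) measurable
      show "(\<lambda>z. ?G (\<lambda>i. Y i z)) \<in> borel_measurable N" by measurable
    qed
    then show ?thesis by (simp add: y_def)
  qed
  \<comment> \<open>\<open>lead\<close> has order 1 and the remainder order 2, so the mixed terms
    have order 3; the square of the remainder has order 4.\<close>
  have "momO M 3 (\<lambda>m w. outer (lead m w) (?W m w - lead m w) + outer (?W m w - lead m w) (lead m w)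
      + outer (?W m w - lead m w) (?W m w - lead m w))"
    using momO_outer[OF lead_momO R] momO_outer[OF R lead_momO] momO_mono[OF momO_outer[OF R R], of 3]
    by (intro momO_add) (simp_all add: numeral_3_eq_3 numeral_2_eq_2)
  moreover have "outer x (z - x) + outer (z - x) x + outer (z - x) (z - x) = outer z z - outer x x" for x z :: "real^'k"
    by (simp add: outer.diff_left outer.diff_right)
  ultimately have "momO M 3 (\<lambda>m w. outer (?W m w) (?W m w) - outer (lead m w) (lead m w))" by simp
  then obtain C1 where C1: "\<forall>\<^sub>F m in sequentially. integrable M (\<lambda>w. outer (?W m w) (?W m w) - outer (lead m w) (lead m w)) \<and>
      norm (expectation (\<lambda>w. outer (?W m w) (?W m w) - outer (lead m w) (lead m w))) \<le> C1 * (1 / sqrt (real m)) ^ 3"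
    by (rule momO_expectation)
  obtain C2 where C2: "\<forall>\<^sub>F m in sequentially. integrable M (\<lambda>w. outer (lead m w) (lead m w)) \<and>
    norm (expectation (\<lambda>w. outer (lead m w) (lead m w)) - (G2 X D a m Psi + G3 D a m Psi)) \<le> C2 * (1 / sqrt (real m)) ^ 4"
    by (rule lead_second_moment_order)
  have eW: "\<forall>\<^sub>F m in sequentially. integrable M (\<lambda>w. outer (bayes_err w) (?W m w))"
    by (rule momO_expectation[OF momO_outer[OF e W]], erule eventually_mono, rule conjunct1)
  have We: "\<forall>\<^sub>F m in sequentially. integrable M (\<lambda>w. outer (?W m w) (bayes_err w))"
    by (rule momO_expectation[OF momO_outer[OF W e]], erule eventually_mono, rule conjunct1)
  have "\<forall>\<^sub>F m in sequentially. norm (norm (MSEM M (\<lambda>w. theta_hat X D a m (?P m w) (\<lambda>i. y i w)) (\<lambda>w. X a *v \<beta> + v a w)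
      - (G1 D a Psi + G2 X D a m Psi + G3 D a m Psi))) \<le> (\<bar>C1\<bar> + \<bar>C2\<bar>) * norm (real m powr (-3/2))"
    using C1 C2 eW We eventually_gt_at_top[of 0]
  proof eventually_elim
    case (elim m)
    let ?s = "1 / sqrt (real m)"
    have s: "0 \<le> ?s" "?s \<le> 1" using elim by auto
    have iW: "integrable M (\<lambda>w. outer (?W m w) (?W m w))"
      using Bochner_Integration.integrable_add[OF conjunct1[OF elim(1)] conjunct1[OF elim(2)]] by simp
    have z1: "expectation (\<lambda>w. outer (bayes_err w) (?W m w)) = 0"
      unfolding vec_eq_iff integral_matrix_nth[OF elim(3)] by (simp add: zero)
    have z2: "expectation (\<lambda>w. outer (?W m w) (bayes_err w)) = 0"
      unfolding vec_eq_iff integral_matrix_nth[OF elim(4)] by (simp add: zero mult.commute[of "?W m _ $ _"])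
    have "MSEM M (\<lambda>w. theta_hat X D a m (?P m w) (\<lambda>i. y i w)) (\<lambda>w. X a *v \<beta> + v a w)
       = expectation (\<lambda>w. outer (bayes_err w) (bayes_err w) + outer (bayes_err w) (?W m w)
          + outer (?W m w) (bayes_err w) + outer (?W m w) (?W m w))"
      unfolding MSEM_def eb_error by (simp add: outer.add_left outer.add_right add_ac)
    also have "\<dots> = G1 D a Psi + expectation (\<lambda>w. outer (?W m w) (?W m w))"
      using elim iW centred_normal_outer[OF bayes_err_normal] by (simp add: z1 z2)
    also have "expectation (\<lambda>w. outer (?W m w) (?W m w)) = expectation (\<lambda>w. outer (?W m w) (?W m w) - outer (lead m w) (lead m w))
        + expectation (\<lambda>w. outer (lead m w) (lead m w))"
      using elim iW by simp
    finally have "norm (MSEM M (\<lambda>w. theta_hat X D a m (?P m w) (\<lambda>i. y i w)) (\<lambda>w. X a *v \<beta> + v a w)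
        - (G1 D a Psi + G2 X D a m Psi + G3 D a m Psi))
      = norm (expectation (\<lambda>w. outer (?W m w) (?W m w) - outer (lead m w) (lead m w))
        + (expectation (\<lambda>w. outer (lead m w) (lead m w)) - (G2 X D a m Psi + G3 D a m Psi)))"
      by (simp add: algebra_simps)
    also have "\<dots> \<le> C1 * ?s ^ 3 + C2 * ?s ^ 4"
      using elim by (intro order_trans[OF norm_triangle_ineq] add_mono) auto
    \<comment> \<open>The constants have no known sign, hence the absolute values; the fourth power
      is absorbed as 1 / sqrt m is at most 1.\<close>
    also have "\<dots> \<le> \<bar>C1\<bar> * ?s ^ 3 + \<bar>C2\<bar> * ?s ^ 3"
      using s by (intro add_mono mult_mono power_decreasing) auto
    also have "?s ^ 3 = real m powr (-3/2)"
    proof -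
      have "?s = real m powr - (1 / 2)"
        using powr_minus[of "real m" "1 / 2"] powr_half_sqrt[of "real m"] by (simp add: inverse_eq_divide)
      then have "?s ^ 3 = (real m powr - (1 / 2)) ^ 3" by simp
      also have "\<dots> = real m powr (- (1 / 2) * 3)" by (subst powr_power) (use elim in auto)
      finally show ?thesis by simp
    qed
    finally show ?case by (simp add: algebra_simps)
  qed
  then show ?thesis by (rule bigoI)
qed

end

theorem theorem2:
  fixes M :: "'a measure"
    and X :: "nat \<Rightarrow> real^'s^'k"
    and D :: "nat \<Rightarrow> real^'k^'k"
    and Psi :: "real^'k^'k"
    and \<beta> :: "real^'s"
    and v \<epsilon> y :: "nat \<Rightarrow> 'a \<Rightarrow> real^'k"
    and Psi_hat :: "nat \<Rightarrow> (nat \<Rightarrow> real^'k) \<Rightarrow> real^'k^'k"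
    and Q :: "real^'s^'s"
    and dlo dhi :: real
    and a :: nat
  assumes prob: "prob_space M"
    and Psi_cov: "psd Psi" "invertible Psi"
    and D_cov: "\<And>i. psd (D i)"
    and indep: "prob_space.indep_vars M (\<lambda>_. borel)
                  (\<lambda>j. case j of Inl i \<Rightarrow> v i | Inr i \<Rightarrow> \<epsilon> i) (UNIV :: (nat + nat) set)"
    and v_normal: "\<And>i. distributed M lborel (v i) (\<lambda>x. ennreal (mvn_density 0 Psi x))"
    and eps_normal: "\<And>i. distributed M lborel (\<epsilon> i) (\<lambda>x. ennreal (mvn_density 0 (D i) x))"
    and model: "\<And>i w. y i w = X i *v \<beta> + v i w + \<epsilon> i w"
    and d_pos: "0 < dlo" "0 < dhi"
    and D_bounds: "\<And>i. loewner_le (dlo *\<^sub>R mat 1) (D i)" "\<And>i. loewner_le (D i) (dhi *\<^sub>R mat 1)"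
    and XtX_nonsing: "\<forall>\<^sub>F m in sequentially. invertible (XtX X m)"
    and XtX_lim: "(\<lambda>m. (1 / real m) *\<^sub>R XtX X m) \<longlonglongrightarrow> Q" "pos_def Q"
    and est: "Psi_hat = Psi0_hat X D \<or> Psi_hat = Psi1_hat X D"
  shows "G1 D a Psi = Psi ** matrix_inv (Psi + D a) ** D a \<and>
    (\<lambda>m. norm (MSEM M
              (\<lambda>w. theta_hat X D a m (psd_part (Psi_hat m (\<lambda>i. y i w))) (\<lambda>i. y i w))
              (\<lambda>w. X a *v \<beta> + v a w)
            - (G1 D a Psi + G2 X D a m Psi + G3 D a m Psi)))
      \<in> O(\<lambda>m. real m powr (-3/2))"
proof -
  interpret prob_space M by (rule prob)
  \<comment> \<open>An invertible semidefinite matrix is positive definite, and the Loewner bounds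
    are passed on as inequalities between quadratic forms.\<close>
  interpret F: fay_herriot_model M X D Psi dlo dhi Q \<beta> v \<epsilon> a
  proof
    show "pos_def Psi" by (rule psd_invertible_pos_def[OF Psi_cov])
    show "dlo * (x \<bullet> x) \<le> x \<bullet> (D i *v x)" for i x
      by (rule loewner_le_scaled_mat(1)[OF D_bounds(1)])
    show "x \<bullet> (D i *v x) \<le> dhi * (x \<bullet> x)" for i x
      by (rule loewner_le_scaled_mat(2)[OF D_bounds(2)])
  qed (fact D_cov d_pos XtX_lim indep v_normal eps_normal)+
  have "y = F.y" by (intro ext) (simp add: F.y_def F.u_def model add.assoc)
  then show ?thesis
    using F.G1_eq F.MSEM_expansion[OF est] by (simp add: F.isig_def F.sig_def)
qed

end
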